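(* Let $n\ge 1$ and let $T_1$ and $T_2$ be trees on $n$ vertices such that $T_2$ covers $T_1$ in the poset $\mathsf{GTS}_n$. Let $\mathcal{L}_{T_1}^q$ and $\mathcal{L}_{T_2}^q$ be their $q$-Laplacians. For $\lambda\vdash n$ and $j=1,2$ write $$d_{m_\lambda}(xI-\mathcal{L}_{T_j}^q)=\sum_{r=0}^n (-1)^r c_{m_\lambda,r}^{\mathcal{L}_{T_j}^q}(q)\,x^{n-r}.$$ Then for every $\lambda\vdash n$ and every $r=0,1,\ldots,n$, $$c_{m_\lambda,r}^{\mathcal{L}_{T_1}^q}(q)-c_{m_\lambda,r}^{\mathcal{L}_{T_2}^q}(q)\in\mathbb{R}^+[q^2].$$ Moreover, if $\lambda$ is not of the form $2^k,1^{n-2k}$ for any $k$, then $d_{m_\lambda}(xI-\mathcal{L}_{T_1}^q)=d_{m_\lambda}(xI-\mathcal{L}_{T_2}^q)=0$.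
   Context: Partitions are written in exponential notation: $2^k,1^{n-2k}$ denotes the partition of $n$ with $k$ parts equal to $2$ and $n-2k$ parts equal to $1$. $\mathbb{R}^+$ is the set of non-negative reals and $\mathbb{R}^+[q^2]$ the set of polynomials in $q^2$ with coefficients in $\mathbb{R}^+$. $q$-Laplacian: for a graph $G$ with degree diagonal matrix $D$ and adjacency matrix $A$, $\mathcal{L}_G^q=I+q^2(D-I)-qA$, where $q$ is a variable. Generalized matrix function: let $\Lambda^n_{\mathbb{Q}}$ be the space of homogeneous degree-$n$ symmetric functions over $\mathbb{Q}$, and let $\mathsf{ch}$ be the Frobenius characteristic map from class functions of the symmetric group $\mathfrak{S}_n$ to $\Lambda^n_{\mathbb{Q}}$, $\mathsf{ch}(g)=\sum_{\mu\vdash n} z_\mu^{-1}g(\mu)p_\mu$ (with $p_\mu$ the power sum symmetric functions and $g(\mu)$ the value of $g$ on permutations of cycle type $\mu$). For $\gamma\in\Lambda^n_{\mathbb{Q}}$ let $\Gamma_\gamma=\mathsf{ch}^{-1}(\gamma)$, and for an $n\times n$ matrix $A=(a_{i,j})$ define $d_\gamma(A)=\sum_{\psi\in\mathfrak{S}_n}\Gamma_\gamma(\psi)\prod_{i=1}^n a_{i,\psi(i)}$. Here $m_\lambda$ is the monomial symmetric function indexed by $\lambda$. Generalized tree shift (Csikvári): let $T$ be a tree and $x,y$ vertices such that all interior vertices of the $x$–$y$ path $P$ (if any) have degree $2$ in $T$; let $z$ be the neighbour of $y$ on $P$. The tree $T'$ obtained from $T$ by deleting all edges between $y$ and its neighbours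 other than $z$, and adding edges between $x$ and these same vertices, is a generalized tree shift of $T$. $\mathsf{GTS}_n$ is the partial order on isomorphism classes of trees on $n$ vertices given by the reflexive–transitive closure of the relation $T\le T'$ whenever $T'$ is a generalized tree shift of $T$ (the path is its minimum and the star its maximum). "$T_2$ covers $T_1$" means $T_1<T_2$ and there is no $T$ with $T_1<T<T_2$. *)

theory Defs
  imports
    "HOL-Library.Multiset"
    "HOL-Library.Poly_Mapping"
    "HOL-Combinatorics.Permutations"
    "HOL-Combinatorics.Orbits"
    "HOL-Computational_Algebra.Polynomial"
    "Jordan_Normal_Form.Matrix"
begin

section \<open>Partitions\<close>

definition is_partition :: "nat \<Rightarrow> nat multiset \<Rightarrow> bool" where
  "is_partition n \<mu> \<longleftrightarrow> 0 \<notin># \<mu> \<and> sum_mset \<mu> = n"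

definition z_factor :: "nat multiset \<Rightarrow> nat" where
  "z_factor \<mu> = (\<Prod>i\<in>set_mset \<mu>. i ^ count \<mu> i * fact (count \<mu> i))"


section \<open>Symmetric functions\<close>

text \<open>
  A formal power series over the rationals in the variables \<open>x\<^sub>0, x\<^sub>1, \<dots>\<close> is given by its
  coefficients: a monomial is a finitely supported exponent vector \<open>e\<close>, and \<open>f e\<close> is its
  coefficient in \<open>f\<close>. All symmetric functions below are such series.
\<close>

type_synonym series = "(nat \<Rightarrow>\<^sub>0 nat) \<Rightarrow> rat"

definition series_one :: series where
  "series_one e = (if e = 0 then 1 else 0)"

definition series_mult :: "series \<Rightarrow> series \<Rightarrow> series" where
  "series_mult f g e = (\<Sum>(a, b) \<in> {(a, b). a + b = e}. f a * g b)"

definition exponent_type :: "(nat \<Rightarrow>\<^sub>0 nat) \<Rightarrow> nat multiset" where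
  "exponent_type e = image_mset (Poly_Mapping.lookup e) (mset_set (Poly_Mapping.keys e))"

definition monomial_sym :: "nat multiset \<Rightarrow> series" where
  "monomial_sym \<mu> e = (if exponent_type e = \<mu> then 1 else 0)"

definition power_sum :: "nat \<Rightarrow> series" where
  "power_sum k e = (if \<exists>i. e = Poly_Mapping.single i k then 1 else 0)"

definition power_sum_sym :: "nat multiset \<Rightarrow> series" where
  "power_sum_sym \<mu> = foldr series_mult (map power_sum (sorted_list_of_multiset \<mu>)) series_one"


section \<open>The Frobenius characteristic and generalized matrix functions\<close>

definition cycle_type :: "nat \<Rightarrow> (nat \<Rightarrow> nat) \<Rightarrow> nat multiset" where
  "cycle_type n \<psi> = image_mset card (mset_set (orbit \<psi> ` {0..<n}))"

text \<open>
  The symmetric group is the set of permutations of \<open>{0..<n}\<close>. Functions on it are extended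
  by \<open>0\<close>, so that a class function is determined by its values on the group.
\<close>

definition class_functions :: "nat \<Rightarrow> ((nat \<Rightarrow> nat) \<Rightarrow> rat) set" where
  "class_functions n =
     {g. (\<forall>\<sigma> \<tau>. \<sigma> permutes {0..<n} \<longrightarrow> \<tau> permutes {0..<n} \<longrightarrow> g (\<sigma> \<circ> \<tau> \<circ> Hilbert_Choice.inv \<sigma>) = g \<tau>) \<and>
         (\<forall>\<tau>. \<not> \<tau> permutes {0..<n} \<longrightarrow> g \<tau> = 0)}"

definition class_value :: "nat \<Rightarrow> ((nat \<Rightarrow> nat) \<Rightarrow> rat) \<Rightarrow> nat multiset \<Rightarrow> rat" where
  "class_value n g \<mu> = g (SOME \<psi>. \<psi> permutes {0..<n} \<and> cycle_type n \<psi> = \<mu>)"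

definition frobenius_ch :: "nat \<Rightarrow> ((nat \<Rightarrow> nat) \<Rightarrow> rat) \<Rightarrow> series" where
  "frobenius_ch n g e =
     (\<Sum>\<mu> | is_partition n \<mu>. class_value n g \<mu> / of_nat (z_factor \<mu>) * power_sum_sym \<mu> e)"

text \<open>
  The Frobenius characteristic is a bijection from the class functions onto the homogeneous
  symmetric functions of degree \<open>n\<close>, so on the latter the following is its genuine inverse.
\<close>

definition frobenius_ch_inv :: "nat \<Rightarrow> series \<Rightarrow> (nat \<Rightarrow> nat) \<Rightarrow> rat" where
  "frobenius_ch_inv n \<gamma> = inv_into (class_functions n) (frobenius_ch n) \<gamma>"

text \<open>
  Entries lie in \<open>\<real>[q][x]\<close>: the inner polynomial variable is \<open>q\<close>, the outer one is \<open>x\<close>.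
\<close>

definition gen_matrix_fun :: "nat \<Rightarrow> series \<Rightarrow> real poly poly mat \<Rightarrow> real poly poly" where
  "gen_matrix_fun n \<gamma> A =
     (\<Sum>\<psi> | \<psi> permutes {0..<n}.
        [:[:of_rat (frobenius_ch_inv n \<gamma> \<psi>):]:] * (\<Prod>i = 0..<n. A $$ (i, \<psi> i)))"

definition x_minus :: "nat \<Rightarrow> real poly mat \<Rightarrow> real poly poly mat" where
  "x_minus n M = [:0, 1:] \<cdot>\<^sub>m 1\<^sub>m n - map_mat (\<lambda>p. [:p:]) M"

definition gen_char_poly :: "nat \<Rightarrow> series \<Rightarrow> real poly mat \<Rightarrow> real poly poly" where
  "gen_char_poly n \<gamma> M = gen_matrix_fun n \<gamma> (x_minus n M)"

definition gen_char_coeff :: "nat \<Rightarrow> series \<Rightarrow> real poly mat \<Rightarrow> nat \<Rightarrow> real poly" where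
  "gen_char_coeff n \<gamma> M r = (-1) ^ r * coeff (gen_char_poly n \<gamma> M) (n - r)"

lemma gen_char_poly_expansion:
  assumes M: "M \<in> carrier_mat n n"
  shows "gen_char_poly n \<gamma> M = (\<Sum>r = 0..n. monom ((-1) ^ r * gen_char_coeff n \<gamma> M r) (n - r))"
proof -
  have entry: "degree (x_minus n M $$ (i, j)) \<le> 1" if "i < n" "j < n" for i j
    using that M by (auto simp: x_minus_def intro!: degree_diff_le)
  have "degree (gen_char_poly n \<gamma> M) \<le> n"
    unfolding gen_char_poly_def gen_matrix_fun_def
  proof (intro degree_sum_le)
    show "finite {\<psi>. \<psi> permutes {0..<n}}"
      by (simp add: finite_permutations)
    fix \<psi> assume "\<psi> \<in> {\<psi>. \<psi> permutes {0..<n}}"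
    hence \<psi>: "\<psi> i < n" if "i < n" for i
      using that permutes_in_image[of \<psi> "{0..<n}" i] by auto
    have "degree (\<Prod>i = 0..<n. x_minus n M $$ (i, \<psi> i)) \<le>
        sum (degree \<circ> (\<lambda>i. x_minus n M $$ (i, \<psi> i))) {0..<n}"
      by (rule degree_prod_sum_le) simp
    also have "\<dots> \<le> (\<Sum>i = 0..<n. 1)"
      using entry \<psi> by (intro sum_mono) auto
    finally have "degree (\<Prod>i = 0..<n. x_minus n M $$ (i, \<psi> i)) \<le> n" by simp
    thus "degree ([:[:of_rat (frobenius_ch_inv n \<gamma> \<psi>):]:] *
        (\<Prod>i = 0..<n. x_minus n M $$ (i, \<psi> i))) \<le> n"
      by (intro order.trans[OF degree_mult_le]) simp
  qed
  hence "gen_char_poly n \<gamma> M = (\<Sum>i\<le>n. monom (coeff (gen_char_poly n \<gamma> M) i) i)"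
    by (rule poly_as_sum_of_monoms'[symmetric])
  also have "\<dots> = (\<Sum>r\<le>n. monom (coeff (gen_char_poly n \<gamma> M) (n - r)) (n - r))"
    by (rule sum.reindex_bij_witness[of _ "\<lambda>r. n - r" "\<lambda>r. n - r"]) auto
  also have "\<dots> = (\<Sum>r = 0..n. monom ((-1) ^ r * gen_char_coeff n \<gamma> M r) (n - r))"
    unfolding atLeast0AtMost
  proof (intro sum.cong refl)
    fix r
    have "((-1) ^ r * (-1) ^ r :: real poly) = 1"
      by (simp flip: power_add)
    thus "monom (coeff (gen_char_poly n \<gamma> M) (n - r)) (n - r) =
        monom ((-1) ^ r * gen_char_coeff n \<gamma> M r) (n - r)"
      by (simp only: gen_char_coeff_def mult.assoc[symmetric] mult_1)
  qed
  finally show ?thesis .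
qed


section \<open>Trees and their \<open>q\<close>-Laplacians\<close>

text \<open>
  A graph on \<open>n\<close> vertices is a symmetric irreflexive relation on \<open>{0..<n}\<close>.
\<close>

type_synonym graph = "(nat \<times> nat) set"

definition is_graph :: "nat \<Rightarrow> graph \<Rightarrow> bool" where
  "is_graph n E \<longleftrightarrow> E \<subseteq> {0..<n} \<times> {0..<n} \<and> sym E \<and> irrefl E"

definition is_path :: "graph \<Rightarrow> nat list \<Rightarrow> bool" where
  "is_path E p \<longleftrightarrow> distinct p \<and> successively (\<lambda>u v. (u, v) \<in> E) p"

definition is_cycle :: "graph \<Rightarrow> nat list \<Rightarrow> bool" where
  "is_cycle E p \<longleftrightarrow> 3 \<le> length p \<and> is_path E p \<and> (last p, hd p) \<in> E"

definition is_tree :: "nat \<Rightarrow> graph \<Rightarrow> bool" where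
  "is_tree n E \<longleftrightarrow> is_graph n E \<and> (\<forall>u<n. \<forall>v<n. (u, v) \<in> E\<^sup>*) \<and> (\<nexists>p. is_cycle E p)"

definition vertex_degree :: "graph \<Rightarrow> nat \<Rightarrow> nat" where
  "vertex_degree E v = card (E `` {v})"

definition degree_mat :: "nat \<Rightarrow> graph \<Rightarrow> real poly mat" where
  "degree_mat n E = mat n n (\<lambda>(i, j). if i = j then of_nat (vertex_degree E i) else 0)"

definition adjacency_mat :: "nat \<Rightarrow> graph \<Rightarrow> real poly mat" where
  "adjacency_mat n E = mat n n (\<lambda>(i, j). if (i, j) \<in> E then 1 else 0)"

definition q_laplacian :: "nat \<Rightarrow> graph \<Rightarrow> real poly mat" where
  "q_laplacian n E =
     (let q = [:0, 1:] in
      1\<^sub>m n + q ^ 2 \<cdot>\<^sub>m (degree_mat n E - 1\<^sub>m n) - q \<cdot>\<^sub>m adjacency_mat n E)"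

lemma q_laplacian_carrier: "q_laplacian n E \<in> carrier_mat n n"
  unfolding q_laplacian_def Let_def adjacency_mat_def
  by (intro minus_carrier_mat smult_carrier_mat mat_carrier)


section \<open>The poset of trees under generalized tree shifts\<close>

definition graph_iso :: "nat \<Rightarrow> graph \<Rightarrow> graph \<Rightarrow> bool" where
  "graph_iso n E E' \<longleftrightarrow> (\<exists>f. bij_betw f {0..<n} {0..<n} \<and> map_prod f f ` E = E')"

definition iso_class :: "nat \<Rightarrow> graph \<Rightarrow> graph set" where
  "iso_class n T = {T'. is_tree n T' \<and> graph_iso n T T'}"

definition tree_classes :: "nat \<Rightarrow> graph set set" where
  "tree_classes n = iso_class n ` {T. is_tree n T}"

definition gen_tree_shift :: "graph \<Rightarrow> graph \<Rightarrow> bool" where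
  "gen_tree_shift T T' \<longleftrightarrow>
     (\<exists>p x y z N.
        is_path T p \<and> 2 \<le> length p \<and> x = hd p \<and> y = last p \<and>
        (\<forall>v \<in> set p - {x, y}. vertex_degree T v = 2) \<and>
        z = last (butlast p) \<and> N = T `` {y} - {z} \<and>
        T' = (T - ({y} \<times> N \<union> N \<times> {y})) \<union> ({x} \<times> N \<union> N \<times> {x}))"

definition gts_le :: "nat \<Rightarrow> graph set \<Rightarrow> graph set \<Rightarrow> bool" where
  "gts_le n = (\<lambda>C C'. C \<in> tree_classes n \<and> C' \<in> tree_classes n \<and>
                       (\<exists>T \<in> C. \<exists>T' \<in> C'. gen_tree_shift T T'))\<^sup>*\<^sup>*"

definition gts_less :: "nat \<Rightarrow> graph set \<Rightarrow> graph set \<Rightarrow> bool" where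
  "gts_less n C C' \<longleftrightarrow> gts_le n C C' \<and> C \<noteq> C'"

definition gts_covers :: "nat \<Rightarrow> graph set \<Rightarrow> graph set \<Rightarrow> bool" where
  "gts_covers n C\<^sub>2 C\<^sub>1 \<longleftrightarrow>
     gts_less n C\<^sub>1 C\<^sub>2 \<and> \<not> (\<exists>C \<in> tree_classes n. gts_less n C\<^sub>1 C \<and> gts_less n C C\<^sub>2)"


section \<open>Polynomials in \<open>q\<^sup>2\<close> with non-negative coefficients\<close>

definition nonneg_polys_q2 :: "real poly set" where
  "nonneg_polys_q2 = {f \<circ>\<^sub>p monom 1 2 |f. \<forall>i. 0 \<le> coeff f i}"

end

theory Submission
  imports Defs
begin

text \<open>
  In a tree, a permutation contributes to a generalized matrix function of \<open>x I - \<L>\<close> only if it is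
  an involution along edges. Inverting the triangular system that expresses power sums by monomials
  shows that \<open>m\<^sub>\<lambda>\<close> with \<open>\<lambda> = 2\<^sup>k, 1\<^sup>n\<^sup>-\<^sup>2\<^sup>k\<close> corresponds to a class function with value
  \<open>2\<^sup>k (-1)\<^sup>j\<^sup>-\<^sup>k (j choose k)\<close> on involutions with \<open>j\<close> transpositions, and that all other \<open>m\<^sub>\<lambda>\<close> vanish on
  involutions. So, up to signs, all coefficients are collected by the single generating function
  \<open>Z(V)\<close>: the sum over the edge involutions of \<open>V\<close>, a fixed vertex \<open>v\<close> having weight
  \<open>x + 1 + q\<^sup>2 (deg v - 1)\<close> and a transposition having weight \<open>q\<^sup>2 (s - 1)\<close>, where \<open>s\<close> marks \<open>k\<close>.

  Expanding at a vertex \<open>v \<in> V\<close> with a neighbour outside \<open>V\<close> shows by induction that \<open>Z(V)\<close> and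
  \<open>Z(V) - Z(V - {v})\<close> have non-negative coefficients for every proper vertex subset \<open>V\<close>. For a shift
  along a path with ends \<open>x\<close> and \<open>y\<close>, let \<open>W\<close> be the set of the other vertices. Expanding at \<open>x\<close> and
  \<open>y\<close> and cancelling by the reflection of the path, the difference of the two generating functions
  becomes a sum, over off-path neighbours \<open>u\<close> of \<open>x\<close> and \<open>v\<close> of \<open>y\<close>, of
  \<open>q\<^sup>4 (Z(K) + (s - 1) Z(K - {u})) (Z(R) + (s - 1) Z(R - {v}))\<close>, where \<open>K\<close> is the part of \<open>W\<close> hanging
  off \<open>x\<close> and \<open>R\<close> is the rest; both factors have non-negative coefficients.
\<close>


section \<open>Conjugacy classes of the symmetric group\<close>

text \<open>The powers below the return time of \<open>x\<close> are distinct and fill the orbit, so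
  the return time is \<open>card (orbit f x)\<close> and exponents matter only modulo it.\<close>

lemma funpow_eq_iff_cong_card_orbit:
  assumes "permutation f"
  shows "(f ^^ a) x = (f ^^ b) x \<longleftrightarrow> a mod card (orbit f x) = b mod card (orbit f x)"
proof -
  let ?d = "funpow_dist1 f x x"
  have x: "x \<in> orbit f x" using assms by (rule permutation_self_in_orbit)
  have inj: "inj_on (\<lambda>n. (f ^^ n) x) {0..<?d}" using x by (rule inj_on_funpow_dist1)
  have c: "card (orbit f x) = ?d"
    using orbit_conv_funpow_dist1[OF x] card_image[OF inj] by simp
  have m: "(f ^^ a) x = (f ^^ (a mod ?d)) x" for a
    using funpow_mod_eq[OF funpow_dist1_prop[OF x]] by simp
  show ?thesis
  proof
    assume "(f ^^ a) x = (f ^^ b) x"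
    hence "(f ^^ (a mod ?d)) x = (f ^^ (b mod ?d)) x" using m[of a] m[of b] by simp
    thus "a mod card (orbit f x) = b mod card (orbit f x)"
      unfolding c by (rule inj_onD[OF inj]) simp_all
  next
    assume "a mod card (orbit f x) = b mod card (orbit f x)"
    thus "(f ^^ a) x = (f ^^ b) x" unfolding c using m[of a] m[of b] by metis
  qed
qed

lemma bij_betw_of_image_mset_eq:
  assumes "finite X" "finite Y" "image_mset f (mset_set X) = image_mset g (mset_set Y)"
  shows "\<exists>F. bij_betw F X Y \<and> (\<forall>x\<in>X. g (F x) = f x)"
  using assms
proof (induction X arbitrary: Y rule: finite_induct)
  case empty
  thus ?case by (auto simp: mset_set_empty_iff bij_betw_def)
next
  case (insert x X)
  have "f x \<in># image_mset g (mset_set Y)"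
    using insert.prems(2)[symmetric] insert.hyps by simp
  then obtain y where y: "y \<in> Y" "g y = f x" using insert.prems(1) by auto
  have Y: "Y = insert y (Y - {y})" using y by auto
  have "mset_set Y = add_mset y (mset_set (Y - {y}))"
    using insert.prems(1) y(1) by (simp add: mset_set.remove)
  hence "image_mset f (mset_set X) = image_mset g (mset_set (Y - {y}))"
    using insert.prems(2) insert.hyps y(2) by simp
  then obtain F where F: "bij_betw F X (Y - {y})" "\<forall>x\<in>X. g (F x) = f x"
    using insert.IH[of "Y - {y}"] insert.prems(1) by auto
  have "bij_betw (F(x := y)) (insert x X) Y"
  proof -
    have "bij_betw (F(x := y)) X (Y - {y})"
      using F(1) insert.hyps(2) by (subst bij_betw_cong[of X _ F]) auto
    moreover have "bij_betw (F(x := y)) {x} {y}" by (auto simp: bij_betw_def)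
    ultimately have "bij_betw (F(x := y)) ({x} \<union> X) ({y} \<union> (Y - {y}))"
      by (intro bij_betw_combine) auto
    thus ?thesis using Y by simp
  qed
  moreover have "\<forall>a\<in>insert x X. g ((F(x := y)) a) = f a" using F(2) y(2) insert.hyps(2) by auto
  ultimately show ?case by blast
qed

lemma orbit_permutes_eq:
  assumes "permutation f" "y \<in> orbit f x"
  shows "orbit f y = orbit f x"
  using assms by (meson orbit_cyclic_eq3 cyclic_on_orbit')

text \<open>Cycles of equal length are matched by \<open>F\<close>, a base point is chosen in each,
  and \<open>\<sigma>\<close> sends the \<open>k\<close>-th iterate of one base point to the
  \<open>k\<close>-th iterate of the other.\<close>

lemma conjugate_of_cycle_type_eq:
  assumes p: "\<psi> permutes {0..<n}" and p': "\<psi>' permutes {0..<n}"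
    and type: "cycle_type n \<psi> = cycle_type n \<psi>'"
  shows "\<exists>\<sigma>. \<sigma> permutes {0..<n} \<and> \<psi>' = \<sigma> \<circ> \<psi> \<circ> Hilbert_Choice.inv \<sigma>"
proof -
  have P: "permutation \<psi>" and P': "permutation \<psi>'"
    using p p' by (auto simp: permutation_permutes)
  obtain F where F: "bij_betw F (orbit \<psi> ` {0..<n}) (orbit \<psi>' ` {0..<n})"
    and Fc: "\<And>X. X \<in> orbit \<psi> ` {0..<n} \<Longrightarrow> card (F X) = card X"
    using bij_betw_of_image_mset_eq[of "orbit \<psi> ` {0..<n}" "orbit \<psi>' ` {0..<n}" card card] type
    unfolding cycle_type_def by auto
  \<comment> \<open>The base points depend on \<open>i\<close> only through its orbit, hence are
    constant along a cycle; \<open>r' i\<close> lies in the matched cycle.\<close>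
  define r where "r i = (SOME a. a \<in> orbit \<psi> i)" for i
  define r' where "r' i = (SOME a. a \<in> F (orbit \<psi> i))" for i
  have r: "r i \<in> orbit \<psi> i" for i
    unfolding r_def using orbit_nonempty[of \<psi> i] by (meson ex_in_conv someI_ex)
  have ro: "orbit \<psi> (r i) = orbit \<psi> i" for i using orbit_permutes_eq[OF P r] .
  have Fo: "\<exists>j<n. F (orbit \<psi> i) = orbit \<psi>' j" if "i < n" for i
  proof -
    have "F (orbit \<psi> i) \<in> orbit \<psi>' ` {0..<n}" using bij_betwE[OF F] that by simp
    thus ?thesis by auto
  qed
  have r': "r' i \<in> F (orbit \<psi> i)" if "i < n" for i
  proof -
    have "\<exists>a. a \<in> F (orbit \<psi> i)" using Fo[OF that] orbit_nonempty[of \<psi>'] by auto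
    thus ?thesis unfolding r'_def by (rule someI_ex)
  qed
  have ro': "orbit \<psi>' (r' i) = F (orbit \<psi> i)" if i: "i < n" for i
  proof -
    obtain j where j: "F (orbit \<psi> i) = orbit \<psi>' j" using Fo[OF i] by blast
    show ?thesis unfolding j using r'[OF i] unfolding j by (rule orbit_permutes_eq[OF P'])
  qed
  have rlt': "r' i < n" if "i < n" for i
    using Fo[OF that] r'[OF that] permutes_orbit_subset[OF p']
    by (metis atLeastLessThan_iff subset_iff zero_le)
  have lt: "(\<psi> ^^ k) i < n" "(\<psi>' ^^ k) i < n" if "i < n" for i k
    using that permutes_in_image[OF p] permutes_in_image[OF p'] by (induct k) auto
  define k where "k i = (SOME k. (\<psi> ^^ k) (r i) = i)" for i
  have k: "(\<psi> ^^ k i) (r i) = i" for i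
  proof -
    have "i \<in> orbit \<psi> (r i)" using permutation_self_in_orbit[OF P, of i] ro by simp
    hence "\<exists>k. (\<psi> ^^ k) (r i) = i" unfolding orbit_altdef by (auto intro: sym)
    thus ?thesis unfolding k_def by (rule someI_ex)
  qed
  define \<sigma> where "\<sigma> i = (if i < n then (\<psi>' ^^ k i) (r' i) else i)" for i
  \<comment> \<open>Matched cycles have equal length, so both equations are the same congruence.
    This yields that \<open>\<sigma>\<close> intertwines the permutations and that it is injective
    on each cycle.\<close>
  have key: "(\<psi> ^^ a) (r i) = (\<psi> ^^ b) (r i) \<longleftrightarrow> (\<psi>' ^^ a) (r' i) = (\<psi>' ^^ b) (r' i)" if "i < n" for i a b
  proof -
    have "card (orbit \<psi>' (r' i)) = card (orbit \<psi> (r i))"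
      unfolding ro' [OF that] ro using that by (intro Fc) simp
    thus ?thesis
      using funpow_eq_iff_cong_card_orbit[OF P, of a "r i" b] funpow_eq_iff_cong_card_orbit[OF P', of a "r' i" b]
      by (simp only:)
  qed
  have ostep: "orbit \<psi> (\<psi> i) = orbit \<psi> i" for i by (rule permutation_orbit_step[OF P])
  have comm: "\<sigma> (\<psi> i) = \<psi>' (\<sigma> i)" for i
  proof (cases "i < n")
    case True
    have eq: "r (\<psi> i) = r i" "r' (\<psi> i) = r' i" unfolding r_def r'_def ostep by auto
    have "(\<psi> ^^ k (\<psi> i)) (r i) = (\<psi> ^^ (Suc (k i))) (r i)"
      using k[of "\<psi> i"] unfolding eq by (simp add: k)
    hence "(\<psi>' ^^ k (\<psi> i)) (r' i) = (\<psi>' ^^ (Suc (k i))) (r' i)" using key[OF True] by blast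
    thus ?thesis using True lt(1)[of i 1] eq by (simp add: \<sigma>_def)
  next
    case False
    thus ?thesis using p p' by (simp add: \<sigma>_def permutes_def)
  qed
  have "inj_on \<sigma> {0..<n}"
  proof (rule inj_onI)
    fix i j assume ij: "i \<in> {0..<n}" "j \<in> {0..<n}" "\<sigma> i = \<sigma> j"
    hence i: "i < n" and j: "j < n" by auto
    have in_orb: "\<sigma> i \<in> F (orbit \<psi> i)" if "i < n" for i
      using that ro'[OF that] funpow_in_orbit[OF permutation_self_in_orbit[OF P'], of "k i" "r' i"]
      by (simp add: \<sigma>_def)
    have "orbit \<psi>' (\<sigma> i) = F (orbit \<psi> i)" if "i < n" for i
      using orbit_permutes_eq[OF P', of "\<sigma> i" "r' i"] in_orb[OF that] unfolding ro'[OF that] .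
    from this[OF i] this[OF j] have "F (orbit \<psi> i) = F (orbit \<psi> j)" unfolding ij(3) by (rule trans[OF sym])
    hence o: "orbit \<psi> i = orbit \<psi> j"
      by (rule inj_onD[OF bij_betw_imp_inj_on[OF F]]) (use i j in auto)
    have eq: "r i = r j" "r' i = r' j" unfolding r_def r'_def o by (rule refl)+
    have "(\<psi>' ^^ k i) (r' i) = (\<psi>' ^^ k j) (r' i)" using ij(3) i j eq by (simp add: \<sigma>_def)
    hence "(\<psi> ^^ k i) (r i) = (\<psi> ^^ k j) (r i)" using key[OF i] by blast
    thus "i = j" using k[of i] k[of j] unfolding eq by (simp only:)
  qed
  moreover have "\<sigma> ` {0..<n} \<subseteq> {0..<n}" using lt(2) rlt' by (auto simp: \<sigma>_def)
  ultimately have "bij_betw \<sigma> {0..<n} {0..<n}"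
    by (simp add: bij_betw_def endo_inj_surj)
  hence s: "\<sigma> permutes {0..<n}" by (rule bij_imp_permutes) (auto simp: \<sigma>_def)
  have "\<psi>' i = (\<sigma> \<circ> \<psi> \<circ> Hilbert_Choice.inv \<sigma>) i" for i
    using comm[of "Hilbert_Choice.inv \<sigma> i"] permutes_inverses[OF s] by simp
  thus ?thesis using s by blast
qed

text \<open>Conjugation carries orbits to their images under \<open>\<sigma>\<close>, which have the
  same size.\<close>

lemma cycle_type_conjugate:
  assumes s: "\<sigma> permutes {0..<n}" and t: "\<tau> permutes {0..<n}"
  shows "cycle_type n (\<sigma> \<circ> \<tau> \<circ> Hilbert_Choice.inv \<sigma>) = cycle_type n \<tau>"
proof -
  let ?c = "\<sigma> \<circ> \<tau> \<circ> Hilbert_Choice.inv \<sigma>"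
  have T: "permutation \<tau>" using t by (auto simp: permutation_permutes)
  have inj: "inj \<sigma>" using s by (rule permutes_inj)
  have o: "orbit ?c (\<sigma> i) = \<sigma> ` orbit \<tau> i" for i
    by (rule orbit_inverse[symmetric]) (auto simp: permutation_self_in_orbit[OF T] permutes_inverses[OF s])
  have "orbit ?c ` {0..<n} = orbit ?c ` (\<sigma> ` {0..<n})" using permutes_image[OF s] by simp
  also have "\<dots> = (`) \<sigma> ` (orbit \<tau> ` {0..<n})" by (simp add: image_image o)
  finally have "mset_set (orbit ?c ` {0..<n}) = image_mset ((`) \<sigma>) (mset_set (orbit \<tau> ` {0..<n}))"
    using inj by (simp add: image_mset_mset_set inj_on_def inj_image_eq_iff)
  moreover have "card (\<sigma> ` X) = card X" for X using inj by (simp add: card_image inj_on_subset)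
  ultimately show ?thesis unfolding cycle_type_def by (simp add: multiset.map_comp comp_def)
qed

text \<open>Guarantees that the choice in \<open>class_value\<close> picks a genuine representative
  for each partition.\<close>

lemma ex_permutation_of_cycle_type:
  assumes "0 \<notin># \<mu>"
  shows "\<exists>\<psi>. \<psi> permutes {0..<sum_mset \<mu>} \<and> cycle_type (sum_mset \<mu>) \<psi> = \<mu>"
  using assms
proof (induction \<mu>)
  case empty
  show ?case by (intro exI[of _ id]) (auto simp: cycle_type_def)
next
  case (add k \<mu>)
  define m where "m = sum_mset \<mu>"
  obtain \<psi> where p: "\<psi> permutes {0..<m}" and c: "cycle_type m \<psi> = \<mu>" using add unfolding m_def by auto
  have k: "k > 0" using add.prems by auto
  \<comment> \<open>The new part is realised as a rotation of the fresh block
    \<open>{m..<m + k}\<close>, on which the truncated \<open>i - m\<close> is exact.\<close>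
  define \<phi> where "\<phi> i = (if i < m then \<psi> i else if i < m + k then m + (i - m + 1) mod k else i)" for i
  have low: "\<psi> i < m" if "i < m" for i using permutes_in_image[OF p, of i] that by simp
  have "inj_on \<phi> {0..<m+k}"
  proof (rule inj_onI)
    fix i j assume ij: "i \<in> {0..<m+k}" "j \<in> {0..<m+k}" "\<phi> i = \<phi> j"
    show "i = j"
    proof (cases "i < m")
      case True
      hence "j < m" using ij low[of i] by (auto simp: \<phi>_def split: if_splits)
      thus ?thesis using True ij(3) permutes_inj[OF p] by (auto simp: \<phi>_def inj_def)
    next
      case False
      hence j: "\<not> j < m" using ij low[of j] by (auto simp: \<phi>_def split: if_splits)
      hence "(i - m + 1) mod k = (j - m + 1) mod k" using False ij by (auto simp: \<phi>_def)
      moreover have "i - m < k" "j - m < k" using ij False j by auto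
      ultimately have "i - m = j - m"
        by (auto simp: mod_Suc split: if_splits)
      thus ?thesis using False j by simp
    qed
  qed
  moreover have "\<phi> ` {0..<m+k} \<subseteq> {0..<m+k}"
    using low k by (force simp: \<phi>_def)
  ultimately have b: "bij_betw \<phi> {0..<m+k} {0..<m+k}" by (simp add: bij_betw_def endo_inj_surj)
  have perm: "\<phi> permutes {0..<m+k}" by (rule bij_imp_permutes[OF b]) (auto simp: \<phi>_def)
  have P: "permutation \<phi>" using perm by (auto simp: permutation_permutes)
  have o1: "orbit \<phi> i = orbit \<psi> i" if "i < m" for i
    by (rule orbit_cong0[of _ "{0..<m}"]) (use that low in \<open>auto simp: \<phi>_def\<close>)
  have pw: "(\<phi> ^^ a) m = m + a mod k" for a
    using k by (induct a) (auto simp: \<phi>_def mod_Suc)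
  have om: "orbit \<phi> m = {m..<m+k}"
    unfolding orbit_altdef_permutation[OF P] pw
  proof (rule Set.set_eqI, rule iffI)
    fix i assume "i \<in> {m..<m+k}"
    hence "i = m + (i - m) mod k" by auto
    thus "i \<in> {m + a mod k |a. True}" by blast
  qed (use k in auto)
  have o2: "orbit \<phi> i = {m..<m+k}" if "m \<le> i" "i < m + k" for i
    using orbit_permutes_eq[OF P, of i m] om that by auto
  have "orbit \<phi> ` {0..<m+k} = orbit \<phi> ` {0..<m} \<union> orbit \<phi> ` {m..<m+k}"
    by (metis image_Un ivl_disj_un_two(3) le_add1 zero_le)
  also have "orbit \<phi> ` {m..<m+k} = {{m..<m+k}}" using o2[of m] o2 k by force
  also have "orbit \<phi> ` {0..<m} = orbit \<psi> ` {0..<m}" using o1 by (intro image_cong) auto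
  finally have o: "orbit \<phi> ` {0..<m+k} = insert {m..<m+k} (orbit \<psi> ` {0..<m})" by auto
  have "{m..<m+k} \<notin> orbit \<psi> ` {0..<m}"
  proof
    assume "{m..<m+k} \<in> orbit \<psi> ` {0..<m}"
    hence "{m..<m+k} \<subseteq> {0..<m}" using permutes_orbit_subset[OF p] by (metis imageE)
    moreover have "m \<in> {m..<m+k}" using k by simp
    ultimately show False by (meson atLeastLessThan_iff less_irrefl subsetD)
  qed
  hence "cycle_type (m + k) \<phi> = add_mset k \<mu>"
    using c unfolding cycle_type_def o by simp
  thus ?case using perm unfolding m_def by (auto simp: add.commute)
qed

text \<open>Transpositions are counted by their smaller elements. The involution maps these
  bijectively onto the larger ones, so \<open>n\<close> is twice their number plus the number of
  fixed points.\<close>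

lemma cycle_type_involution:
  assumes p: "\<psi> permutes {0..<n}" and inv: "\<And>i. \<psi> (\<psi> i) = i"
  shows "2 * card {i. i < \<psi> i} \<le> n"
    and "cycle_type n \<psi> = replicate_mset (card {i. i < \<psi> i}) 2 + replicate_mset (n - 2 * card {i. i < \<psi> i}) 1"
    and "card {i\<in>{0..<n}. \<psi> i = i} = n - 2 * card {i. i < \<psi> i}"
proof -
  define U where "U = {i. i < \<psi> i}"
  define D where "D = {i. i > \<psi> i}"
  define S where "S = {i\<in>{0..<n}. \<psi> i = i}"
  have mv: "i < n" if "\<psi> i \<noteq> i" for i using p that by (auto simp: permutes_def not_less[symmetric])
  have lt: "\<psi> i < n" if "i < n" for i using permutes_in_image[OF p, of i] that by simp
  have split: "{0..<n} = U \<union> D \<union> S" unfolding U_def D_def S_def using mv by (fastforce)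
  have fin: "finite U" "finite D" "finite S" using split by (metis finite_Un finite_atLeastLessThan)+
  have "D = \<psi> ` U" unfolding D_def U_def using inv by (auto simp: image_iff) metis
  hence cD: "card D = card U" using permutes_inj[OF p] by (simp add: card_image inj_on_subset)
  have "card {0..<n} = card U + card D + card S"
    unfolding split using fin by (subst card_Un_disjoint, auto simp: U_def D_def S_def)+
  hence n: "n = 2 * card U + card S" using cD by simp
  have o: "orbit \<psi> i = {i, \<psi> i}" for i
  proof -
    have "(\<psi> ^^ a) i \<in> {i, \<psi> i}" for a by (induct a) (auto simp: inv)
    moreover have "permutation \<psi>" using p by (auto simp: permutation_permutes)
    ultimately show ?thesis
      using orbit.base[of \<psi> i] permutation_self_in_orbit[of \<psi> i] unfolding orbit_altdef by blast
  qed
  have inj1: "inj_on (\<lambda>i. {i, \<psi> i}) U" by (auto simp: inj_on_def U_def doubleton_eq_iff)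
  have inj2: "inj_on (\<lambda>i. {i}) S" by (auto simp: inj_on_def)
  have "orbit \<psi> ` {0..<n} = (\<lambda>i. {i, \<psi> i}) ` U \<union> (\<lambda>i. {i, \<psi> i}) ` D \<union> (\<lambda>i. {i, \<psi> i}) ` S"
    unfolding split image_Un using o by simp
  also have "(\<lambda>i. {i, \<psi> i}) ` D = (\<lambda>i. {i, \<psi> i}) ` U"
    unfolding \<open>D = \<psi> ` U\<close> image_image inv by (simp add: insert_commute)
  also have "(\<lambda>i. {i, \<psi> i}) ` S = (\<lambda>i. {i}) ` S" by (auto simp: S_def)
  finally have "orbit \<psi> ` {0..<n} = (\<lambda>i. {i, \<psi> i}) ` U \<union> (\<lambda>i. {i}) ` S" by simp
  moreover have "(\<lambda>i. {i, \<psi> i}) ` U \<inter> (\<lambda>i. {i}) ` S = {}" by (auto simp: U_def S_def)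
  ultimately have "mset_set (orbit \<psi> ` {0..<n})
      = image_mset (\<lambda>i. {i, \<psi> i}) (mset_set U) + image_mset (\<lambda>i. {i}) (mset_set S)"
    using fin by (simp add: mset_set_Union image_mset_mset_set[OF inj1] image_mset_mset_set[OF inj2])
  hence "cycle_type n \<psi> = image_mset (\<lambda>i. card {i, \<psi> i}) (mset_set U) + image_mset (\<lambda>i. card {i}) (mset_set S)"
    unfolding cycle_type_def by (simp add: multiset.map_comp comp_def)
  also have "image_mset (\<lambda>i. card {i, \<psi> i}) (mset_set U) = image_mset (\<lambda>i. 2) (mset_set U)"
    using fin by (intro image_mset_cong) (auto simp: U_def)
  finally have "cycle_type n \<psi> = replicate_mset (card U) 2 + replicate_mset (card S) 1"
    by (simp add: image_mset_const_eq)
  thus "2 * card {i. i < \<psi> i} \<le> n"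
    "cycle_type n \<psi> = replicate_mset (card {i. i < \<psi> i}) 2 + replicate_mset (n - 2 * card {i. i < \<psi> i}) 1"
    "card {i\<in>{0..<n}. \<psi> i = i} = n - 2 * card {i. i < \<psi> i}"
    using n diff_add_inverse[of "2 * card U" "card S"] unfolding U_def S_def by simp_all
qed

section \<open>Power sums and monomial symmetric functions\<close>

lemma finite_partitions: "finite {\<mu>. is_partition n \<mu>}"
proof (rule finite_subset)
  show "finite (mset ` {xs. set xs \<subseteq> {0..n} \<and> length xs \<le> n})"
    by (intro finite_imageI finite_lists_length_le) simp
  show "{\<mu>. is_partition n \<mu>} \<subseteq> mset ` {xs. set xs \<subseteq> {0..n} \<and> length xs \<le> n}"
  proof
    fix \<mu> assume "\<mu> \<in> {\<mu>. is_partition n \<mu>}"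
    moreover obtain xs where xs: "\<mu> = mset xs" by (metis ex_mset)
    ultimately have h: "0 \<notin> set xs" "sum_list xs = n"
      by (auto simp: is_partition_def sum_mset_sum_list)
    have "length xs \<le> sum_list xs" if "0 \<notin> set xs" for xs :: "nat list"
      using that by (induct xs) auto
    with h have "length xs \<le> n" by auto
    moreover have "set xs \<subseteq> {0..n}" using member_le_sum_list[of _ xs] h by auto
    ultimately show "\<mu> \<in> mset ` {xs. set xs \<subseteq> {0..n} \<and> length xs \<le> n}" using xs by auto
  qed
qed

lemma exponent_type_add_single:
  assumes "i \<notin> Poly_Mapping.keys e"
  shows "exponent_type (e + Poly_Mapping.single i c) = exponent_type e + (if c = 0 then {#} else {#c#})"
proof (cases "c = 0")
  case False
  have l: "Poly_Mapping.lookup (e + Poly_Mapping.single i c) j = (if j = i then c else Poly_Mapping.lookup e j)" for j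
    using assms by (auto simp: lookup_add lookup_single in_keys_iff when_def)
  hence k: "Poly_Mapping.keys (e + Poly_Mapping.single i c) = insert i (Poly_Mapping.keys e)"
    using False by (auto simp: in_keys_iff l split: if_splits)
  have "image_mset (Poly_Mapping.lookup (e + Poly_Mapping.single i c)) (mset_set (Poly_Mapping.keys e))
      = image_mset (Poly_Mapping.lookup e) (mset_set (Poly_Mapping.keys e))"
    using assms by (intro image_mset_cong) (auto simp: l)
  thus ?thesis unfolding exponent_type_def k using assms False by (simp add: l)
qed simp

lemma zero_notin_exponent_type: "0 \<notin># exponent_type e"
  by (auto simp: exponent_type_def in_keys_iff)

lemma ex_exponent_type:
  assumes "0 \<notin># \<mu>"
  shows "\<exists>e. exponent_type e = \<mu>"
  using assms
proof (induction \<mu>)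
  case empty
  show ?case by (intro exI[of _ 0]) (simp add: exponent_type_def)
next
  case (add c \<mu>)
  then obtain e where e: "exponent_type e = \<mu>" by auto
  obtain i where "i \<notin> Poly_Mapping.keys e"
    using ex_new_if_finite[OF infinite_UNIV_nat finite_keys] by blast
  thus ?case using exponent_type_add_single[of i e c] e add.prems by (auto split: if_splits)
qed

lemma exponent_type_minus_single:
  assumes "i \<in> Poly_Mapping.keys e" "k \<le> Poly_Mapping.lookup e i"
  shows "exponent_type (e - Poly_Mapping.single i k) = exponent_type e - {#Poly_Mapping.lookup e i#}
    + (if Poly_Mapping.lookup e i = k then {#} else {#Poly_Mapping.lookup e i - k#})"
proof -
  define c where "c = Poly_Mapping.lookup e i"
  define e' where "e' = e - Poly_Mapping.single i c"
  have l: "Poly_Mapping.lookup e' j = (if j = i then 0 else Poly_Mapping.lookup e j)" for j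
    by (auto simp: e'_def c_def lookup_minus lookup_single when_def)
  hence i: "i \<notin> Poly_Mapping.keys e'" by (auto simp: in_keys_iff)
  have e: "e = e' + Poly_Mapping.single i c"
    by (rule poly_mapping_eqI) (auto simp: lookup_add lookup_single l c_def when_def)
  have ek: "e - Poly_Mapping.single i k = e' + Poly_Mapping.single i (c - k)"
    by (rule poly_mapping_eqI) (auto simp: lookup_add lookup_minus lookup_single l c_def when_def)
  have c: "c \<noteq> 0" using assms(1) by (simp add: c_def in_keys_iff)
  have "exponent_type e = exponent_type e' + {#c#}"
    using exponent_type_add_single[OF i, of c] c unfolding e[symmetric] by simp
  thus ?thesis unfolding ek exponent_type_add_single[OF i] c_def[symmetric]
    using assms(2) by (auto simp: c_def)
qed

text \<open>The first summand is bounded pointwise by \<open>e\<close> and determines the second.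
  Finiteness matters because a sum over an infinite set is 0 by convention.\<close>

lemma finite_add_decompositions: "finite {(a, b :: nat \<Rightarrow>\<^sub>0 nat). a + b = e}"
proof -
  let ?F = "{f. \<forall>i. (i \<in> Poly_Mapping.keys e \<longrightarrow> f i \<in> {0..Max (Poly_Mapping.lookup e ` Poly_Mapping.keys e)})
                    \<and> (i \<notin> Poly_Mapping.keys e \<longrightarrow> f i = (0::nat))}"
  have "finite ?F" by (rule finite_set_of_finite_funs) auto
  moreover have "(\<lambda>(a, b). Poly_Mapping.lookup a) ` {(a, b). a + b = e} \<subseteq> ?F"
  proof clarify
    fix a b :: "nat \<Rightarrow>\<^sub>0 nat" and i
    assume e: "e = a + b"
    have le: "Poly_Mapping.lookup a i \<le> Poly_Mapping.lookup (a + b) i" by (simp add: lookup_add)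
    have "Poly_Mapping.lookup (a + b) i \<le> Max (Poly_Mapping.lookup (a + b) ` Poly_Mapping.keys (a + b))"
      if "i \<in> Poly_Mapping.keys (a + b)" using that by (intro Max_ge) auto
    with le show "(i \<in> Poly_Mapping.keys (a + b) \<longrightarrow> Poly_Mapping.lookup a i
        \<in> {0..Max (Poly_Mapping.lookup (a + b) ` Poly_Mapping.keys (a + b))})
      \<and> (i \<notin> Poly_Mapping.keys (a + b) \<longrightarrow> Poly_Mapping.lookup a i = 0)"
      by (metis atLeastAtMost_iff in_keys_iff le_zero_eq order_trans zero_le)
  qed
  ultimately have "finite ((\<lambda>(a, b). Poly_Mapping.lookup a) ` {(a, b). a + b = e})"
    by (rule finite_subset[rotated])
  moreover have "inj_on (\<lambda>(a, b). Poly_Mapping.lookup a) {(a, b). a + b = e}"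
    by (auto simp: inj_on_def)
  ultimately show ?thesis by (rule finite_imageD)
qed

text \<open>For \<open>k > 0\<close> different variables give different \<open>k\<close>-th powers,
  so each variable whose exponent in \<open>e\<close> is at least \<open>k\<close> contributes
  exactly one splitting of \<open>e\<close>.\<close>

lemma series_mult_power_sum:
  assumes "k > 0"
  shows "series_mult (power_sum k) f e
    = (\<Sum>i | i \<in> Poly_Mapping.keys e \<and> k \<le> Poly_Mapping.lookup e i. f (e - Poly_Mapping.single i k))"
proof -
  let ?I = "{i. i \<in> Poly_Mapping.keys e \<and> k \<le> Poly_Mapping.lookup e i}"
  let ?s = "\<lambda>i. (Poly_Mapping.single i k, e - Poly_Mapping.single i k)"
  have "series_mult (power_sum k) f e = (\<Sum>(a, b) \<in> ?s ` ?I. power_sum k a * f b)"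
    unfolding series_mult_def
  proof (rule sum.mono_neutral_right[OF finite_add_decompositions])
    have "Poly_Mapping.single i k + (e - Poly_Mapping.single i k) = e" if "i \<in> ?I" for i
      using that by (intro poly_mapping_eqI) (auto simp: lookup_add lookup_minus lookup_single when_def)
    thus "?s ` ?I \<subseteq> {(a, b). a + b = e}" by auto
    show "\<forall>p\<in>{(a, b). a + b = e} - ?s ` ?I. (case p of (a, b) \<Rightarrow> power_sum k a * f b) = 0"
    proof clarify
      fix a b :: "nat \<Rightarrow>\<^sub>0 nat"
      assume e: "e = a + b" and n: "(a, b) \<notin> (\<lambda>i. (Poly_Mapping.single i k, a + b - Poly_Mapping.single i k)) `
        {i. i \<in> Poly_Mapping.keys (a + b) \<and> k \<le> Poly_Mapping.lookup (a + b) i}"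
      have "a \<noteq> Poly_Mapping.single i k" for i
      proof
        assume a: "a = Poly_Mapping.single i k"
        hence "k \<le> Poly_Mapping.lookup (a + b) i" by (simp add: lookup_add)
        thus False using n a assms by (auto simp: in_keys_iff)
      qed
      thus "power_sum k a * f b = 0" by (simp add: power_sum_def)
    qed
  qed
  also have "\<dots> = (\<Sum>i\<in>?I. f (e - Poly_Mapping.single i k))"
  proof (subst sum.reindex)
    show "inj_on ?s ?I"
      using assms by (intro inj_onI) (metis Pair_inject less_irrefl lookup_single_eq lookup_single_not_eq)
  qed (auto simp: power_sum_def intro!: sum.cong)
  finally show ?thesis .
qed

text \<open>The coefficient, in the product of the power sums \<open>p_k\<close> for
  \<open>k\<close> in the list, of a monomial with exponents \<open>\<nu>\<close>: each
  \<open>k\<close> is charged to one variable, whose exponent drops by \<open>k\<close>. Equal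
  exponents are summed separately, as they belong to different variables.\<close>

fun ps_coeff :: "nat list \<Rightarrow> nat multiset \<Rightarrow> rat" where
  "ps_coeff [] \<nu> = (if \<nu> = {#} then 1 else 0)"
| "ps_coeff (k # ks) \<nu> =
     (\<Sum>c\<in>#filter_mset (\<lambda>c. k \<le> c) \<nu>. ps_coeff ks (\<nu> - {#c#} + (if c = k then {#} else {#c - k#})))"

lemma foldr_power_sum_eq_ps_coeff:
  assumes "0 \<notin> set ks"
  shows "foldr series_mult (map power_sum ks) series_one e = ps_coeff ks (exponent_type e)"
  using assms
proof (induction ks arbitrary: e)
  case Nil
  show ?case by (auto simp: series_one_def exponent_type_def mset_set_empty_iff)
next
  case (Cons k ks)
  hence k: "k > 0" by auto
  let ?g = "\<lambda>c. ps_coeff ks (exponent_type e - {#c#} + (if c = k then {#} else {#c - k#}))"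
  have "foldr series_mult (map power_sum (k # ks)) series_one e
    = (\<Sum>i | i \<in> Poly_Mapping.keys e \<and> k \<le> Poly_Mapping.lookup e i. ?g (Poly_Mapping.lookup e i))"
  proof -
    have "foldr series_mult (map power_sum (k # ks)) series_one e
      = (\<Sum>i | i \<in> Poly_Mapping.keys e \<and> k \<le> Poly_Mapping.lookup e i.
          foldr series_mult (map power_sum ks) series_one (e - Poly_Mapping.single i k))"
      using k by (simp only: list.map foldr.simps comp_apply series_mult_power_sum)
    also have "\<dots> = (\<Sum>i | i \<in> Poly_Mapping.keys e \<and> k \<le> Poly_Mapping.lookup e i. ?g (Poly_Mapping.lookup e i))"
    proof (rule sum.cong[OF refl])
      fix i assume "i \<in> {i. i \<in> Poly_Mapping.keys e \<and> k \<le> Poly_Mapping.lookup e i}"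
      hence "exponent_type (e - Poly_Mapping.single i k) = exponent_type e - {#Poly_Mapping.lookup e i#}
          + (if Poly_Mapping.lookup e i = k then {#} else {#Poly_Mapping.lookup e i - k#})"
        by (intro exponent_type_minus_single) auto
      thus "foldr series_mult (map power_sum ks) series_one (e - Poly_Mapping.single i k) = ?g (Poly_Mapping.lookup e i)"
        using Cons.IH[of "e - Poly_Mapping.single i k"] Cons.prems by simp
    qed
    finally show ?thesis .
  qed
  also have "\<dots> = (\<Sum>c\<in>#filter_mset (\<lambda>c. k \<le> c) (exponent_type e). ?g c)"
  proof -
    \<comment> \<open>Passing from variables to exponents keeps multiplicities, so the sum over
      variables becomes a sum over the multiset of parts.\<close>
    have "filter_mset (\<lambda>c. k \<le> c) (exponent_type e)
      = image_mset (Poly_Mapping.lookup e) (mset_set {i. i \<in> Poly_Mapping.keys e \<and> k \<le> Poly_Mapping.lookup e i})"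
      unfolding exponent_type_def filter_mset_image_mset by (simp add: filter_mset_mset_set)
    thus ?thesis by (simp only: sum_unfold_sum_mset multiset.map_comp comp_def)
  qed
  finally show ?case by simp
qed

lemma power_sum_sym_eq_ps_coeff:
  assumes "0 \<notin># \<mu>"
  shows "power_sum_sym \<mu> e = ps_coeff (sorted_list_of_multiset \<mu>) (exponent_type e)"
  unfolding power_sum_sym_def using assms by (intro foldr_power_sum_eq_ps_coeff) simp

lemma sum_mset_nonzero_witness:
  "(\<Sum>c\<in>#M. f c) \<noteq> (0 :: 'a :: comm_monoid_add) \<Longrightarrow> \<exists>c\<in>#M. f c \<noteq> 0"
  by (induct M) force+

lemma ps_coeff_Cons_nonzero:
  assumes "ps_coeff (k # ks) \<nu> \<noteq> 0"
  obtains c where "c \<in># \<nu>" "k \<le> c" "ps_coeff ks (\<nu> - {#c#} + (if c = k then {#} else {#c - k#})) \<noteq> 0"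
  using sum_mset_nonzero_witness[OF assms[unfolded ps_coeff.simps]] by auto

lemma ps_coeff_nonneg: "ps_coeff ks \<nu> \<ge> 0"
proof (induction ks arbitrary: \<nu>)
  case (Cons k ks)
  have "(\<Sum>c\<in>#M. ps_coeff ks (h c)) \<ge> 0" for M :: "nat multiset" and h
    by (induct M) (auto simp: Cons)
  thus ?case by simp
qed simp

text \<open>Charging every part to an equal one contributes a positive summand, and no summand is
  negative. This is the diagonal of the triangular system, by which one divides later.\<close>

lemma ps_coeff_self_pos: "ps_coeff ks (mset ks) > 0"
proof (induction ks)
  case (Cons k ks)
  have "(\<Sum>c\<in>#M. ps_coeff ks (h c)) \<ge> 0" for M :: "nat multiset" and h
    by (induct M) (auto simp: ps_coeff_nonneg)
  thus ?case using Cons by (simp add: add_pos_nonneg)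
qed simp

text \<open>
  Expanding a product of power sums merges parts; hence the transition matrix from power sums to
  monomials is triangular with respect to the number of parts.
\<close>

lemma ps_coeff_triangular:
  assumes "ps_coeff ks \<nu> \<noteq> 0"
  shows "sum_mset \<nu> = sum_list ks \<and> (\<nu> = mset ks \<or> size \<nu> < length ks)"
  using assms
proof (induction ks arbitrary: \<nu>)
  case Nil
  thus ?case by (auto split: if_splits)
next
  case (Cons k ks)
  obtain c where c: "c \<in># \<nu>" "k \<le> c" and
    nz: "ps_coeff ks (\<nu> - {#c#} + (if c = k then {#} else {#c - k#})) \<noteq> 0"
    using ps_coeff_Cons_nonzero[OF Cons.prems] .
  obtain \<nu>' where \<nu>: "\<nu> = add_mset c \<nu>'" using c(1) by (metis mset_add)
  show ?case
  proof (cases "c = k")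
    case True
    thus ?thesis using Cons.IH[OF nz] by (auto simp: \<nu>)
  next
    case False
    have "sum_mset (add_mset (c - k) \<nu>') = sum_list ks"
      and "add_mset (c - k) \<nu>' = mset ks \<or> size (add_mset (c - k) \<nu>') < length ks"
      using Cons.IH[OF nz] False by (auto simp: \<nu>)
    moreover have "Suc (size \<nu>') = length ks" if "add_mset (c - k) \<nu>' = mset ks"
      using that by (metis size_add_mset size_mset)
    ultimately show ?thesis using c(2) by (auto simp: \<nu>)
  qed
qed

text \<open>Each part of a power sum has to fit into an exponent, and exponents only shrink. Hence
  monomials with exponents at most 2 see only power sums with parts at most 2, which isolates the
  values on involutions.\<close>

lemma ps_coeff_parts_le:
  assumes "ps_coeff ks \<nu> \<noteq> 0" "\<forall>c\<in>#\<nu>. c \<le> m"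
  shows "\<forall>k\<in>set ks. k \<le> m"
  using assms
proof (induction ks arbitrary: \<nu>)
  case (Cons k ks)
  obtain c where c: "c \<in># \<nu>" "k \<le> c" and
    nz: "ps_coeff ks (\<nu> - {#c#} + (if c = k then {#} else {#c - k#})) \<noteq> 0"
    using ps_coeff_Cons_nonzero[OF Cons.prems(1)] .
  have "\<forall>d\<in>#\<nu> - {#c#} + (if c = k then {#} else {#c - k#}). d \<le> m"
    using Cons.prems(2) c by (auto dest: in_diffD intro: order_trans[OF diff_le_self])
  hence "\<forall>k\<in>set ks. k \<le> m" using Cons.IH[OF nz] by blast
  thus ?case using c Cons.prems(2) by auto
qed simp

section \<open>Monomial symmetric functions as combinations of power sums\<close>

definition power_sum_span :: "nat \<Rightarrow> series set" where
  "power_sum_span n = {f. \<exists>h. \<forall>e. f e = (\<Sum>\<mu> | is_partition n \<mu>. h \<mu> * power_sum_sym \<mu> e)}"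

lemma power_sum_sym_in_span:
  assumes "is_partition n \<mu>"
  shows "power_sum_sym \<mu> \<in> power_sum_span n"
  unfolding power_sum_span_def using assms
  by (auto intro!: exI[of _ "\<lambda>\<nu>. if \<nu> = \<mu> then 1 else 0"] simp: if_distrib[of "\<lambda>c. c * _"] sum.delta[OF finite_partitions] cong: if_cong)

lemma power_sum_span_scale:
  assumes "f \<in> power_sum_span n"
  shows "(\<lambda>e. c * f e) \<in> power_sum_span n"
proof -
  obtain h where "\<And>e. f e = (\<Sum>\<mu> | is_partition n \<mu>. h \<mu> * power_sum_sym \<mu> e)"
    using assms unfolding power_sum_span_def by blast
  thus ?thesis unfolding power_sum_span_def
    by (auto intro!: exI[of _ "\<lambda>\<mu>. c * h \<mu>"] simp: sum_distrib_left mult.assoc)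
qed

lemma power_sum_span_diff:
  assumes "f \<in> power_sum_span n" "g \<in> power_sum_span n"
  shows "(\<lambda>e. f e - g e) \<in> power_sum_span n"
proof -
  obtain h k where "\<And>e. f e = (\<Sum>\<mu> | is_partition n \<mu>. h \<mu> * power_sum_sym \<mu> e)"
    "\<And>e. g e = (\<Sum>\<mu> | is_partition n \<mu>. k \<mu> * power_sum_sym \<mu> e)"
    using assms unfolding power_sum_span_def by blast
  thus ?thesis unfolding power_sum_span_def
    by (auto intro!: exI[of _ "\<lambda>\<mu>. h \<mu> - k \<mu>"] simp: sum_subtractf left_diff_distrib)
qed

lemma power_sum_span_diff_sum:
  assumes "finite I" "g \<in> power_sum_span n" "\<And>i. i \<in> I \<Longrightarrow> f i \<in> power_sum_span n"
  shows "(\<lambda>e. g e - (\<Sum>i\<in>I. f i e)) \<in> power_sum_span n"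
  using assms
proof (induction I rule: finite_induct)
  case (insert i I)
  have "(\<lambda>e. (g e - (\<Sum>i\<in>I. f i e)) - f i e) \<in> power_sum_span n"
    by (rule power_sum_span_diff) (use insert in auto)
  moreover have "(\<lambda>e. (g e - (\<Sum>i\<in>I. f i e)) - f i e) = (\<lambda>e. g e - (\<Sum>i\<in>insert i I. f i e))"
    using insert.hyps by (simp add: fun_eq_iff)
  ultimately show ?case by (simp only:)
qed simp

lemma power_sum_sym_expand_monomial:
  assumes "is_partition n \<mu>"
  shows "power_sum_sym \<mu> e = (\<Sum>\<nu> | is_partition n \<nu>. ps_coeff (sorted_list_of_multiset \<mu>) \<nu> * monomial_sym \<nu> e)"
proof -
  have z: "0 \<notin># \<mu>" and s: "sum_mset \<mu> = n" using assms by (auto simp: is_partition_def)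
  have "(\<Sum>\<nu> | is_partition n \<nu>. ps_coeff (sorted_list_of_multiset \<mu>) \<nu> * monomial_sym \<nu> e)
    = (\<Sum>\<nu> | is_partition n \<nu>. if \<nu> = exponent_type e then ps_coeff (sorted_list_of_multiset \<mu>) \<nu> else 0)"
    by (intro sum.cong) (auto simp: monomial_sym_def)
  also have "\<dots> = (if is_partition n (exponent_type e) then ps_coeff (sorted_list_of_multiset \<mu>) (exponent_type e) else 0)"
    by (simp add: sum.delta[OF finite_partitions])
  \<comment> \<open>If \<open>e\<close> does not have degree \<open>n\<close>, the right-hand side
    vanishes too, by the degree part of triangularity.\<close>
  also have "\<dots> = ps_coeff (sorted_list_of_multiset \<mu>) (exponent_type e)"
    using ps_coeff_triangular[of "sorted_list_of_multiset \<mu>" "exponent_type e"] s zero_notin_exponent_type[of e]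
    by (auto simp: is_partition_def simp flip: sum_mset_sum_list)
  finally show ?thesis using power_sum_sym_eq_ps_coeff[OF z] by simp
qed

text \<open>Induction on the number of parts: by triangularity \<open>p_\<mu>\<close> is a positive
  multiple of \<open>m_\<mu>\<close> plus monomial functions with fewer parts, which can be solved
  for \<open>m_\<mu>\<close>.\<close>

lemma monomial_sym_in_span:
  assumes "is_partition n \<mu>"
  shows "monomial_sym \<mu> \<in> power_sum_span n"
  using assms
proof (induction "size \<mu>" arbitrary: \<mu> rule: less_induct)
  case less
  let ?P = "ps_coeff (sorted_list_of_multiset \<mu>)"
  let ?I = "{\<nu>. is_partition n \<nu> \<and> size \<nu> < size \<mu>}"
  have fin: "finite ?I" using finite_partitions[of n] by (rule rev_finite_subset) auto
  have pos: "?P \<mu> > 0" using ps_coeff_self_pos[of "sorted_list_of_multiset \<mu>"] by simp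
  have len: "length (sorted_list_of_multiset \<mu>) = size \<mu>"
    by (metis mset_sorted_list_of_multiset size_mset)
  have "power_sum_sym \<mu> e = ?P \<mu> * monomial_sym \<mu> e + (\<Sum>\<nu>\<in>?I. ?P \<nu> * monomial_sym \<nu> e)" for e
  proof -
    have "power_sum_sym \<mu> e = (\<Sum>\<nu> | is_partition n \<nu>. ?P \<nu> * monomial_sym \<nu> e)"
      by (rule power_sum_sym_expand_monomial[OF less.prems])
    also have "\<dots> = (\<Sum>\<nu>\<in>insert \<mu> ?I. ?P \<nu> * monomial_sym \<nu> e)"
      by (rule sum.mono_neutral_right[OF finite_partitions])
        (use less.prems ps_coeff_triangular[of "sorted_list_of_multiset \<mu>"] len in auto)
    finally show ?thesis using fin by simp
  qed
  hence "monomial_sym \<mu> = (\<lambda>e. (1 / ?P \<mu>) * (power_sum_sym \<mu> e - (\<Sum>\<nu>\<in>?I. ?P \<nu> * monomial_sym \<nu> e)))"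
    using pos by auto
  moreover have "\<dots> \<in> power_sum_span n"
    using less fin by (intro power_sum_span_scale power_sum_span_diff_sum power_sum_sym_in_span) auto
  ultimately show ?case by simp
qed

section \<open>Preimages under the Frobenius characteristic\<close>

lemma z_factor_nonzero:
  assumes "0 \<notin># \<mu>" shows "z_factor \<mu> \<noteq> 0"
  using assms by (auto simp: z_factor_def)

lemma class_function_of_cycle_type:
  "(\<lambda>\<psi>. if \<psi> permutes {0..<n} then h (cycle_type n \<psi>) else 0) \<in> class_functions n"
  unfolding class_functions_def
  by (auto simp: cycle_type_conjugate permutes_compose permutes_inv)

text \<open>The preimage takes on cycle type \<open>\<mu>\<close> the coefficient of
  \<open>p_\<mu>\<close> times \<open>z_factor \<mu>\<close>, which cancels the division in
  \<open>frobenius_ch\<close>.\<close>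

lemma power_sum_span_subset_range_ch:
  assumes "f \<in> power_sum_span n"
  shows "f \<in> frobenius_ch n ` class_functions n"
proof -
  obtain h where h: "\<And>e. f e = (\<Sum>\<mu> | is_partition n \<mu>. h \<mu> * power_sum_sym \<mu> e)"
    using assms unfolding power_sum_span_def by blast
  let ?g = "\<lambda>\<psi>. if \<psi> permutes {0..<n} then h (cycle_type n \<psi>) * of_nat (z_factor (cycle_type n \<psi>)) else 0"
  have "class_value n ?g \<mu> = h \<mu> * of_nat (z_factor \<mu>)" if "is_partition n \<mu>" for \<mu>
  proof -
    have "\<exists>\<psi>. \<psi> permutes {0..<n} \<and> cycle_type n \<psi> = \<mu>"
      using ex_permutation_of_cycle_type[of \<mu>] that unfolding is_partition_def by auto
    from someI_ex[OF this] show ?thesis unfolding class_value_def by simp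
  qed
  hence "frobenius_ch n ?g = f"
    unfolding fun_eq_iff frobenius_ch_def h
    by (intro allI sum.cong) (auto simp: z_factor_nonzero is_partition_def)
  moreover have "?g \<in> class_functions n" by (rule class_function_of_cycle_type)
  ultimately show ?thesis by blast
qed

text \<open>As \<open>m_\<mu>\<close> lies in the range of \<open>frobenius_ch\<close>,
  \<open>inv_into\<close> returns a genuine preimage.\<close>

lemma frobenius_ch_inv_monomial:
  assumes "is_partition n \<mu>"
  shows "frobenius_ch_inv n (monomial_sym \<mu>) \<in> class_functions n"
    and "frobenius_ch n (frobenius_ch_inv n (monomial_sym \<mu>)) = monomial_sym \<mu>"
proof -
  note r = power_sum_span_subset_range_ch[OF monomial_sym_in_span[OF assms]]
  show "frobenius_ch_inv n (monomial_sym \<mu>) \<in> class_functions n"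
    unfolding frobenius_ch_inv_def using r by (rule inv_into_into)
  show "frobenius_ch n (frobenius_ch_inv n (monomial_sym \<mu>)) = monomial_sym \<mu>"
    unfolding frobenius_ch_inv_def using r by (rule f_inv_into_f)
qed

text \<open>All permutations of one cycle type are conjugate, so the arbitrary representative in
  \<open>class_value\<close> takes the same value as \<open>\<psi>\<close>.\<close>

lemma class_function_eq_class_value:
  assumes g: "g \<in> class_functions n" and p: "\<psi> permutes {0..<n}"
  shows "g \<psi> = class_value n g (cycle_type n \<psi>)"
proof -
  define \<phi> where "\<phi> = (SOME \<phi>. \<phi> permutes {0..<n} \<and> cycle_type n \<phi> = cycle_type n \<psi>)"
  have "\<phi> permutes {0..<n} \<and> cycle_type n \<phi> = cycle_type n \<psi>"
    unfolding \<phi>_def by (rule someI[of _ \<psi>]) (simp add: p)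
  hence \<phi>: "\<phi> permutes {0..<n}" "cycle_type n \<psi> = cycle_type n \<phi>" by auto
  obtain \<sigma> where "\<sigma> permutes {0..<n}" "\<phi> = \<sigma> \<circ> \<psi> \<circ> Hilbert_Choice.inv \<sigma>"
    using conjugate_of_cycle_type_eq[OF p \<phi>] by blast
  hence "g \<phi> = g \<psi>" using g p unfolding class_functions_def by blast
  thus ?thesis unfolding class_value_def \<phi>_def by simp
qed

section \<open>Values on permutations with cycles of length at most two\<close>

definition two_one :: "nat \<Rightarrow> nat \<Rightarrow> nat multiset" where
  "two_one n i = replicate_mset i 2 + replicate_mset (n - 2 * i) 1"

lemma inj_two_one: "two_one n i = two_one n j \<Longrightarrow> i = j"
  by (auto simp: two_one_def dest: arg_cong[of _ _ "\<lambda>M. count M 2"])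

lemma is_partition_two_one: "2 * i \<le> n \<Longrightarrow> is_partition n (two_one n i)"
  by (auto simp: two_one_def is_partition_def)

lemma eq_two_oneI:
  assumes "is_partition n \<mu>" "\<forall>c\<in>#\<mu>. c \<le> 2"
  shows "\<exists>i. 2 * i \<le> n \<and> \<mu> = two_one n i"
proof -
  have c: "c = 1 \<or> c = 2" if "c \<in># \<mu>" for c
    using assms that unfolding is_partition_def by (cases c) (force, fastforce)
  have \<mu>: "\<mu> = replicate_mset (count \<mu> 2) 2 + replicate_mset (count \<mu> 1) 1"
  proof (rule multiset_eqI)
    fix c show "count \<mu> c = count (replicate_mset (count \<mu> 2) 2 + replicate_mset (count \<mu> 1) 1) c"
      using c[of c] by (auto simp: count_eq_zero_iff)
  qed
  have "sum_mset \<mu> = 2 * count \<mu> 2 + count \<mu> 1" by (subst \<mu>) simp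
  hence "n = 2 * count \<mu> 2 + count \<mu> 1" using assms(1) unfolding is_partition_def by simp
  thus ?thesis using \<mu> unfolding two_one_def by (intro exI[of _ "count \<mu> 2"]) simp
qed

lemma z_factor_two_one:
  "z_factor (two_one n i) = 2 ^ i * fact i * fact (n - 2 * i)"
proof -
  let ?\<mu> = "two_one n i"
  have c: "count ?\<mu> 2 = i" "count ?\<mu> 1 = n - 2 * i" by (auto simp: two_one_def)
  \<comment> \<open>Extending the product to both possible parts is harmless: a part of multiplicity
    0 contributes the factor 1.\<close>
  have "z_factor ?\<mu> = (\<Prod>c\<in>{1, 2}. c ^ count ?\<mu> c * fact (count ?\<mu> c))"
    unfolding z_factor_def
    by (rule prod.mono_neutral_left) (auto simp: two_one_def split: if_splits)
  thus ?thesis by (simp add: c flip: One_nat_def)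
qed

lemma ps_coeff_twos:
  "ps_coeff (replicate i 2) (replicate_mset x 2 + replicate_mset y 1) = (if x = i \<and> y = 0 then fact x else 0)"
proof (induction i arbitrary: x)
  case (Suc i)
  have "filter_mset (\<lambda>c. 2 \<le> c) (replicate_mset x 2 + replicate_mset y 1) = replicate_mset x (2::nat)"
    by (auto simp: multiset_eq_iff)
  hence "ps_coeff (replicate (Suc i) 2) (replicate_mset x 2 + replicate_mset y 1)
    = of_nat x * ps_coeff (replicate i 2) (replicate_mset x 2 + replicate_mset y 1 - {#2#})"
    by (simp only: replicate_Suc ps_coeff.simps image_replicate_mset sum_mset_replicate_mset simp_thms if_True add_0_right)
  thus ?case using Suc by (cases x) auto
qed (auto)

text \<open>A part 1 is charged either to an exponent 2, leaving 1, or to an exponent 1, which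
  disappears. The truncated \<open>x - 1\<close> and \<open>y - 1\<close> do no harm, since their
  factors vanish at 0.\<close>

lemma ps_coeff_one_Cons:
  "ps_coeff (1 # ks) (replicate_mset x 2 + replicate_mset y 1)
     = of_nat x * ps_coeff ks (replicate_mset (x - 1) 2 + replicate_mset (y + 1) 1)
       + of_nat y * ps_coeff ks (replicate_mset x 2 + replicate_mset (y - 1) 1)"
proof -
  have "filter_mset (\<lambda>c. 1 \<le> c) (replicate_mset x 2 + replicate_mset y 1) = replicate_mset x (2::nat) + replicate_mset y 1"
    by (auto simp: multiset_eq_iff)
  hence "ps_coeff (1 # ks) (replicate_mset x 2 + replicate_mset y 1)
     = of_nat x * ps_coeff ks (replicate_mset x 2 + replicate_mset y 1 - {#2#} + {#1#})
       + of_nat y * ps_coeff ks (replicate_mset x 2 + replicate_mset y 1 - {#1#})"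
    by (simp add: image_replicate_mset sum_mset_replicate_mset)
  moreover have "replicate_mset x 2 + replicate_mset y 1 - {#2#} + {#1#}
      = replicate_mset (x - 1) 2 + replicate_mset (y + 1) (1 :: nat)" if "x \<noteq> 0"
    using that by (cases x) auto
  moreover have "replicate_mset x 2 + replicate_mset y 1 - {#1#}
      = replicate_mset x 2 + replicate_mset (y - 1) (1 :: nat)" if "y \<noteq> 0"
    using that by (cases y) auto
  ultimately show ?thesis by (cases "x = 0"; cases "y = 0") simp_all
qed

text \<open>A count: the \<open>i\<close> twos are charged to distinct exponents 2 in
  \<open>x! / (x - i)!\<close> ways, and the \<open>a\<close> ones fill the remaining
  \<open>x - i\<close> twos and the \<open>y\<close> ones in \<open>a! / 2^(x - i)\<close> ways. The
  proof follows the recursion on the ones.\<close>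

lemma ps_coeff_ones_twos:
  assumes "a + 2 * i = 2 * x + y"
  shows "ps_coeff (replicate a 1 @ replicate i 2) (replicate_mset x 2 + replicate_mset y 1)
    = (if i \<le> x then fact x * fact a / (fact (x - i) * 2 ^ (x - i)) else 0)"
  using assms
proof (induction a arbitrary: x y)
  case 0
  thus ?case using ps_coeff_twos[of i x y] by auto
next
  case (Suc a)
  let ?P = "ps_coeff (replicate a 1 @ replicate i 2)"
  let ?F = "\<lambda>x. if i \<le> x then fact x * fact a / (fact (x - i) * 2 ^ (x - i)) else (0 :: rat)"
  have 1: "of_nat x * ?P (replicate_mset (x - 1) 2 + replicate_mset (y + 1) 1) = of_nat x * ?F (x - 1)"
    using Suc.IH[of "x - 1" "y + 1"] Suc.prems by (cases x) auto
  have 2: "of_nat y * ?P (replicate_mset x 2 + replicate_mset (y - 1) 1) = of_nat y * ?F x"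
    using Suc.IH[of x "y - 1"] Suc.prems by (cases y) auto
  have "ps_coeff (replicate (Suc a) 1 @ replicate i 2) (replicate_mset x 2 + replicate_mset y 1)
     = of_nat x * ?F (x - 1) + of_nat y * ?F x"
    using ps_coeff_one_Cons[of "replicate a 1 @ replicate i 2" x y] unfolding 1 2 by simp
  also have "\<dots> = (if i \<le> x then fact x * fact (Suc a) / (fact (x - i) * 2 ^ (x - i)) else 0)"
  proof (cases "i \<le> x")
    case True
    then obtain d where d: "x = i + d" using le_Suc_ex by blast
    have a: "Suc a = 2 * d + y" using Suc.prems d by simp
    show ?thesis
    proof (cases d)
      case 0
      thus ?thesis using d a by (cases x) (auto simp: fact_Suc simp del: of_nat_Suc)
    next
      case (Suc d')
      have F1: "?F (x - 1) = fact (x - 1) * fact a / (fact d' * 2 ^ d')" using Suc d by simp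
      have F2: "?F x = (of_nat x * fact (x - 1)) * fact a / ((of_nat (Suc d') * fact d') * (2 * 2 ^ d'))"
        using Suc d fact_reduce[of x, where 'a = rat] by (simp del: of_nat_Suc)
      \<comment> \<open>The recursion closes because \<open>x * ?F (x - 1) = 2 * d * ?F x\<close>
        and \<open>2 * d + y = Suc a\<close>.\<close>
      have "of_nat x * ?F (x - 1) = of_nat (2 * d) * ?F x"
        unfolding F1 F2 unfolding Suc by (simp add: field_simps del: of_nat_Suc) simp
      hence "of_nat x * ?F (x - 1) + of_nat y * ?F x = of_nat (Suc a) * ?F x"
        unfolding a by (simp add: algebra_simps)
      thus ?thesis using True by (simp del: of_nat_Suc)
    qed
  qed (cases x, auto)
  finally show ?case .
qed

lemma sorted_list_of_two_one:
  "sorted_list_of_multiset (two_one n i) = replicate (n - 2 * i) 1 @ replicate i 2"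
proof -
  have "two_one n i = mset (replicate (n - 2 * i) 1 @ replicate i 2)" by (simp add: two_one_def)
  moreover have "sorted (replicate (n - 2 * i) 1 @ replicate i (2::nat))" by (auto simp: sorted_append)
  ultimately show ?thesis by (simp only: sorted_list_of_multiset_mset sorted_sort_id)
qed

text \<open>Dividing by \<open>z_factor\<close> turns the coefficients into binomials, up to a
  factor depending on \<open>x\<close> only, so that the system can be inverted explicitly.\<close>

lemma power_sum_two_one:
  assumes "2 * i \<le> n" "2 * x \<le> n" "exponent_type e = two_one n x"
  shows "power_sum_sym (two_one n i) e / of_nat (z_factor (two_one n i)) = of_nat (x choose i) / 2 ^ x"
proof -
  have "power_sum_sym (two_one n i) e = ps_coeff (replicate (n - 2 * i) 1 @ replicate i 2) (two_one n x)"
    using is_partition_two_one[OF assms(1)] assms(3)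
    by (simp add: power_sum_sym_eq_ps_coeff is_partition_def sorted_list_of_two_one)
  also have "\<dots> = (if i \<le> x then fact x * fact (n - 2 * i) / (fact (x - i) * 2 ^ (x - i)) else 0)"
    unfolding two_one_def using assms by (intro ps_coeff_ones_twos) simp
  finally show ?thesis
    by (auto simp: z_factor_two_one binomial_fact power_diff field_simps)
qed

text \<open>Compares the coefficients of \<open>frobenius_ch n g\<close> and \<open>m_\<mu>\<close>
  at a monomial of type \<open>two_one n x\<close>, to which only cycle types with parts at most 2
  contribute.\<close>

lemma class_value_binomial_sum:
  assumes x: "2 * x \<le> n" and ch: "frobenius_ch n g = monomial_sym \<mu>"
  shows "(\<Sum>i\<le>x. of_nat (x choose i) * class_value n g (two_one n i)) = (if \<mu> = two_one n x then 2 ^ x else 0)"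
proof -
  obtain e where e: "exponent_type e = two_one n x"
    using ex_exponent_type[of "two_one n x"] is_partition_two_one[OF x] by (auto simp: is_partition_def)
  have le2: "\<forall>c\<in>#two_one n x. c \<le> 2" by (auto simp: two_one_def split: if_splits)
  let ?f = "\<lambda>\<nu>. class_value n g \<nu> / of_nat (z_factor \<nu>) * power_sum_sym \<nu> e"
  have "monomial_sym \<mu> e = (\<Sum>\<nu> | is_partition n \<nu>. ?f \<nu>)"
    unfolding ch[symmetric] frobenius_ch_def ..
  also have "\<dots> = (\<Sum>\<nu>\<in>two_one n ` {i. 2 * i \<le> n}. ?f \<nu>)"
  proof (rule sum.mono_neutral_right[OF finite_partitions])
    show "two_one n ` {i. 2 * i \<le> n} \<subseteq> {\<nu>. is_partition n \<nu>}" using is_partition_two_one by auto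
    show "\<forall>\<nu>\<in>{\<nu>. is_partition n \<nu>} - two_one n ` {i. 2 * i \<le> n}. ?f \<nu> = 0"
    proof
      fix \<nu> assume \<nu>: "\<nu> \<in> {\<nu>. is_partition n \<nu>} - two_one n ` {i. 2 * i \<le> n}"
      have "ps_coeff (sorted_list_of_multiset \<nu>) (two_one n x) = 0"
      proof (rule ccontr)
        assume "ps_coeff (sorted_list_of_multiset \<nu>) (two_one n x) \<noteq> 0"
        hence "\<forall>c\<in>#\<nu>. c \<le> 2"
          using ps_coeff_parts_le[of "sorted_list_of_multiset \<nu>" "two_one n x" 2] le2 by simp
        hence "\<exists>i. 2 * i \<le> n \<and> \<nu> = two_one n i" using eq_two_oneI \<nu> by blast
        thus False using \<nu> by blast
      qed
      moreover have "0 \<notin># \<nu>" using \<nu> by (simp add: is_partition_def)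
      ultimately show "?f \<nu> = 0" by (simp add: power_sum_sym_eq_ps_coeff e)
    qed
  qed
  also have "\<dots> = (\<Sum>i | 2 * i \<le> n. ?f (two_one n i))"
    using inj_two_one by (subst sum.reindex) (simp_all add: inj_on_def)
  also have "\<dots> = (\<Sum>i | 2 * i \<le> n. of_nat (x choose i) * class_value n g (two_one n i) / 2 ^ x)"
  proof (rule sum.cong[OF refl])
    fix i assume "i \<in> {i. 2 * i \<le> n}"
    hence "power_sum_sym (two_one n i) e / of_nat (z_factor (two_one n i)) = of_nat (x choose i) / 2 ^ x"
      using power_sum_two_one[OF _ x e] by blast
    moreover have "?f (two_one n i)
        = class_value n g (two_one n i) * (power_sum_sym (two_one n i) e / of_nat (z_factor (two_one n i)))"
      by simp
    ultimately show "?f (two_one n i) = of_nat (x choose i) * class_value n g (two_one n i) / 2 ^ x"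
      by (simp only: times_divide_eq_right mult.commute)
  qed
  also have "\<dots> = (\<Sum>i\<le>x. of_nat (x choose i) * class_value n g (two_one n i) / 2 ^ x)"
  proof (rule sum.mono_neutral_right)
    show "finite {i. 2 * i \<le> n}" by (rule finite_subset[of _ "{..n}"]) auto
  qed (use x in auto)
  also have "\<dots> = (\<Sum>i\<le>x. of_nat (x choose i) * class_value n g (two_one n i)) / 2 ^ x"
    by (simp only: sum_divide_distrib)
  finally have "monomial_sym \<mu> e * 2 ^ x = (\<Sum>i\<le>x. of_nat (x choose i) * class_value n g (two_one n i))"
    by (subst (asm) nonzero_eq_divide_eq) simp_all
  thus ?thesis unfolding monomial_sym_def e by (auto split: if_splits)
qed

text \<open>The system is triangular with ones on the diagonal, so its equations determine the
  unknowns one after the other.\<close>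

lemma binomial_sums_determine:
  fixes a b :: "nat \<Rightarrow> rat"
  assumes "\<And>x. x \<le> m \<Longrightarrow> (\<Sum>i\<le>x. of_nat (x choose i) * a i) = (\<Sum>i\<le>x. of_nat (x choose i) * b i)" "j \<le> m"
  shows "a j = b j"
  using assms(2)
proof (induction j rule: less_induct)
  case (less j)
  have "(\<Sum>i<j. of_nat (j choose i) * a i) = (\<Sum>i<j. of_nat (j choose i) * b i)"
    using less by (intro sum.cong) auto
  thus ?case using assms(1)[OF less.prems] by (simp add: lessThan_Suc_atMost[symmetric])
qed

text \<open>Binomial inversion: \<open>(x choose i) * (i choose k)\<close> equals
  \<open>(x choose k) * ((x - k) choose (i - k))\<close>, and the alternating sum over row
  \<open>x - k\<close> vanishes unless \<open>x = k\<close>.\<close>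

lemma binomial_orthogonality:
  "(\<Sum>i\<le>x. of_nat (x choose i) * (of_nat (i choose k) * (-1) ^ (i - k))) = (if x = k then 1 else (0 :: rat))"
proof (cases "k \<le> x")
  case True
  then obtain d where d: "x = k + d" using le_Suc_ex by blast
  have "(\<Sum>i\<le>x. of_nat (x choose i) * (of_nat (i choose k) * (-1) ^ (i - k)) :: rat)
     = (\<Sum>i\<in>{k..x}. of_nat (x choose i) * (of_nat (i choose k) * (-1) ^ (i - k)))"
    by (rule sum.mono_neutral_right) auto
  also have "\<dots> = (\<Sum>j\<le>d. of_nat (x choose k) * ((-1) ^ j * of_nat (d choose j)))"
  proof (rule sum.reindex_bij_witness[of _ "\<lambda>j. j + k" "\<lambda>i. i - k"])
    fix i assume i: "i \<in> {k..x}"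
    have "(x choose i) * (i choose k) = (x choose k) * ((x - k) choose (i - k))"
      using i by (intro choose_mult) auto
    thus "of_nat (x choose k) * ((-1) ^ (i - k) * of_nat (d choose (i - k)))
        = (of_nat (x choose i) * (of_nat (i choose k) * (-1) ^ (i - k)) :: rat)"
      unfolding d by (simp add: mult.assoc[symmetric] flip: of_nat_mult)
  qed (auto simp: d)
  also have "\<dots> = (if x = k then 1 else 0)"
    using choose_alternating_sum[of d, where 'a = rat] unfolding d
    by (cases "d = 0") (auto simp: sum_distrib_left[symmetric])
  finally show ?thesis .
qed (auto intro!: sum.neutral)

text \<open>By orthogonality the asserted values solve the binomial system, and if
  \<open>\<mu>\<close> is not of the form \<open>two_one n k\<close>, the zero sequence does;
  uniqueness finishes. Equations are taken for \<open>x \<le> n div 2\<close>, where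
  \<open>two_one n x\<close> is a partition of \<open>n\<close>.\<close>

lemma frobenius_ch_inv_monomial_involution:
  assumes \<mu>: "is_partition n \<mu>" and p: "\<psi> permutes {0..<n}" and inv: "\<And>i. \<psi> (\<psi> i) = i"
  defines "j \<equiv> card {i. i < \<psi> i}"
  shows "\<mu> = two_one n k \<Longrightarrow> 2 * k \<le> n \<Longrightarrow>
      frobenius_ch_inv n (monomial_sym \<mu>) \<psi> = 2 ^ k * (of_nat (j choose k) * (-1) ^ (j - k))"
    and "\<nexists>k. 2 * k \<le> n \<and> \<mu> = two_one n k \<Longrightarrow> frobenius_ch_inv n (monomial_sym \<mu>) \<psi> = 0"
proof -
  let ?g = "frobenius_ch_inv n (monomial_sym \<mu>)"
  let ?a = "\<lambda>i. class_value n ?g (two_one n i)"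
  note g = frobenius_ch_inv_monomial[OF \<mu>]
  have j: "2 * j \<le> n" and v: "?g \<psi> = ?a j"
    using cycle_type_involution[OF p inv] class_function_eq_class_value[OF g(1) p]
    by (simp_all add: j_def two_one_def)
  have s: "(\<Sum>i\<le>x. of_nat (x choose i) * ?a i) = (if \<mu> = two_one n x then 2 ^ x else 0)" if "x \<le> n div 2" for x
    using that by (intro class_value_binomial_sum g(2)) auto
  have jm: "j \<le> n div 2" using j by auto
  show "?g \<psi> = 2 ^ k * (of_nat (j choose k) * (-1) ^ (j - k))" if k: "\<mu> = two_one n k" "2 * k \<le> n"
    unfolding v
  proof (rule binomial_sums_determine[OF _ jm])
    fix x assume "x \<le> n div 2"
    hence "(\<Sum>i\<le>x. of_nat (x choose i) * ?a i) = 2 ^ k * (if x = k then 1 else 0)"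
      using s k inj_two_one by (auto simp: k)
    also have "\<dots> = (\<Sum>i\<le>x. of_nat (x choose i) * (2 ^ k * (of_nat (i choose k) * (-1) ^ (i - k))))"
      unfolding binomial_orthogonality[symmetric] by (simp add: sum_distrib_left mult_ac)
    finally show "(\<Sum>i\<le>x. of_nat (x choose i) * ?a i)
      = (\<Sum>i\<le>x. of_nat (x choose i) * (2 ^ k * (of_nat (i choose k) * (-1) ^ (i - k))))" .
  qed
  show "?g \<psi> = 0" if k: "\<nexists>k. 2 * k \<le> n \<and> \<mu> = two_one n k"
    unfolding v
  proof (rule binomial_sums_determine[OF _ jm, where b = "\<lambda>_. 0"])
    fix x assume x: "x \<le> n div 2"
    hence "\<mu> \<noteq> two_one n x" using k by auto
    thus "(\<Sum>i\<le>x. of_nat (x choose i) * ?a i) = (\<Sum>i\<le>x. of_nat (x choose i) * 0)" using s[OF x] by simp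
  qed
qed

section \<open>Sums over involutions along edges\<close>

definition edge_involutions :: "graph \<Rightarrow> nat set \<Rightarrow> (nat \<Rightarrow> nat) set" where
  "edge_involutions E V = {\<psi>. \<psi> permutes V \<and> (\<forall>i. \<psi> (\<psi> i) = i) \<and> (\<forall>i. \<psi> i \<noteq> i \<longrightarrow> (i, \<psi> i) \<in> E)}"

text \<open>The weight \<open>t\<close> of a transposition is attached to its smaller element.\<close>

definition involution_sum :: "graph \<Rightarrow> 'a :: comm_ring_1 \<Rightarrow> (nat \<Rightarrow> 'a) \<Rightarrow> nat set \<Rightarrow> 'a" where
  "involution_sum E t w V =
     (\<Sum>\<psi>\<in>edge_involutions E V. \<Prod>i\<in>V. if \<psi> i = i then w i else if i < \<psi> i then t else 1)"

lemma finite_edge_involutions: "finite V \<Longrightarrow> finite (edge_involutions E V)"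
  unfolding edge_involutions_def by (rule finite_subset[OF _ finite_permutations[of V]]) auto

lemma involution_sum_empty: "involution_sum E t w {} = 1"
proof -
  have "edge_involutions E {} = {id}" by (auto simp: edge_involutions_def)
  thus ?thesis by (simp add: involution_sum_def)
qed

lemma edge_involutions_fixing:
  assumes "v \<notin> V"
  shows "{\<psi> \<in> edge_involutions E (insert v V). \<psi> v = v} = edge_involutions E V"
  using assms unfolding edge_involutions_def
  by (auto simp: permutes_def)

text \<open>Removing the transposition of \<open>v\<close> and \<open>u\<close> leaves an arbitrary
  edge involution of the other vertices.\<close>

lemma involution_sum_swapping:
  assumes "finite V" "v \<notin> V" "u \<in> V" "sym E"
  shows "(\<Sum>\<psi> | \<psi> \<in> edge_involutions E (insert v V) \<and> \<psi> v = u.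
            \<Prod>i\<in>insert v V. if \<psi> i = i then w i else if i < \<psi> i then t else 1)
       = (if (v, u) \<in> E then t * involution_sum E t w (V - {u}) else 0)"
proof (cases "(v, u) \<in> E")
  case False
  have "u \<noteq> v" using assms by auto
  hence "\<psi> v \<noteq> u" if "\<psi> \<in> edge_involutions E (insert v V)" for \<psi>
    using that False unfolding edge_involutions_def by auto
  hence "{\<psi>. \<psi> \<in> edge_involutions E (insert v V) \<and> \<psi> v = u} = {}" by blast
  thus ?thesis using False by (simp only: sum.empty if_False)
next
  case True
  have uv: "u \<noteq> v" using assms by auto
  let ?L = "{\<psi>. \<psi> \<in> edge_involutions E (insert v V) \<and> \<psi> v = u}"
  let ?R = "edge_involutions E (V - {u})"
  let ?w = "\<lambda>\<psi> i. if \<psi> i = i then w i else if i < \<psi> i then t else 1"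
  have "(\<Sum>\<psi>\<in>?L. \<Prod>i\<in>insert v V. ?w \<psi> i) = (\<Sum>\<phi>\<in>?R. t * (\<Prod>i\<in>V - {u}. ?w \<phi> i))"
  proof (rule sum.reindex_bij_witness[of _ "\<lambda>\<phi>. \<phi>(v := u, u := v)" "\<lambda>\<psi>. \<psi>(v := v, u := u)"])
    fix \<psi> assume "\<psi> \<in> ?L"
    hence p: "\<psi> permutes insert v V" and i: "\<And>i. \<psi> (\<psi> i) = i"
      and e: "\<And>i. \<psi> i \<noteq> i \<Longrightarrow> (i, \<psi> i) \<in> E" and v: "\<psi> v = u"
      by (auto simp: edge_involutions_def)
    have u: "\<psi> u = v" using i v by metis
    show "(\<psi>(v := v, u := u)) (v := u, u := v) = \<psi>" using u v by auto
    have ii: "(\<psi>(v := v, u := u)) ((\<psi>(v := v, u := u)) j) = j" for j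
      using i u v by (auto) metis+
    have "\<psi>(v := v, u := u) permutes V - {u}"
      unfolding permutes_def
    proof (intro conjI allI impI)
      fix j assume "j \<notin> V - {u}"
      thus "(\<psi>(v := v, u := u)) j = j" using p by (auto simp: permutes_def)
    next
      fix j show "\<exists>!k. (\<psi>(v := v, u := u)) k = j" using ii by metis
    qed
    thus "\<psi>(v := v, u := u) \<in> ?R" unfolding edge_involutions_def using e ii by auto
    have V: "insert v V = insert v (insert u (V - {u}))" using assms by auto
    have "(\<Prod>i\<in>insert v V. ?w \<psi> i) = ?w \<psi> v * (?w \<psi> u * (\<Prod>i\<in>V - {u}. ?w \<psi> i))"
      unfolding V using assms uv by (subst prod.insert, simp, simp)+ simp
    \<comment> \<open>Exactly one of \<open>v\<close> and \<open>u\<close> is the smaller element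
      and carries \<open>t\<close>; the other carries 1.\<close>
    moreover have "?w \<psi> v * ?w \<psi> u = t" using u v uv by auto
    moreover have "(\<Prod>i\<in>V - {u}. ?w \<psi> i) = (\<Prod>i\<in>V - {u}. ?w (\<psi>(v := v, u := u)) i)"
      using assms by (intro prod.cong) auto
    ultimately show "t * (\<Prod>i\<in>V - {u}. ?w (\<psi>(v := v, u := u)) i) = (\<Prod>i\<in>insert v V. ?w \<psi> i)"
      by (simp only: mult.assoc[symmetric])
  next
    fix \<phi> assume "\<phi> \<in> ?R"
    hence p: "\<phi> permutes V - {u}" and i: "\<And>i. \<phi> (\<phi> i) = i"
      and e: "\<And>i. \<phi> i \<noteq> i \<Longrightarrow> (i, \<phi> i) \<in> E"
      by (auto simp: edge_involutions_def)
    have u: "\<phi> u = u" and v: "\<phi> v = v" using p assms by (auto simp: permutes_def)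
    show "(\<phi>(v := u, u := v)) (v := v, u := u) = \<phi>" using u v by auto
    have ii: "(\<phi>(v := u, u := v)) ((\<phi>(v := u, u := v)) j) = j" for j
      using i u v uv by auto
    have "\<phi>(v := u, u := v) permutes insert v V"
      unfolding permutes_def
    proof (intro conjI allI impI)
      fix j assume "j \<notin> insert v V"
      thus "(\<phi>(v := u, u := v)) j = j" using p assms by (auto simp: permutes_def)
    next
      fix j show "\<exists>!k. (\<phi>(v := u, u := v)) k = j" using ii by metis
    qed
    thus "\<phi>(v := u, u := v) \<in> ?L"
      unfolding edge_involutions_def using e ii True symD[OF assms(4) True] uv by auto
  qed
  thus ?thesis using True by (simp add: involution_sum_def sum_distrib_left)
qed

text \<open>Sorting the involutions by the image of \<open>v\<close>, which is \<open>v\<close>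
  itself or a neighbour, gives the recursion familiar from matching polynomials.\<close>

lemma involution_sum_insert:
  assumes "finite V" "v \<notin> V" "sym E"
  shows "involution_sum E t w (insert v V)
    = w v * involution_sum E t w V + t * (\<Sum>u\<in>V \<inter> E `` {v}. involution_sum E t w (V - {u}))"
proof -
  let ?w = "\<lambda>\<psi> i. if \<psi> i = i then w i else if i < \<psi> i then t else 1"
  let ?S = "edge_involutions E (insert v V)"
  have "involution_sum E t w (insert v V)
    = (\<Sum>u\<in>insert v V. \<Sum>\<psi> | \<psi> \<in> ?S \<and> \<psi> v = u. \<Prod>i\<in>insert v V. ?w \<psi> i)"
    unfolding involution_sum_def
  proof (rule sum.group[symmetric])
    show "finite ?S" using assms by (simp add: finite_edge_involutions)
    show "(\<lambda>\<psi>. \<psi> v) ` ?S \<subseteq> insert v V"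
      unfolding edge_involutions_def using permutes_in_image[of _ "insert v V" v] by auto
  qed (use assms in simp)
  also have "\<dots> = (\<Sum>\<psi> | \<psi> \<in> ?S \<and> \<psi> v = v. \<Prod>i\<in>insert v V. ?w \<psi> i)
      + (\<Sum>u\<in>V. \<Sum>\<psi> | \<psi> \<in> ?S \<and> \<psi> v = u. \<Prod>i\<in>insert v V. ?w \<psi> i)"
    using assms by simp
  also have "(\<Sum>\<psi> | \<psi> \<in> ?S \<and> \<psi> v = v. \<Prod>i\<in>insert v V. ?w \<psi> i) = w v * involution_sum E t w V"
    unfolding involution_sum_def sum_distrib_left edge_involutions_fixing[OF assms(2)]
  proof (rule sum.cong[OF refl])
    fix \<psi> assume "\<psi> \<in> edge_involutions E V"
    hence "\<psi> v = v" using assms unfolding edge_involutions_def by (auto simp: permutes_def)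
    thus "(\<Prod>i\<in>insert v V. ?w \<psi> i) = w v * (\<Prod>i\<in>V. ?w \<psi> i)" using assms by simp
  qed
  also have "(\<Sum>u\<in>V. \<Sum>\<psi> | \<psi> \<in> ?S \<and> \<psi> v = u. \<Prod>i\<in>insert v V. ?w \<psi> i)
      = (\<Sum>u\<in>V. if (v, u) \<in> E then t * involution_sum E t w (V - {u}) else 0)"
    by (rule sum.cong[OF refl], rule involution_sum_swapping) (use assms in auto)
  also have "\<dots> = t * (\<Sum>u\<in>V \<inter> E `` {v}. involution_sum E t w (V - {u}))"
    using assms(1) by (auto simp: sum_distrib_left sum.inter_restrict intro!: sum.cong)
  finally show ?thesis .
qed

text \<open>Since \<open>f\<close> need not preserve the order, conjugation could move a weight
  \<open>t\<close> to the other element of its pair. The recursion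
  \<open>involution_sum_insert\<close> does not mention the order and avoids this.\<close>

lemma involution_sum_image:
  assumes "finite V" "inj_on f V" "sym E" "sym E'"
    and "\<And>i. i \<in> V \<Longrightarrow> w' (f i) = w i"
    and "\<And>i j. i \<in> V \<Longrightarrow> j \<in> V \<Longrightarrow> (f i, f j) \<in> E' \<longleftrightarrow> (i, j) \<in> E"
  shows "involution_sum E' t w' (f ` V) = involution_sum E t w V"
  using assms
proof (induction V rule: finite_psubset_induct)
  case (psubset V)
  show ?case
  proof (cases "V = {}")
    case False
    then obtain v where v: "v \<in> V" by blast
    define W where "W = V - {v}"
    have V: "V = insert v W" "v \<notin> W" "finite W" using v psubset.hyps by (auto simp: W_def)
    note inj = psubset.prems(1)
    have IH: "involution_sum E' t w' (f ` U) = involution_sum E t w U" if "U \<subset> V" for U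
      using that psubset.prems by (intro psubset.IH) (auto intro: inj_on_subset)
    have fv: "f v \<notin> f ` W" using V inj by (auto simp: inj_on_def)
    have N: "f ` W \<inter> E' `` {f v} = f ` (W \<inter> E `` {v})" using psubset.prems(5) V by auto
    have "involution_sum E' t w' (f ` V) = w' (f v) * involution_sum E' t w' (f ` W)
        + t * (\<Sum>u\<in>f ` (W \<inter> E `` {v}). involution_sum E' t w' (f ` W - {u}))"
      using involution_sum_insert[of "f ` W" "f v" E' t w'] fv V psubset.prems(3) N by simp
    also have "(\<Sum>u\<in>f ` (W \<inter> E `` {v}). involution_sum E' t w' (f ` W - {u}))
        = (\<Sum>u\<in>W \<inter> E `` {v}. involution_sum E' t w' (f ` W - {f u}))"
      by (subst sum.reindex) (use inj V in \<open>auto intro: inj_on_subset\<close>)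
    also have "\<dots> = (\<Sum>u\<in>W \<inter> E `` {v}. involution_sum E t w (W - {u}))"
    proof (rule sum.cong[OF refl])
      fix u assume u: "u \<in> W \<inter> E `` {v}"
      hence "f ` W - {f u} = f ` (W - {u})" using inj V by (auto simp: inj_on_def)
      thus "involution_sum E' t w' (f ` W - {f u}) = involution_sum E t w (W - {u})"
        using IH[of "W - {u}"] V by auto
    qed
    also have "involution_sum E' t w' (f ` W) = involution_sum E t w W" using IH[of W] V by auto
    finally show ?thesis
      using involution_sum_insert[OF V(3,2) psubset.prems(2), of t w] psubset.prems(4)[OF v] V(1) by simp
  qed (simp add: involution_sum_empty)
qed

lemma involution_sum_cong:
  assumes "finite V" "sym E" "sym E'" "\<And>i. i \<in> V \<Longrightarrow> w' i = w i"
    and "\<And>i j. i \<in> V \<Longrightarrow> j \<in> V \<Longrightarrow> (i, j) \<in> E' \<longleftrightarrow> (i, j) \<in> E"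
  shows "involution_sum E' t w' V = involution_sum E t w V"
  using involution_sum_image[of V "\<lambda>i. i" E E' w' w t] assms by simp

text \<open>The expansion at a vertex of \<open>V\<close> never touches \<open>U\<close>, so the
  factor for \<open>U\<close> passes through the recursion.\<close>

lemma involution_sum_Un:
  assumes "finite V" "finite U" "sym E" "V \<inter> U = {}" "\<And>i j. i \<in> V \<Longrightarrow> j \<in> U \<Longrightarrow> (i, j) \<notin> E"
  shows "involution_sum E t w (V \<union> U) = involution_sum E t w V * involution_sum E t w U"
  using assms
proof (induction V rule: finite_psubset_induct)
  case (psubset V)
  show ?case
  proof (cases "V = {}")
    case False
    then obtain v where v: "v \<in> V" by blast
    define W where "W = V - {v}"
    have V: "V = insert v W" "v \<notin> W" "finite W" using v psubset.hyps by (auto simp: W_def)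
    have vU: "v \<notin> U" using v psubset.prems by auto
    have IH: "involution_sum E t w (X \<union> U) = involution_sum E t w X * involution_sum E t w U" if "X \<subset> V" for X
      using that psubset.prems by (intro psubset.IH) auto
    have N: "(W \<union> U) \<inter> E `` {v} = W \<inter> E `` {v}" using psubset.prems v by auto
    have "involution_sum E t w (V \<union> U) = w v * involution_sum E t w (W \<union> U)
        + t * (\<Sum>u\<in>W \<inter> E `` {v}. involution_sum E t w (W \<union> U - {u}))"
      using involution_sum_insert[of "W \<union> U" v E t w] V vU psubset.prems N by simp
    also have "(\<Sum>u\<in>W \<inter> E `` {v}. involution_sum E t w (W \<union> U - {u}))
        = (\<Sum>u\<in>W \<inter> E `` {v}. involution_sum E t w (W - {u}) * involution_sum E t w U)"
    proof (rule sum.cong[OF refl])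
      fix u assume u: "u \<in> W \<inter> E `` {v}"
      hence "W \<union> U - {u} = (W - {u}) \<union> U" using psubset.prems(3) V by auto
      thus "involution_sum E t w (W \<union> U - {u}) = involution_sum E t w (W - {u}) * involution_sum E t w U"
        using IH[of "W - {u}"] V by auto
    qed
    also have "involution_sum E t w (W \<union> U) = involution_sum E t w W * involution_sum E t w U"
      using IH[of W] V by auto
    also have "(\<Sum>u\<in>W \<inter> E `` {v}. involution_sum E t w (W - {u}) * involution_sum E t w U)
        = (\<Sum>u\<in>W \<inter> E `` {v}. involution_sum E t w (W - {u})) * involution_sum E t w U"
      by (simp only: sum_distrib_right)
    finally show ?thesis
      using involution_sum_insert[OF V(3,2) psubset.prems(2), of t w] V(1)
      by (simp add: algebra_simps)
  qed (simp add: involution_sum_empty)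
qed

section \<open>Non-negativity by expansion at a boundary vertex\<close>

text \<open>Stands for the polynomials with non-negative coefficients, so that positivity can be
  argued before the polynomial rings are fixed.\<close>

definition semiring_cone :: "'a :: comm_ring_1 set \<Rightarrow> bool" where
  "semiring_cone C \<longleftrightarrow> 0 \<in> C \<and> 1 \<in> C \<and> (\<forall>a\<in>C. \<forall>b\<in>C. a + b \<in> C \<and> a * b \<in> C)"

lemma semiring_coneD:
  assumes "semiring_cone C"
  shows "0 \<in> C" "1 \<in> C" "\<And>a b. a \<in> C \<Longrightarrow> b \<in> C \<Longrightarrow> a + b \<in> C" "\<And>a b. a \<in> C \<Longrightarrow> b \<in> C \<Longrightarrow> a * b \<in> C"
    "of_nat n \<in> C"
proof -
  show "of_nat n \<in> C" using assms by (induct n) (auto simp: semiring_cone_def)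
qed (use assms in \<open>auto simp: semiring_cone_def\<close>)

lemma semiring_cone_sum:
  assumes "semiring_cone C" "\<And>i. i \<in> I \<Longrightarrow> f i \<in> C"
  shows "sum f I \<in> C"
  using assms(2) semiring_coneD[OF assms(1)] by (induct I rule: infinite_finite_induct) auto

text \<open>Induction over both claims together. At a vertex with a neighbour outside
  \<open>V\<close>, the degree term of the weight outweighs the negative part of
  \<open>Q * (s - 1)\<close>, which gives the difference; such a vertex exists by
  \<open>conn\<close>, and adding back the smaller sum gives the first claim.\<close>

lemma involution_sum_cone:
  fixes C :: "'a :: comm_ring_1 set" and X Q s :: 'a
  assumes C: "semiring_cone C" "X \<in> C" "Q \<in> C" "s \<in> C"
    and E: "finite U" "sym E" "\<And>v. finite (E `` {v})"
    and conn: "\<And>V. V \<noteq> {} \<Longrightarrow> V \<subset> U \<Longrightarrow> \<exists>v\<in>V. E `` {v} - V \<noteq> {}"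
    and w: "\<And>v. v \<in> U \<Longrightarrow> w v = X + 1 - Q + Q * of_nat (vertex_degree E v)"
    and V: "V \<subset> U"
  shows "involution_sum E (Q * (s - 1)) w V \<in> C \<and>
    (\<forall>v\<in>V. E `` {v} - V \<noteq> {} \<longrightarrow>
       involution_sum E (Q * (s - 1)) w V - involution_sum E (Q * (s - 1)) w (V - {v}) \<in> C)"
  using finite_subset[OF psubset_imp_subset[OF V] E(1)] V
proof (induction V rule: finite_psubset_induct)
  case (psubset V)
  note c = semiring_coneD[OF C(1)] semiring_cone_sum[OF C(1)]
  let ?Z = "involution_sum E (Q * (s - 1)) w"
  have ZC: "?Z W \<in> C" if "W \<subset> V" for W using psubset.IH[OF that] psubset.prems that by auto
  have diff: "?Z V - ?Z (V - {v}) \<in> C" if v: "v \<in> V" "E `` {v} - V \<noteq> {}" for v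
  proof -
    define W where "W = V - {v}"
    define N where "N = W \<inter> E `` {v}"
    have W: "V = insert v W" "v \<notin> W" "finite W" "W \<subset> V" using v psubset.hyps by (auto simp: W_def)
    have fN: "finite N" using W by (auto simp: N_def)
    have "N \<subset> E `` {v}" using v(2) W by (auto simp: N_def)
    hence "card N < vertex_degree E v" unfolding vertex_degree_def by (rule psubset_card_mono[OF E(3)])
    \<comment> \<open>One neighbour beyond \<open>N\<close> cancels the \<open>- Q\<close> of the
      weight, and \<open>k\<close> counts the remaining ones.\<close>
    then obtain k where k: "vertex_degree E v = card N + 1 + k" by (metis Suc_eq_plus1 less_iff_Suc_add add.commute add.left_commute)
    have 1: "?Z V = w v * ?Z W + Q * (s - 1) * (\<Sum>u\<in>N. ?Z (W - {u}))"
      unfolding W(1) N_def using W E(2) by (intro involution_sum_insert) auto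
    have 2: "w v = X + 1 + Q * of_nat k + Q * of_nat (card N)"
      using w[of v] v psubset.prems k by (auto simp: algebra_simps)
    have 3: "(\<Sum>u\<in>N. ?Z W - ?Z (W - {u})) = of_nat (card N) * ?Z W - (\<Sum>u\<in>N. ?Z (W - {u}))"
      by (simp add: sum_subtractf)
    \<comment> \<open>Each \<open>Q * ?Z W\<close> owed to a neighbour \<open>u\<close> in
      \<open>N\<close> is paired with the \<open>- Q * ?Z (W - {u})\<close> from the transposition
      with \<open>u\<close>, leaving a difference covered by induction.\<close>
    have "?Z V - ?Z W = X * ?Z W + Q * of_nat k * ?Z W + Q * (\<Sum>u\<in>N. ?Z W - ?Z (W - {u}))
        + Q * s * (\<Sum>u\<in>N. ?Z (W - {u}))"
      unfolding 1 2 3 by (simp add: algebra_simps)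
    moreover have "?Z W - ?Z (W - {u}) \<in> C" if u: "u \<in> N" for u
    proof -
      \<comment> \<open>After the removal of \<open>v\<close>, the vertex \<open>u\<close> has
        \<open>v\<close> as a neighbour outside \<open>W\<close>.\<close>
      have "v \<in> E `` {u} - W" using u symD[OF E(2)] W(2) by (auto simp: N_def)
      thus ?thesis using psubset.IH[OF W(4)] psubset.prems W(4) u by (auto simp: N_def)
    qed
    moreover have "?Z W \<in> C" using W(4) by (rule ZC)
    moreover have "?Z (W - {u}) \<in> C" for u using W(4) by (intro ZC) auto
    ultimately show ?thesis unfolding W_def[symmetric] using C(2-4) by (auto intro!: c)
  qed
  moreover have "?Z V \<in> C"
  proof (cases "V = {}")
    case True
    thus ?thesis using c by (simp add: involution_sum_empty)
  next
    case False
    then obtain v where v: "v \<in> V" "E `` {v} - V \<noteq> {}" using conn psubset.prems by blast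
    have "?Z V = (?Z V - ?Z (V - {v})) + ?Z (V - {v})" by simp
    also have "\<dots> \<in> C" using diff[OF v] ZC[of "V - {v}"] v by (intro c) auto
    finally show ?thesis .
  qed
  ultimately show ?case by blast
qed

section \<open>Comparison of two expansions at a pair of vertices\<close>

lemma involution_sum_insert2:
  fixes E :: graph and t :: "'a :: comm_ring_1" and w :: "nat \<Rightarrow> 'a"
  assumes "finite W" "x \<notin> W" "y \<notin> W" "x \<noteq> y" "sym E"
  defines "Z \<equiv> involution_sum E t w"
  shows "Z (insert x (insert y W)) =
     w x * (w y * Z W + t * (\<Sum>v\<in>W \<inter> E `` {y}. Z (W - {v})))
     + t * (\<Sum>u\<in>W \<inter> E `` {x}. w y * Z (W - {u}) + t * (\<Sum>v\<in>W \<inter> E `` {y} - {u}. Z (W - {u} - {v})))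
     + (if (x, y) \<in> E then t * Z W else 0)"
proof -
  have 1: "Z (insert y U) = w y * Z U + t * (\<Sum>v\<in>U \<inter> E `` {y}. Z (U - {v}))" if "U \<subseteq> W" for U
    unfolding Z_def using assms that by (intro involution_sum_insert) (auto intro: finite_subset)
  have "Z (insert x (insert y W)) = w x * Z (insert y W) + t * (\<Sum>u\<in>insert y W \<inter> E `` {x}. Z (insert y W - {u}))"
    unfolding Z_def using assms by (intro involution_sum_insert) auto
  also have "(\<Sum>u\<in>insert y W \<inter> E `` {x}. Z (insert y W - {u}))
    = (if (x, y) \<in> E then Z W else 0) + (\<Sum>u\<in>W \<inter> E `` {x}. Z (insert y W - {u}))"
    using assms(1,3) by (auto simp: Int_insert_left)
  also have "(\<Sum>u\<in>W \<inter> E `` {x}. Z (insert y W - {u}))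
    = (\<Sum>u\<in>W \<inter> E `` {x}. w y * Z (W - {u}) + t * (\<Sum>v\<in>W \<inter> E `` {y} - {u}. Z (W - {u} - {v})))"
  proof (rule sum.cong[OF refl])
    fix u assume "u \<in> W \<inter> E `` {x}"
    hence "insert y W - {u} = insert y (W - {u})" using assms(3) by auto
    moreover have "(W - {u}) \<inter> E `` {y} = W \<inter> E `` {y} - {u}" by auto
    ultimately show "Z (insert y W - {u}) = w y * Z (W - {u}) + t * (\<Sum>v\<in>W \<inter> E `` {y} - {u}. Z (W - {u} - {v}))"
      using 1[of "W - {u}"] by (simp only: Diff_subset)
  qed
  finally show ?thesis using 1[of W] by (simp add: distrib_left)
qed

text \<open>Here \<open>A\<close> and \<open>B\<close> are the off-path neighbours of
  \<open>x\<close> and \<open>y\<close>, while \<open>P\<close> and \<open>S\<close> are their path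
  neighbours other than \<open>x\<close> and \<open>y\<close>. The shift moves \<open>B\<close> from
  \<open>y\<close> to \<open>x\<close>; \<open>refl1\<close> and \<open>refl2\<close> let
  \<open>P\<close> be exchanged for \<open>S\<close>, so that only terms indexed by pairs from
  \<open>A\<close> and \<open>B\<close> survive.\<close>

lemma involution_sum_shift_diff:
  fixes E E' :: graph and Q s c :: "'a :: comm_ring_1" and w w' :: "nat \<Rightarrow> 'a"
  defines "Z \<equiv> involution_sum E (Q * (s - 1)) w" and "Z' \<equiv> involution_sum E' (Q * (s - 1)) w'"
  assumes W: "finite W" "x \<notin> W" "y \<notin> W" "x \<noteq> y" and sym: "sym E" "sym E'"
    and nb: "W \<inter> E `` {x} = A \<union> P" "W \<inter> E `` {y} = B \<union> S"
      "W \<inter> E' `` {x} = A \<union> B \<union> P" "W \<inter> E' `` {y} = S"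
    and disj: "A \<inter> B = {}" "A \<inter> P = {}" "B \<inter> P = {}" "A \<inter> S = {}" "B \<inter> S = {}"
    and xy: "(x, y) \<in> E' \<longleftrightarrow> (x, y) \<in> E"
    and eq: "\<And>U. U \<subseteq> W \<Longrightarrow> Z' U = Z U"
    and w: "w x = c + Q * of_nat (card A)" "w y = c + Q * of_nat (card B)"
      "w' x = c + Q * of_nat (card A + card B)" "w' y = c"
    and refl1: "(\<Sum>p\<in>P. Z (W - {p})) = (\<Sum>p\<in>S. Z (W - {p}))"
    and refl2: "\<And>v. v \<in> B \<Longrightarrow> (\<Sum>p\<in>P. Z (W - {v} - {p})) = (\<Sum>p\<in>S. Z (W - {v} - {p}))"
  shows "Z (insert x (insert y W)) - Z' (insert x (insert y W)) =
    (\<Sum>u\<in>A. \<Sum>v\<in>B. Q\<^sup>2 * (Z W + (s - 1) * Z (W - {u}) + (s - 1) * Z (W - {v}) + (s - 1)\<^sup>2 * Z (W - {u} - {v})))"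
proof -
  let ?t = "Q * (s - 1)"
  have "finite (A \<union> P)" "finite (B \<union> S)" using W(1) nb(1,2) by (metis finite_Int)+
  hence fin: "finite A" "finite P" "finite B" "finite S" by auto
  define e where "e = (if (x, y) \<in> E then ?t * Z W else 0)"
  define SA where "SA = (\<Sum>u\<in>A. Z (W - {u}))"
  define SB where "SB = (\<Sum>u\<in>B. Z (W - {u}))"
  define SS where "SS = (\<Sum>u\<in>S. Z (W - {u}))"
  define SAB where "SAB = (\<Sum>u\<in>A. \<Sum>v\<in>B. Z (W - {u} - {v}))"
  define SAS where "SAS = (\<Sum>u\<in>A. \<Sum>v\<in>S. Z (W - {u} - {v}))"
  define SBS where "SBS = (\<Sum>u\<in>B. \<Sum>v\<in>S. Z (W - {u} - {v}))"
  define SPS where "SPS = (\<Sum>u\<in>P. \<Sum>v\<in>S - {u}. Z (W - {u} - {v}))"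
  \<comment> \<open>After interchanging the sums, \<open>refl2\<close> replaces \<open>P\<close> by
    \<open>S\<close>, so this mixed term also occurs in the expansion of \<open>Z'\<close>.\<close>
  have SPB: "(\<Sum>u\<in>P. \<Sum>v\<in>B. Z (W - {u} - {v})) = SBS"
  proof -
    have "(\<Sum>u\<in>P. \<Sum>v\<in>B. Z (W - {u} - {v})) = (\<Sum>v\<in>B. \<Sum>u\<in>P. Z (W - {v} - {u}))"
      by (subst sum.swap) (simp add: Diff_insert2[symmetric] insert_commute)
    thus ?thesis unfolding SBS_def using refl2 by simp
  qed
  have 1: "Z (insert x (insert y W)) =
      w x * (w y * Z W + ?t * (SB + SS)) + ?t * (w y * SA + ?t * (SAB + SAS) + w y * SS + ?t * (SBS + SPS)) + e"
  proof -
    have "(\<Sum>v\<in>B \<union> S. Z (W - {v})) = SB + SS"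
      unfolding SB_def SS_def using fin disj by (simp add: sum.union_disjoint)
    moreover have "(\<Sum>u\<in>A \<union> P. w y * Z (W - {u}) + ?t * (\<Sum>v\<in>B \<union> S - {u}. Z (W - {u} - {v})))
      = (\<Sum>u\<in>A. w y * Z (W - {u}) + ?t * (\<Sum>v\<in>B \<union> S - {u}. Z (W - {u} - {v})))
      + (\<Sum>u\<in>P. w y * Z (W - {u}) + ?t * (\<Sum>v\<in>B \<union> S - {u}. Z (W - {u} - {v})))"
      using fin disj by (intro sum.union_disjoint)
    moreover have "(\<Sum>u\<in>A. w y * Z (W - {u}) + ?t * (\<Sum>v\<in>B \<union> S - {u}. Z (W - {u} - {v})))
      = w y * SA + ?t * (SAB + SAS)"
    proof -
      have "(\<Sum>v\<in>B \<union> S - {u}. Z (W - {u} - {v})) = (\<Sum>v\<in>B. Z (W - {u} - {v})) + (\<Sum>v\<in>S. Z (W - {u} - {v}))"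
        if "u \<in> A" for u
      proof -
        have "B \<union> S - {u} = B \<union> S" using that disj by auto
        thus ?thesis using fin disj by (simp add: sum.union_disjoint)
      qed
      thus ?thesis unfolding SA_def SAB_def SAS_def
        by (simp add: sum.distrib sum_distrib_left distrib_left)
    qed
    moreover have "(\<Sum>u\<in>P. w y * Z (W - {u}) + ?t * (\<Sum>v\<in>B \<union> S - {u}. Z (W - {u} - {v})))
      = w y * SS + ?t * (SBS + SPS)"
    proof -
      have "(\<Sum>v\<in>B \<union> S - {u}. Z (W - {u} - {v})) = (\<Sum>v\<in>B. Z (W - {u} - {v})) + (\<Sum>v\<in>S - {u}. Z (W - {u} - {v}))"
        if "u \<in> P" for u
      proof -
        have "B \<union> S - {u} = B \<union> (S - {u})" using that disj by auto
        thus ?thesis using fin disj by (simp only:) (intro sum.union_disjoint, auto)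
      qed
      hence "(\<Sum>u\<in>P. w y * Z (W - {u}) + ?t * (\<Sum>v\<in>B \<union> S - {u}. Z (W - {u} - {v})))
        = w y * (\<Sum>u\<in>P. Z (W - {u})) + ?t * ((\<Sum>u\<in>P. \<Sum>v\<in>B. Z (W - {u} - {v})) + SPS)"
        unfolding SPS_def by (simp add: sum.distrib sum_distrib_left distrib_left)
      thus ?thesis unfolding SPB refl1 SS_def .
    qed
    ultimately show ?thesis
      using involution_sum_insert2[OF W sym(1), of ?t w] unfolding Z_def[symmetric] nb e_def by (simp only: add.assoc)
  qed
  have 2: "Z' (insert x (insert y W)) =
      w' x * (w' y * Z W + ?t * SS) + ?t * (w' y * SA + ?t * SAS + (w' y * SB + ?t * SBS) + (w' y * SS + ?t * SPS)) + e"
  proof -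
    have "Z' (insert x (insert y W)) =
     w' x * (w' y * Z' W + ?t * (\<Sum>v\<in>S. Z' (W - {v})))
     + ?t * (\<Sum>u\<in>A \<union> B \<union> P. w' y * Z' (W - {u}) + ?t * (\<Sum>v\<in>S - {u}. Z' (W - {u} - {v})))
     + (if (x, y) \<in> E then ?t * Z' W else 0)"
      using involution_sum_insert2[OF W sym(2), of ?t w'] unfolding Z'_def[symmetric] nb xy .
    also have "\<dots> = w' x * (w' y * Z W + ?t * (\<Sum>v\<in>S. Z (W - {v})))
     + ?t * (\<Sum>u\<in>A \<union> B \<union> P. w' y * Z (W - {u}) + ?t * (\<Sum>v\<in>S - {u}. Z (W - {u} - {v})))
     + (if (x, y) \<in> E then ?t * Z W else 0)"
    proof -
      have "Z' W = Z W" "Z' (W - {u}) = Z (W - {u})" "Z' (W - {u} - {v}) = Z (W - {u} - {v})" for u v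
        by (rule eq, blast)+
      thus ?thesis by (simp only:)
    qed
    also have "(\<Sum>u\<in>A \<union> B \<union> P. w' y * Z (W - {u}) + ?t * (\<Sum>v\<in>S - {u}. Z (W - {u} - {v})))
      = (\<Sum>u\<in>A. w' y * Z (W - {u}) + ?t * (\<Sum>v\<in>S - {u}. Z (W - {u} - {v})))
      + (\<Sum>u\<in>B. w' y * Z (W - {u}) + ?t * (\<Sum>v\<in>S - {u}. Z (W - {u} - {v})))
      + (\<Sum>u\<in>P. w' y * Z (W - {u}) + ?t * (\<Sum>v\<in>S - {u}. Z (W - {u} - {v})))"
      using fin disj by (subst sum.union_disjoint, auto)+
    also have "(\<Sum>u\<in>A. w' y * Z (W - {u}) + ?t * (\<Sum>v\<in>S - {u}. Z (W - {u} - {v}))) = w' y * SA + ?t * SAS"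
    proof -
      have "S - {u} = S" if "u \<in> A" for u using disj that by auto
      thus ?thesis unfolding SA_def SAS_def by (simp add: sum.distrib sum_distrib_left)
    qed
    also have "(\<Sum>u\<in>B. w' y * Z (W - {u}) + ?t * (\<Sum>v\<in>S - {u}. Z (W - {u} - {v}))) = w' y * SB + ?t * SBS"
    proof -
      have "S - {u} = S" if "u \<in> B" for u using disj that by auto
      thus ?thesis unfolding SB_def SBS_def by (simp add: sum.distrib sum_distrib_left)
    qed
    also have "(\<Sum>u\<in>P. w' y * Z (W - {u}) + ?t * (\<Sum>v\<in>S - {u}. Z (W - {u} - {v}))) = w' y * SS + ?t * SPS"
      unfolding SS_def refl1[symmetric] SPS_def by (simp add: sum.distrib sum_distrib_left)
    finally show ?thesis unfolding e_def SS_def .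
  qed
  define a :: 'a where "a = of_nat (card A)"
  define b :: 'a where "b = of_nat (card B)"
  have w': "w x = c + Q * a" "w y = c + Q * b" "w' x = c + Q * (a + b)" "w' y = c"
    using w unfolding a_def b_def by auto
  have 3: "(\<Sum>u\<in>A. \<Sum>v\<in>B. Q\<^sup>2 * (Z W + (s - 1) * Z (W - {u}) + (s - 1) * Z (W - {v}) + (s - 1)\<^sup>2 * Z (W - {u} - {v})))
      = Q\<^sup>2 * (a * b * Z W + (s - 1) * b * SA + (s - 1) * a * SB + (s - 1)\<^sup>2 * SAB)"
  proof -
    have "(\<Sum>v\<in>B. Q\<^sup>2 * (Z W + (s - 1) * Z (W - {u}) + (s - 1) * Z (W - {v}) + (s - 1)\<^sup>2 * Z (W - {u} - {v})))
      = Q\<^sup>2 * (b * Z W + (s - 1) * b * Z (W - {u}) + (s - 1) * SB + (s - 1)\<^sup>2 * (\<Sum>v\<in>B. Z (W - {u} - {v})))" for u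
    proof -
      have "(\<Sum>v\<in>B. Q\<^sup>2 * (Z W + (s - 1) * Z (W - {u}) + (s - 1) * Z (W - {v}) + (s - 1)\<^sup>2 * Z (W - {u} - {v})))
        = Q\<^sup>2 * (of_nat (card B) * Z W + (s - 1) * (of_nat (card B) * Z (W - {u}))
            + (s - 1) * (\<Sum>v\<in>B. Z (W - {v})) + (s - 1)\<^sup>2 * (\<Sum>v\<in>B. Z (W - {u} - {v})))"
        by (simp only: sum_distrib_left[symmetric] sum.distrib sum_constant)
      thus ?thesis unfolding SB_def b_def by (simp only: mult_ac)
    qed
    hence "(\<Sum>u\<in>A. \<Sum>v\<in>B. Q\<^sup>2 * (Z W + (s - 1) * Z (W - {u}) + (s - 1) * Z (W - {v}) + (s - 1)\<^sup>2 * Z (W - {u} - {v})))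
      = Q\<^sup>2 * (b * (a * Z W) + (s - 1) * b * SA + (s - 1) * (a * SB) + (s - 1)\<^sup>2 * SAB)"
      unfolding SAB_def SA_def a_def by (simp only: sum_distrib_left[symmetric] sum.distrib sum_constant)
    thus ?thesis by (simp only: mult_ac)
  qed
  \<comment> \<open>\<open>SS\<close> drops out since \<open>w x + w y = w' x + w' y\<close>, and
    \<open>SAS\<close>, \<open>SBS\<close>, \<open>SPS\<close> and \<open>e\<close> agree on both
    sides. The term with \<open>Z W\<close> survives because
    \<open>w x * w y - w' x * w' y = Q^2 * a * b\<close>.\<close>
  show ?thesis unfolding 1 2 3 w'
    by (simp add: algebra_simps power2_eq_square)
qed

lemma distinct_path_of_rtrancl:
  assumes "(v, u) \<in> r\<^sup>*" "r \<subseteq> S \<times> S" "u \<in> S"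
  shows "\<exists>q. q \<noteq> [] \<and> hd q = v \<and> last q = u \<and> distinct q \<and> successively (\<lambda>a b. (a, b) \<in> r) q \<and> set q \<subseteq> S"
  using assms(1)
proof (induction rule: converse_rtrancl_induct)
  case base
  show ?case by (intro exI[of _ "[u]"]) (simp add: assms)
next
  case (step v v')
  then obtain q where q: "q \<noteq> []" "hd q = v'" "last q = u" "distinct q"
    "successively (\<lambda>a b. (a, b) \<in> r) q" "set q \<subseteq> S" by blast
  show ?case
  proof (cases "v \<in> set q")
    case True
    \<comment> \<open>The new vertex already lies on the path, so the loop up to its occurrence is
      cut off.\<close>
    then obtain q1 q2 where "q = q1 @ v # q2" by (meson split_list)
    thus ?thesis using q by (intro exI[of _ "v # q2"]) (auto simp: successively_append_iff)
  next
    case False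
    thus ?thesis using q step(1) assms(2)
      by (intro exI[of _ "v # q"]) (auto simp: successively_Cons)
  qed
qed

section \<open>Generalized tree shifts\<close>

locale shift_path =
  fixes n :: nat and T :: graph and p :: "nat list"
  assumes tree: "is_tree n T" and path: "is_path T p" and len: "2 \<le> length p"
    and deg2: "\<And>v. v \<in> set p - {hd p, last p} \<Longrightarrow> vertex_degree T v = 2"
begin

lemma graph_facts:
  shows sub: "T \<subseteq> {0..<n} \<times> {0..<n}" and symT: "sym T" and irreflT: "irrefl T" and finite_nbrs: "finite (T `` X)"
proof -
  show s: "T \<subseteq> {0..<n} \<times> {0..<n}" and "sym T" "irrefl T"
    using tree by (auto simp: is_tree_def is_graph_def)
  have "T `` X \<subseteq> {0..<n}" using s by auto
  thus "finite (T `` X)" by (rule finite_subset) simp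
qed

lemma T_commute: "(u, v) \<in> T \<longleftrightarrow> (v, u) \<in> T"
  using symT by (auto dest: symD)

lemma distinct_p: "distinct p" using path by (simp add: is_path_def)

lemma ends: "hd p = p ! 0" "last p = p ! (length p - 1)" "p \<noteq> []"
proof -
  show "p \<noteq> []" using len by auto
  thus "hd p = p ! 0" "last p = p ! (length p - 1)" by (simp_all add: hd_conv_nth last_conv_nth)
qed

lemma nth_eq: "i < length p \<Longrightarrow> j < length p \<Longrightarrow> p ! i = p ! j \<longleftrightarrow> i = j"
  using distinct_p by (simp add: nth_eq_iff_index_eq)

lemma nth_edge: "Suc i < length p \<Longrightarrow> (p ! i, p ! Suc i) \<in> T"
  using path by (auto simp: is_path_def successively_conv_nth)

text \<open>The two neighbours along the path already exhaust the degree 2.\<close>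

lemma interior_nbrs:
  assumes "0 < i" "Suc i < length p"
  shows "T `` {p ! i} = {p ! (i - 1), p ! Suc i}"
proof (rule sym, rule card_subset_eq)
  show "{p ! (i - 1), p ! Suc i} \<subseteq> T `` {p ! i}"
    using nth_edge[of "i - 1"] nth_edge[of i] assms T_commute by auto
  have "p ! i \<in> set p - {hd p, last p}" using assms by (auto simp: ends nth_eq)
  thus "card {p ! (i - 1), p ! Suc i} = card (T `` {p ! i})"
    using deg2 assms unfolding vertex_degree_def by (auto simp: nth_eq)
qed (rule finite_nbrs)

text \<open>An interior vertex has only its two path neighbours, and an edge between the ends of a
  path on three or more vertices would close a cycle.\<close>

lemma path_edge_iff:
  assumes i: "i < length p" and j: "j < length p"
  shows "(p ! i, p ! j) \<in> T \<longleftrightarrow> j = Suc i \<or> i = Suc j"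
proof
  assume "j = Suc i \<or> i = Suc j"
  thus "(p ! i, p ! j) \<in> T" using nth_edge[of i] nth_edge[of j] i j T_commute by auto
next
  assume e: "(p ! i, p ! j) \<in> T"
  have int: "j = Suc i \<or> i = Suc j" if "0 < i" "Suc i < length p" "j < length p" "(p ! i, p ! j) \<in> T" for i j
  proof -
    have "p ! j \<in> {p ! (i - 1), p ! Suc i}" using interior_nbrs[OF that(1,2)] that(4) by auto
    hence "j = i - 1 \<or> j = Suc i" using that by (auto simp: nth_eq)
    thus ?thesis using that(1) by auto
  qed
  have ij: "i \<noteq> j" using e irreflT by (auto simp: irrefl_def)
  have edge: "length p = 2" if "(p ! 0, p ! (length p - 1)) \<in> T"
  proof (rule ccontr)
    assume "length p \<noteq> 2"
    hence "is_cycle T p" using len path that T_commute unfolding is_cycle_def ends(1,2) by auto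
    thus False using tree by (auto simp: is_tree_def)
  qed
  consider "0 < i \<and> Suc i < length p" | "0 < j \<and> Suc j < length p"
    | "i = 0 \<and> j = length p - 1" | "j = 0 \<and> i = length p - 1"
    using i j ij by linarith
  thus "j = Suc i \<or> i = Suc j"
  proof cases
    case 1 thus ?thesis using int[of i j] e j by auto
  next
    case 2 thus ?thesis using int[of j i] e i T_commute by auto
  next
    case 3 thus ?thesis using edge e by auto
  next
    case 4 thus ?thesis using edge e T_commute by auto
  qed
qed

lemma p_sub: "set p \<subseteq> {0..<n}"
proof
  fix v assume "v \<in> set p"
  then obtain i where i: "i < length p" "v = p ! i" by (auto simp: set_conv_nth)
  show "v \<in> {0..<n}"
  proof (cases i)
    case 0 thus ?thesis using nth_edge[of 0] sub i len by auto
  next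
    case (Suc j) thus ?thesis using nth_edge[of j] sub i by auto
  qed
qed

lemma ends_distinct: "hd p \<noteq> last p" using len by (auto simp: ends nth_eq)

lemma nbrs_hd_on_path: "T `` {hd p} \<inter> set p = {p ! 1}"
  using len by (auto simp: ends set_conv_nth path_edge_iff)

lemma last_butlast: "last (butlast p) = p ! (length p - 2)"
proof -
  have "butlast p \<noteq> []" using len by (auto simp flip: length_greater_0_conv)
  thus ?thesis using len by (simp add: last_conv_nth nth_butlast numeral_2_eq_2)
qed

lemma nbrs_last_on_path: "T `` {last p} \<inter> set p = {last (butlast p)}"
proof -
  obtain l where "length p = l + 2" using len by (metis add.commute le_iff_add)
  thus ?thesis unfolding last_butlast by (auto simp: ends set_conv_nth path_edge_iff)
qed

section \<open>Reflection of the path\<close>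

definition flip :: "nat \<Rightarrow> nat" where
  "flip v = (case map_of (zip p (rev p)) v of Some u \<Rightarrow> u | None \<Rightarrow> v)"

lemma flip_nth: "i < length p \<Longrightarrow> flip (p ! i) = p ! (length p - Suc i)"
  unfolding flip_def using distinct_p by (simp add: map_of_zip_nth rev_nth)

lemma flip_off_path: "v \<notin> set p \<Longrightarrow> flip v = v"
proof -
  assume "v \<notin> set p"
  hence "map_of (zip p (rev p)) v = None" by (simp add: map_of_zip_is_None)
  thus ?thesis by (simp only: flip_def option.case)
qed

lemma flip_flip: "flip (flip v) = v"
proof (cases "v \<in> set p")
  case True
  then obtain i where "i < length p" "v = p ! i" by (auto simp: set_conv_nth)
  thus ?thesis by (simp add: flip_nth)
qed (simp add: flip_off_path)

lemma inj_flip: "inj flip" by (metis flip_flip injI)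

abbreviation (input) "off_ends \<equiv> {0..<n} - {hd p, last p}"

lemma off_ends_cases:
  assumes "v \<in> off_ends"
  obtains "v \<notin> set p" "flip v = v"
  | i where "0 < i" "Suc i < length p" "v = p ! i" "flip v = p ! (length p - Suc i)"
proof (cases "v \<in> set p")
  case True
  then obtain i where i: "i < length p" "v = p ! i" by (auto simp: set_conv_nth)
  have "i \<noteq> 0" "i \<noteq> length p - 1" using assms i ends by (metis Diff_iff insertCI)+
  thus ?thesis using that(2)[of i] i flip_nth by auto
qed (use that(1) flip_off_path in auto)

lemma flip_off_ends: "flip ` off_ends = off_ends"
proof -
  have s: "flip v \<in> off_ends" if "v \<in> off_ends" for v
    using that
  proof (cases rule: off_ends_cases)
    case (2 i)
    hence "flip v \<in> set p" by auto
    hence "flip v \<in> {0..<n}" using p_sub by blast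
    moreover have "flip v \<noteq> hd p" "flip v \<noteq> last p" unfolding 2(4) ends
      using 2(1,2) by (subst nth_eq; force)+
    ultimately show ?thesis by blast
  qed (use that in simp)
  show ?thesis
  proof (intro equalityI subsetI)
    fix v assume "v \<in> off_ends"
    hence "flip (flip v) \<in> flip ` off_ends" by (rule imageI[OF s])
    thus "v \<in> flip ` off_ends" by (simp only: flip_flip)
  next
    fix v assume "v \<in> flip ` off_ends"
    then obtain u where "u \<in> off_ends" "v = flip u" by blast
    thus "v \<in> off_ends" by (simp only: s)
  qed
qed

text \<open>Among the vertices other than the ends, the interior of the path is joined to nothing
  else and all its vertices have degree 2, so reversing it is a symmetry. The ends are left out
  because the reflection does not exchange their off-path neighbours.\<close>

lemma flip_preserves:
  assumes "u \<in> off_ends" "v \<in> off_ends"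
  shows "(flip u, flip v) \<in> T \<longleftrightarrow> (u, v) \<in> T" "vertex_degree T (flip u) = vertex_degree T u"
proof -
  have no: "(p ! i, v) \<notin> T" if "0 < i" "Suc i < length p" "v \<notin> set p" for i v
    using interior_nbrs[OF that(1,2)] that by (auto simp: Image_singleton_iff[symmetric])
  show "(flip u, flip v) \<in> T \<longleftrightarrow> (u, v) \<in> T"
    using assms(1)
  proof (cases rule: off_ends_cases)
    case 1
    note u = this
    show ?thesis using assms(2)
    proof (cases rule: off_ends_cases)
      case 1 thus ?thesis using u by simp
    next
      case (2 i)
      hence "(v, u) \<notin> T" "(flip v, u) \<notin> T" using no[of i u] no[of "length p - Suc i" u] u by auto
      thus ?thesis using u T_commute by auto
    qed
  next
    case (2 i)
    note u = this
    show ?thesis using assms(2)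
    proof (cases rule: off_ends_cases)
      case 1
      hence "(u, v) \<notin> T" "(flip u, v) \<notin> T" using no[of i v] no[of "length p - Suc i" v] u by auto
      thus ?thesis using 1 by auto
    next
      case (2 j)
      show ?thesis unfolding u(4) 2(4) unfolding u(3) 2(3)
        using u(1,2) 2(1,2) by (subst (1 2) path_edge_iff) auto
    qed
  qed
  show "vertex_degree T (flip u) = vertex_degree T u"
    using assms(1)
  proof (cases rule: off_ends_cases)
    case (2 i)
    have "p ! j \<in> set p - {hd p, last p}" if "0 < j" "Suc j < length p" for j
      using that by (auto simp: ends nth_eq)
    thus ?thesis using deg2 2 by simp
  qed simp
qed

lemma involution_sum_flip:
  assumes "U \<subseteq> off_ends"
  shows "involution_sum T t (\<lambda>v. g (vertex_degree T v)) (flip ` U) = involution_sum T t (\<lambda>v. g (vertex_degree T v)) U"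
proof (rule involution_sum_image[OF _ _ symT symT])
  show "finite U" using assms by (rule finite_subset) simp
  show "inj_on flip U" using inj_flip by (rule inj_on_subset) simp
  show "g (vertex_degree T (flip i)) = g (vertex_degree T i)" if "i \<in> U" for i
    using flip_preserves(2)[of i i] that assms by (metis subsetD)
  show "(flip i, flip j) \<in> T \<longleftrightarrow> (i, j) \<in> T" if "i \<in> U" "j \<in> U" for i j
    using that assms by (intro flip_preserves(1)) auto
qed

section \<open>The branch at the first end of the path\<close>

definition branch :: "nat set" where
  "branch = (T \<inter> (({0..<n} - set p) \<times> ({0..<n} - set p)))\<^sup>* `` (T `` {hd p} - set p)"

lemma branch_sub: "branch \<subseteq> {0..<n} - set p"
proof
  fix v assume "v \<in> branch"
  then obtain u where u: "u \<in> T `` {hd p} - set p" "(u, v) \<in> (T \<inter> (({0..<n} - set p) \<times> ({0..<n} - set p)))\<^sup>*"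
    by (auto simp: branch_def)
  from u(2) show "v \<in> {0..<n} - set p" by (cases rule: rtrancl.cases) (use u(1) sub in auto)
qed

lemma hd_nbrs_sub_branch: "T `` {hd p} - set p \<subseteq> branch"
  by (auto simp: branch_def)

text \<open>A neighbour off the path would itself be reached, and an interior path vertex has both
  its neighbours on the path.\<close>

lemma branch_closed:
  assumes "u \<in> branch" "v \<in> off_ends - branch"
  shows "(u, v) \<notin> T"
proof
  assume e: "(u, v) \<in> T"
  have u: "u \<in> {0..<n} - set p" using assms(1) branch_sub by auto
  have "v \<in> off_ends" using assms by auto
  thus False
  proof (cases rule: off_ends_cases)
    case 1
    hence "(u, v) \<in> T \<inter> (({0..<n} - set p) \<times> ({0..<n} - set p))" using e u assms by auto
    hence "v \<in> branch" using assms(1) unfolding branch_def by (meson ImageE ImageI rtrancl.rtrancl_into_rtrancl)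
    thus False using assms by auto
  next
    case (2 i)
    hence "u \<in> {p ! (i - 1), p ! Suc i}" using interior_nbrs[of i] e T_commute by auto
    thus False using u 2 by auto
  qed
qed

text \<open>A branch vertex adjacent to the other end would close a cycle through the path.\<close>

lemma last_nbrs_off_branch: "(T `` {last p} - set p) \<inter> branch = {}"
proof (rule ccontr)
  assume "(T `` {last p} - set p) \<inter> branch \<noteq> {}"
  then obtain v where v: "(last p, v) \<in> T" "v \<notin> set p" "v \<in> branch" by auto
  let ?r = "T \<inter> (({0..<n} - set p) \<times> ({0..<n} - set p))"
  obtain u where u: "(hd p, u) \<in> T" "u \<notin> set p" "(u, v) \<in> ?r\<^sup>*" using v(3) by (auto simp: branch_def)
  have "sym ?r" using symT by (auto simp: sym_def)
  hence "(v, u) \<in> ?r\<^sup>*" using u(3) by (meson sym_rtrancl symD)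
  moreover have "u \<in> {0..<n} - set p" using u sub by auto
  ultimately obtain q where q: "q \<noteq> []" "hd q = v" "last q = u" "distinct q"
    "successively (\<lambda>a b. (a, b) \<in> ?r) q" "set q \<subseteq> {0..<n} - set p"
    using distinct_path_of_rtrancl[of v u ?r "{0..<n} - set p"] by blast
  have "successively (\<lambda>a b. (a, b) \<in> T) q" using q(5) by (rule successively_mono) auto
  hence "is_path T (p @ q)"
    using path q v(1) ends(3) unfolding is_path_def by (auto simp: successively_append_iff)
  moreover have "length (p @ q) \<ge> 3" using len q(1) by (cases q) auto
  moreover have "(last (p @ q), hd (p @ q)) \<in> T" using q u(1) ends(3) T_commute by simp
  ultimately have "is_cycle T (p @ q)" unfolding is_cycle_def by blast
  thus False using tree by (auto simp: is_tree_def)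
qed

text \<open>A set without outgoing edges contains everything reachable from it. This supplies the
  hypothesis \<open>conn\<close> of \<open>involution_sum_cone\<close>.\<close>

lemma tree_connected:
  assumes "V \<noteq> {}" "V \<subset> {0..<n}"
  shows "\<exists>v\<in>V. T `` {v} - V \<noteq> {}"
proof (rule ccontr)
  assume "\<not> (\<exists>v\<in>V. T `` {v} - V \<noteq> {})"
  hence "T `` V \<subseteq> V" by auto
  hence c: "T\<^sup>* `` V = V" by (rule Image_closed_trancl)
  obtain a where a: "a \<in> V" using assms(1) by blast
  moreover obtain b where b: "b \<in> {0..<n} - V" using assms(2) by blast
  ultimately have ab: "a \<in> V" "b \<in> {0..<n} - V" by auto
  hence "(a, b) \<in> T\<^sup>*" using tree assms unfolding is_tree_def by auto
  thus False using c ab by auto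
qed

section \<open>Effect of a shift on the involution sum\<close>

text \<open>\<open>involution_sum_shift_diff\<close> reduces the difference to a sum over pairs from
  \<open>A\<close> and \<open>B\<close>; splitting \<open>W\<close> into the branch at
  \<open>x\<close> and the rest factors each summand into elements of the cone.\<close>

lemma shift_cone:
  fixes C :: "'a :: comm_ring_1 set" and X Q s :: 'a
  assumes C: "semiring_cone C" "X \<in> C" "Q \<in> C" "s \<in> C"
    and N: "N = T `` {last p} - {last (butlast p)}"
    and T': "T' = (T - ({last p} \<times> N \<union> N \<times> {last p})) \<union> ({hd p} \<times> N \<union> N \<times> {hd p})"
  defines "w \<equiv> \<lambda>G v. X + 1 - Q + Q * of_nat (vertex_degree G v)"
  shows "involution_sum T (Q * (s - 1)) (w T) {0..<n} - involution_sum T' (Q * (s - 1)) (w T') {0..<n} \<in> C"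
proof -
  define x where "x = hd p"
  define y where "y = last p"
  define z where "z = last (butlast p)"
  define W where "W = {0..<n} - {x, y}"
  define A where "A = T `` {x} - set p"
  define B where "B = T `` {y} - set p"
  \<comment> \<open>If the path is a single edge, \<open>P\<close> and \<open>S\<close> are empty;
    otherwise each consists of the one path neighbour of its end.\<close>
  define P where "P = T `` {x} \<inter> set p - {y}"
  define S where "S = T `` {y} \<inter> set p - {x}"
  define R where "R = W - branch"
  let ?Z = "involution_sum T (Q * (s - 1)) (w T)"
  note c = semiring_coneD[OF C(1)]
  have xp: "x \<in> set p" and yp: "y \<in> set p" using ends(3) by (auto simp: x_def y_def)
  have zp: "z \<in> set p" using nbrs_last_on_path by (auto simp: z_def)
  have xy: "x \<noteq> y" using ends_distinct by (simp add: x_def y_def)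
  have nx: "x \<notin> T `` {x}" and ny: "y \<notin> T `` {y}" using irreflT by (auto simp: irrefl_def)
  have NB: "N = B" unfolding N B_def y_def using nbrs_last_on_path by auto
  have Np: "N \<inter> set p = {}" unfolding NB B_def by auto
  have AB: "A \<inter> B = {}"
    using hd_nbrs_sub_branch last_nbrs_off_branch unfolding A_def B_def x_def y_def by blast
  have fin: "finite A" "finite B" unfolding A_def B_def using finite_nbrs by auto
  have V: "{0..<n} = insert x (insert y W)" using p_sub xp yp by (auto simp: W_def)
  have yN: "(y, v) \<in> T" if "v \<in> N" for v using that unfolding NB B_def by auto
  \<comment> \<open>\<open>N\<close> misses the neighbours of \<open>x\<close>, so the shift adds
    genuinely new edges and the degrees add up.\<close>
  have xN: "(x, v) \<notin> T" if "v \<in> N" for v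
    using that AB Np unfolding NB by (auto simp: A_def)
  have T'x: "T' `` {x} = T `` {x} \<union> N"
    unfolding T' using xy Np xp yp by (auto simp: x_def[symmetric] y_def[symmetric])
  have T'y: "T' `` {y} = {z}"
  proof -
    have "T' `` {y} = T `` {y} - N"
      unfolding T' using xy Np xp yp by (auto simp: x_def[symmetric] y_def[symmetric])
    also have "\<dots> = {z}" using nbrs_last_on_path unfolding N y_def z_def by auto
    finally show ?thesis .
  qed
  have TT': "(u, v) \<in> T' \<longleftrightarrow> (u, v) \<in> T" if "u \<notin> {x, y}" "v \<notin> {x, y}" for u v
    unfolding T' using that by (auto simp: x_def[symmetric] y_def[symmetric])
  have T'xy: "(x, y) \<in> T' \<longleftrightarrow> (x, y) \<in> T"
    unfolding T' using xy Np xp yp by (auto simp: x_def[symmetric] y_def[symmetric])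
  have symT': "sym T'"
    using symT unfolding T' by (auto simp: sym_def)
  \<comment> \<open>A vertex of \<open>N\<close> trades the neighbour \<open>y\<close> for
    \<open>x\<close>; all other vertices besides the ends keep their neighbours.\<close>
  have degW: "vertex_degree T' v = vertex_degree T v" if v: "v \<notin> {x, y}" for v
  proof (cases "v \<in> N")
    case False
    hence "T' `` {v} = T `` {v}"
      unfolding T' using v by (auto simp: x_def[symmetric] y_def[symmetric])
    thus ?thesis by (simp add: vertex_degree_def)
  next
    case True
    have "T' `` {v} = insert x (T `` {v} - {y})"
      unfolding T' using v True by (auto simp: x_def[symmetric] y_def[symmetric])
    moreover have "x \<notin> T `` {v}" using xN[OF True] T_commute by auto
    moreover have "y \<in> T `` {v}" using yN[OF True] T_commute by auto
    ultimately show ?thesis using finite_nbrs[of "{v}"] card_Suc_Diff1[of "T `` {v}" y]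
      unfolding vertex_degree_def by (simp only: card_insert_disjoint finite_Diff Diff_iff simp_thms)
  qed
  have degx: "vertex_degree T x = Suc (card A)"
  proof -
    have "T `` {x} = insert (p ! 1) A" "p ! 1 \<notin> A"
      using nbrs_hd_on_path by (auto simp: A_def x_def)
    thus ?thesis using fin by (simp add: vertex_degree_def)
  qed
  have degy: "vertex_degree T y = Suc (card B)"
  proof -
    have "T `` {y} = insert z B" "z \<notin> B"
      using nbrs_last_on_path by (auto simp: B_def y_def z_def)
    thus ?thesis using fin by (simp add: vertex_degree_def)
  qed
  have degx': "vertex_degree T' x = Suc (card A) + card B"
  proof -
    have "T `` {x} \<inter> B = {}" using xN NB by auto
    thus ?thesis unfolding vertex_degree_def T'x NB
      using degx fin finite_nbrs[of "{x}"] by (simp add: card_Un_disjoint vertex_degree_def)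
  qed
  have degy': "vertex_degree T' y = 1" by (simp add: vertex_degree_def T'y)
  have flipP: "flip ` P = S"
  proof -
    have "P = {p ! 1} - {y}" "S = {z} - {x}"
      using nbrs_hd_on_path nbrs_last_on_path unfolding P_def S_def x_def y_def z_def by auto
    moreover have "z = p ! (length p - 2)"
      by (simp only: z_def last_butlast)
    moreover have "p ! 1 = y \<longleftrightarrow> length p = 2" "p ! (length p - 2) = x \<longleftrightarrow> length p = 2"
      unfolding x_def y_def ends using len by (subst nth_eq; auto)+
    moreover have "flip (p ! 1) = p ! (length p - 2)" using len by (simp add: flip_nth numeral_2_eq_2)
    ultimately show ?thesis by (cases "length p = 2") simp_all
  qed
  have wT: "w T = (\<lambda>v. (\<lambda>d. X + 1 - Q + Q * of_nat d) (vertex_degree T v))" by (simp add: w_def)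
  have flipZ: "?Z (flip ` U) = ?Z U" if "U \<subseteq> W" for U
    using that involution_sum_flip[of U] unfolding wT W_def x_def y_def by simp
  have flipW: "flip ` W = W" using flip_off_ends unfolding W_def x_def y_def .
  \<comment> \<open>Deleting \<open>q\<close> and deleting \<open>flip q\<close> from a set
    invariant under \<open>flip\<close> give mirror images, whose involution sums agree.\<close>
  have refl: "(\<Sum>q\<in>P. ?Z (U - {q})) = (\<Sum>q\<in>S. ?Z (U - {q}))" if U: "U \<subseteq> W" "flip ` U = U" for U
  proof -
    have "(\<Sum>q\<in>S. ?Z (U - {q})) = (\<Sum>q\<in>P. ?Z (U - {flip q}))"
      unfolding flipP[symmetric] using inj_flip by (subst sum.reindex) (auto intro: inj_on_subset)
    also have "\<dots> = (\<Sum>q\<in>P. ?Z (flip ` (U - {q})))"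
      using U(2) inj_flip by (simp add: image_set_diff)
    also have "\<dots> = (\<Sum>q\<in>P. ?Z (U - {q}))"
      using U(1) by (intro sum.cong refl flipZ) auto
    finally show ?thesis by simp
  qed
  have "?Z {0..<n} - involution_sum T' (Q * (s - 1)) (w T') {0..<n} =
    (\<Sum>u\<in>A. \<Sum>v\<in>B. Q\<^sup>2 * (?Z W + (s - 1) * ?Z (W - {u}) + (s - 1) * ?Z (W - {v}) + (s - 1)\<^sup>2 * ?Z (W - {u} - {v})))"
    unfolding V
  \<comment> \<open>The path neighbour of each end contributes one to its degree and cancels the
    \<open>- Q\<close> of the weight, hence \<open>c = X + 1\<close>.\<close>
  proof (rule involution_sum_shift_diff[where P = P and S = S and c = "X + 1"])
    show "W \<inter> T `` {x} = A \<union> P" using sub nx xp yp by (auto simp: W_def A_def P_def)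
    show "W \<inter> T `` {y} = B \<union> S" using sub ny xp yp by (auto simp: W_def B_def S_def)
    show "W \<inter> T' `` {x} = A \<union> B \<union> P"
      unfolding T'x NB using sub nx xp yp by (auto simp: W_def A_def B_def P_def)
    have "S = {z} - {x}" using nbrs_last_on_path unfolding S_def y_def z_def by auto
    thus "W \<inter> T' `` {y} = S"
      unfolding T'y using zp p_sub nbrs_last_on_path ny by (auto simp: W_def y_def z_def)
    show "A \<inter> P = {}" "B \<inter> P = {}" "A \<inter> S = {}" "B \<inter> S = {}" by (auto simp: A_def B_def P_def S_def)
    show "involution_sum T' (Q * (s - 1)) (w T') U = ?Z U" if U: "U \<subseteq> W" for U
    proof (rule involution_sum_cong[OF _ symT symT'])
      show "finite U" using U by (rule finite_subset) (simp add: W_def)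
      show "w T' i = w T i" if "i \<in> U" for i
      proof -
        have "i \<notin> {x, y}" using that U by (auto simp: W_def)
        from degW[OF this] show ?thesis by (simp only: w_def)
      qed
      show "(i, j) \<in> T' \<longleftrightarrow> (i, j) \<in> T" if "i \<in> U" "j \<in> U" for i j
        using that U by (intro TT') (auto simp: W_def)
    qed
    show "(\<Sum>q\<in>P. ?Z (W - {q})) = (\<Sum>q\<in>S. ?Z (W - {q}))" using flipW by (intro refl) auto
    show "(\<Sum>q\<in>P. ?Z (W - {v} - {q})) = (\<Sum>q\<in>S. ?Z (W - {v} - {q}))" if "v \<in> B" for v
    proof (rule refl)
      have "flip v = v" using that by (simp add: B_def flip_off_path)
      thus "flip ` (W - {v}) = W - {v}" using flipW inj_flip by (simp add: image_set_diff)
    qed auto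
    show "w T x = X + 1 + Q * of_nat (card A)" "w T y = X + 1 + Q * of_nat (card B)"
      "w T' x = X + 1 + Q * of_nat (card A + card B)" "w T' y = X + 1"
      by (simp_all add: w_def degx degy degx' degy' algebra_simps)
  qed (simp_all add: W_def xy AB symT symT' T'xy)
  also have "\<dots> \<in> C"
  proof (intro semiring_cone_sum[OF C(1)])
    fix u v assume u: "u \<in> A" and v: "v \<in> B"
    have K: "branch \<subset> {0..<n}" "R \<subset> {0..<n}" using branch_sub xp p_sub by (auto simp: R_def W_def)
    have KW: "branch \<subseteq> W" using branch_sub xp yp by (auto simp: W_def)
    have uK: "u \<in> branch" using u hd_nbrs_sub_branch by (auto simp: A_def x_def)
    have vR: "v \<in> R" using v last_nbrs_off_branch sub xp yp by (auto simp: B_def y_def R_def W_def)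
    have fK: "finite branch" "finite R" using K by (auto intro: finite_subset[OF psubset_imp_subset])
    \<comment> \<open>No edge joins the branch to \<open>R\<close>, so involution sums over parts of
      the two sets factor.\<close>
    have prod: "?Z (K \<union> L) = ?Z K * ?Z L" if KL: "K \<subseteq> branch" "L \<subseteq> R" for K L
    proof (rule involution_sum_Un[OF _ _ symT])
      show "finite K" "finite L" using finite_subset[OF KL(1) fK(1)] finite_subset[OF KL(2) fK(2)] .
      show "K \<inter> L = {}" using KL by (auto simp: R_def)
      show "(i, j) \<notin> T" if "i \<in> K" "j \<in> L" for i j
        by (rule branch_closed) (use that KL in \<open>auto simp: R_def W_def x_def y_def\<close>)
    qed
    have 1: "?Z W = ?Z branch * ?Z R" "?Z (W - {u}) = ?Z (branch - {u}) * ?Z R"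
      "?Z (W - {v}) = ?Z branch * ?Z (R - {v})" "?Z (W - {u} - {v}) = ?Z (branch - {u}) * ?Z (R - {v})"
    proof -
      have "W = branch \<union> R" "W - {u} = (branch - {u}) \<union> R" "W - {v} = branch \<union> (R - {v})"
        "W - {u} - {v} = (branch - {u}) \<union> (R - {v})"
        using KW uK vR by (auto simp: R_def)
      thus "?Z W = ?Z branch * ?Z R" "?Z (W - {u}) = ?Z (branch - {u}) * ?Z R"
        "?Z (W - {v}) = ?Z branch * ?Z (R - {v})" "?Z (W - {u} - {v}) = ?Z (branch - {u}) * ?Z (R - {v})"
        by (simp_all only: prod Diff_subset subset_refl)
    qed
    have cone: "?Z U \<in> C \<and> (\<forall>v\<in>U. T `` {v} - U \<noteq> {} \<longrightarrow> ?Z U - ?Z (U - {v}) \<in> C)" if "U \<subset> {0..<n}" for U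
      by (rule involution_sum_cone[OF C _ symT finite_nbrs tree_connected _ that]) (auto simp: w_def)
    \<comment> \<open>\<open>x\<close> is a neighbour of \<open>u\<close> outside
      \<open>branch\<close>, and likewise \<open>y\<close> is a neighbour of \<open>v\<close>
      outside \<open>R\<close>; so the cone contains the differences for deleting \<open>u\<close>
      and \<open>v\<close>.\<close>
    have "x \<in> T `` {u} - branch" using u T_commute branch_sub xp by (auto simp: A_def)
    hence c1: "?Z branch - ?Z (branch - {u}) \<in> C" using cone[OF K(1)] uK by blast
    have "y \<in> T `` {v} - R" using v T_commute by (auto simp: B_def R_def W_def)
    hence c2: "?Z R - ?Z (R - {v}) \<in> C" using cone[OF K(2)] vR by blast
    have c3: "?Z (branch - {u}) \<in> C" "?Z (R - {v}) \<in> C"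
      using cone[of "branch - {u}"] cone[of "R - {v}"] K by auto
    \<comment> \<open>The four terms form the product of
      \<open>?Z branch + (s - 1) * ?Z (branch - {u})\<close> and its analogue for \<open>R\<close>
      and \<open>v\<close>. Each factor is a difference in \<open>C\<close> plus \<open>s\<close>
      times an element of \<open>C\<close>.\<close>
    have "Q\<^sup>2 * (?Z W + (s - 1) * ?Z (W - {u}) + (s - 1) * ?Z (W - {v}) + (s - 1)\<^sup>2 * ?Z (W - {u} - {v}))
      = Q * Q * ((?Z branch - ?Z (branch - {u}) + s * ?Z (branch - {u})) * (?Z R - ?Z (R - {v}) + s * ?Z (R - {v})))"
      unfolding 1 by (simp add: algebra_simps power2_eq_square)
    also have "\<dots> \<in> C" using c1 c2 c3 C by (intro c) auto
    finally show "Q\<^sup>2 * (?Z W + (s - 1) * ?Z (W - {u}) + (s - 1) * ?Z (W - {v}) + (s - 1)\<^sup>2 * ?Z (W - {u} - {v})) \<in> C" .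
  qed
  finally show ?thesis .
qed

end

section \<open>Cones of polynomials with non-negative coefficients\<close>

lemma semiring_cone_nonneg_polys_q2: "semiring_cone nonneg_polys_q2"
proof -
  have m: "f \<circ>\<^sub>p monom 1 2 \<in> nonneg_polys_q2" if "\<And>i. 0 \<le> coeff f i" for f :: "real poly"
    using that unfolding nonneg_polys_q2_def by blast
  have "a + b \<in> nonneg_polys_q2 \<and> a * b \<in> nonneg_polys_q2"
    if ab: "a \<in> nonneg_polys_q2" "b \<in> nonneg_polys_q2" for a b
  proof -
    obtain f g where fg: "a = f \<circ>\<^sub>p monom 1 2" "b = g \<circ>\<^sub>p monom 1 2"
      and nn: "\<And>i. 0 \<le> coeff f i" "\<And>i. 0 \<le> coeff g i"
      using ab unfolding nonneg_polys_q2_def by blast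
    have "0 \<le> coeff (f + g) i" for i using nn by simp
    moreover have "0 \<le> coeff (f * g) i" for i using nn by (auto simp: coeff_mult intro!: sum_nonneg)
    ultimately show ?thesis using m[of "f + g"] m[of "f * g"] unfolding fg by (simp add: pcompose_add pcompose_mult)
  qed
  moreover have "0 \<in> nonneg_polys_q2" using m[of 0] by simp
  moreover have "1 \<in> nonneg_polys_q2" using m[of 1] by (simp add: pcompose_1 coeff_1)
  ultimately show ?thesis unfolding semiring_cone_def by blast
qed

lemma q2_in_nonneg_polys_q2: "monom 1 2 \<in> nonneg_polys_q2"
proof -
  have "monom (1 :: real) 2 = [:0, 1:] \<circ>\<^sub>p monom 1 2" by (simp add: pcompose_pCons)
  moreover have "\<forall>i. 0 \<le> coeff [:0, 1 :: real:] i" by (auto simp: coeff_pCons split: nat.splits)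
  ultimately show ?thesis unfolding nonneg_polys_q2_def by blast
qed

definition poly_cone :: "'a :: comm_ring_1 set \<Rightarrow> 'a poly set" where
  "poly_cone C = {f. \<forall>i. coeff f i \<in> C}"

lemma semiring_cone_poly_cone:
  assumes "semiring_cone C"
  shows "semiring_cone (poly_cone C)"
  unfolding semiring_cone_def
proof (intro conjI ballI)
  note c = semiring_coneD[OF assms]
  show "0 \<in> poly_cone C" "1 \<in> poly_cone C" using c by (auto simp: poly_cone_def coeff_1)
  fix a b assume ab: "a \<in> poly_cone C" "b \<in> poly_cone C"
  show "a + b \<in> poly_cone C" using ab c by (auto simp: poly_cone_def)
  show "a * b \<in> poly_cone C"
    using ab by (auto simp: poly_cone_def coeff_mult intro!: semiring_cone_sum[OF assms] c)
qed

lemma pCons_in_poly_cone: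
  assumes "a \<in> C" "f \<in> poly_cone C"
  shows "pCons a f \<in> poly_cone C"
  using assms by (auto simp: poly_cone_def coeff_pCons split: nat.splits)

lemma zero_in_poly_cone: "0 \<in> C \<Longrightarrow> 0 \<in> poly_cone C"
  by (simp add: poly_cone_def)

text \<open>
  The innermost variable of the following polynomials is \<open>q\<close>, the next one is \<open>x\<close>, and the
  outermost variable \<open>s\<close> marks the parts equal to \<open>2\<close>: up to the factor \<open>2\<^sup>k\<close>, the coefficient of
  \<open>s\<^sup>k\<close> belongs to \<open>m\<^sub>\<lambda>\<close> with \<open>\<lambda> = 2\<^sup>k, 1\<^sup>n\<^sup>-\<^sup>2\<^sup>k\<close>.
\<close>

definition x_var :: "real poly poly poly" where "x_var = [:[:0, 1:]:]"
definition q2_var :: "real poly poly poly" where "q2_var = [:[:monom 1 2:]:]"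
definition s_var :: "real poly poly poly" where "s_var = [:0, 1:]"

section \<open>The generating function of a tree and its monotonicity\<close>

text \<open>Up to sign, the diagonal entry of \<open>x I - L\<close> with \<open>x\<close> replaced
  by \<open>- x\<close>; the signs in \<open>gen_char_coeff\<close> account for this change.\<close>

definition laplacian_weight :: "graph \<Rightarrow> nat \<Rightarrow> real poly poly poly" where
  "laplacian_weight T v = x_var + 1 - q2_var + q2_var * of_nat (vertex_degree T v)"

text \<open>The factor \<open>s_var - 1\<close> is chosen because the coefficient of
  \<open>s^k\<close> in \<open>(s - 1)^j\<close> is \<open>(-1)^(j - k) * (j choose k)\<close>, up
  to \<open>2 ^ k\<close> the class function value on an involution with \<open>j\<close>
  transpositions.\<close>

definition tree_gf :: "nat \<Rightarrow> graph \<Rightarrow> real poly poly poly" where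
  "tree_gf n T = involution_sum T (q2_var * (s_var - 1)) (laplacian_weight T) {0..<n}"

abbreviation (input) "nonneg_cone \<equiv> poly_cone (poly_cone nonneg_polys_q2)"

lemma semiring_cone_nonneg_cone: "semiring_cone nonneg_cone"
  by (intro semiring_cone_poly_cone semiring_cone_nonneg_polys_q2)

lemma variables_in_nonneg_cone: "x_var \<in> nonneg_cone" "q2_var \<in> nonneg_cone" "s_var \<in> nonneg_cone"
proof -
  note c0 = semiring_coneD(1,2)[OF semiring_cone_nonneg_polys_q2]
  note c1 = semiring_coneD(1,2)[OF semiring_cone_poly_cone[OF semiring_cone_nonneg_polys_q2]]
  show "x_var \<in> nonneg_cone" "q2_var \<in> nonneg_cone" "s_var \<in> nonneg_cone"
    unfolding x_var_def q2_var_def s_var_def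
    using c0 c1 semiring_coneD(2)[OF semiring_cone_nonneg_cone] q2_in_nonneg_polys_q2 by (auto intro!: pCons_in_poly_cone zero_in_poly_cone simp: one_pCons[symmetric])
qed

lemma tree_gf_iso:
  assumes T: "is_tree n T" and T': "is_tree n T'" and iso: "graph_iso n T T'"
  shows "tree_gf n T' = tree_gf n T"
proof -
  obtain f where f: "bij_betw f {0..<n} {0..<n}" "map_prod f f ` T = T'"
    using iso by (auto simp: graph_iso_def)
  have s: "sym T" "sym T'" and sub: "T \<subseteq> {0..<n} \<times> {0..<n}"
    using T T' by (auto simp: is_tree_def is_graph_def)
  have inj: "inj_on f {0..<n}" using f(1) by (simp add: bij_betw_def)
  have edge: "(f i, f j) \<in> T' \<longleftrightarrow> (i, j) \<in> T" if "i \<in> {0..<n}" "j \<in> {0..<n}" for i j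
  proof
    assume "(f i, f j) \<in> T'"
    then obtain a b where ab: "(a, b) \<in> T" "f i = f a" "f j = f b" using f(2) by auto
    hence "i = a" "j = b" using that sub inj_onD[OF inj] by (metis SigmaD1 SigmaD2 subsetD)+
    thus "(i, j) \<in> T" using ab by simp
  next
    assume "(i, j) \<in> T"
    thus "(f i, f j) \<in> T'" using f(2) by (metis map_prod_imageI)
  qed
  have deg: "vertex_degree T' (f i) = vertex_degree T i" if i: "i \<in> {0..<n}" for i
  proof -
    have "T' `` {f i} = f ` (T `` {i})"
    proof (intro equalityI subsetI)
      fix b assume "b \<in> T' `` {f i}"
      hence fb: "(f i, b) \<in> T'" by simp
      then obtain j where j: "b = f j" "j \<in> {0..<n}" using f(2) sub by auto
      thus "b \<in> f ` (T `` {i})" using edge[OF i] fb by auto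
    next
      fix b assume "b \<in> f ` (T `` {i})"
      then obtain j where "(i, j) \<in> T" "b = f j" by auto
      thus "b \<in> T' `` {f i}" using f(2) by (metis ImageI map_prod_imageI singletonI)
    qed
    moreover have "inj_on f (T `` {i})" using inj by (rule inj_on_subset) (use sub in auto)
    ultimately show ?thesis by (simp add: vertex_degree_def card_image)
  qed
  have "tree_gf n T' = involution_sum T' (q2_var * (s_var - 1)) (laplacian_weight T') (f ` {0..<n})"
    using f(1) by (simp only: tree_gf_def bij_betw_def)
  also have "\<dots> = tree_gf n T"
    unfolding tree_gf_def
    by (rule involution_sum_image[OF _ inj s]) (simp_all add: laplacian_weight_def deg edge)
  finally show ?thesis .
qed

lemma tree_gf_shift:
  assumes "is_tree n T" "gen_tree_shift T T'"
  shows "tree_gf n T - tree_gf n T' \<in> nonneg_cone"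
proof -
  obtain p where p: "is_path T p" "2 \<le> length p" "\<forall>v\<in>set p - {hd p, last p}. vertex_degree T v = 2"
    and T': "T' = (T - ({last p} \<times> (T `` {last p} - {last (butlast p)}) \<union> (T `` {last p} - {last (butlast p)}) \<times> {last p}))
      \<union> ({hd p} \<times> (T `` {last p} - {last (butlast p)}) \<union> (T `` {last p} - {last (butlast p)}) \<times> {hd p})"
    using assms(2) unfolding gen_tree_shift_def by blast
  interpret shift_path n T p using assms(1) p by unfold_locales auto
  show ?thesis
    unfolding tree_gf_def laplacian_weight_def[abs_def]
    by (rule shift_cone[OF semiring_cone_nonneg_cone variables_in_nonneg_cone refl T'])
qed

lemma tree_class_elements:
  assumes "K \<in> tree_classes n" "T \<in> K" "T' \<in> K"
  shows "is_tree n T" "tree_gf n T = tree_gf n T'"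
proof -
  obtain T0 where T0: "is_tree n T0" "K = iso_class n T0" using assms(1) by (auto simp: tree_classes_def)
  show "is_tree n T" using assms T0 by (auto simp: iso_class_def)
  show "tree_gf n T = tree_gf n T'"
    using assms T0 tree_gf_iso[OF T0(1), of T] tree_gf_iso[OF T0(1), of T'] by (auto simp: iso_class_def)
qed

lemma self_in_iso_class: "is_tree n T \<Longrightarrow> T \<in> iso_class n T"
  by (auto simp: iso_class_def graph_iso_def intro!: exI[of _ id] simp: map_prod.id)

text \<open>The differences along a chain of shifts add up in the cone. Consecutive shifts may use
  different representatives of a class, so the induction claims the result for all of them and
  relies on invariance under isomorphism.\<close>

lemma tree_gf_mono:
  assumes le: "gts_le n K K'" and T: "T \<in> K" "T' \<in> K'" and K: "K \<in> tree_classes n"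
  shows "tree_gf n T - tree_gf n T' \<in> nonneg_cone"
proof -
  note c = semiring_coneD[OF semiring_cone_nonneg_cone]
  have "K' \<in> tree_classes n \<and> (\<forall>T\<in>K. \<forall>T'\<in>K'. tree_gf n T - tree_gf n T' \<in> nonneg_cone)"
    using le unfolding gts_le_def
  proof (induction rule: rtranclp_induct)
    case base
    have "tree_gf n T - tree_gf n T' \<in> nonneg_cone" if "T \<in> K" "T' \<in> K" for T T'
      unfolding tree_class_elements(2)[OF K that] by (simp add: c(1))
    thus ?case using K by (intro conjI ballI)
  next
    case (step L M)
    from step.hyps(2) obtain A B where AB: "L \<in> tree_classes n" "M \<in> tree_classes n" "A \<in> L" "B \<in> M" "gen_tree_shift A B"
      by (elim conjE bexE)
    have "tree_gf n T - tree_gf n T' \<in> nonneg_cone" if "T \<in> K" "T' \<in> M" for T T'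
    proof -
      have "tree_gf n T - tree_gf n A \<in> nonneg_cone" using bspec[OF bspec[OF conjunct2[OF step.IH] that(1)] AB(3)] .
      moreover have "tree_gf n A - tree_gf n B \<in> nonneg_cone"
        by (rule tree_gf_shift[OF tree_class_elements(1)[OF AB(1,3,3)] AB(5)])
      ultimately have "(tree_gf n T - tree_gf n A) + (tree_gf n A - tree_gf n B) \<in> nonneg_cone" by (rule c(3))
      thus ?thesis unfolding tree_class_elements(2)[OF AB(2,4) that(2)] by simp
    qed
    thus ?case using AB(2) by (intro conjI ballI)
  qed
  thus ?thesis using T by (elim conjE) (drule (1) bspec)+
qed

section \<open>Generalized matrix functions of trees\<close>

text \<open>An orbit with at least three elements would list the vertices of a cycle in
  \<open>T\<close>.\<close>

lemma tree_permutation_involutive: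
  assumes tree: "is_tree n T" and p: "\<psi> permutes {0..<n}" and e: "\<And>i. \<psi> i \<noteq> i \<Longrightarrow> (i, \<psi> i) \<in> T"
  shows "\<psi> (\<psi> i) = i"
proof (rule ccontr)
  assume ne: "\<psi> (\<psi> i) \<noteq> i"
  have P: "permutation \<psi>" using p by (auto simp: permutation_permutes)
  define c where "c = card (orbit \<psi> i)"
  note iff = funpow_eq_iff_cong_card_orbit[OF P, where x = i, folded c_def]
  have "c \<noteq> 0"
    unfolding c_def using finite_orbit[OF permutation_self_in_orbit[OF P]] orbit_nonempty by simp
  moreover have "c \<noteq> 1" using iff[of 2 0] ne by (auto simp: numeral_2_eq_2)
  moreover have "c \<noteq> 2" using iff[of 2 0] ne by (auto simp: numeral_2_eq_2)
  ultimately have c: "c \<ge> 3" by simp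
  let ?l = "map (\<lambda>k. (\<psi> ^^ k) i) [0..<c]"
  have step: "((\<psi> ^^ k) i, (\<psi> ^^ Suc k) i) \<in> T" for k
  proof -
    have "Suc k mod c \<noteq> k mod c" using c by (auto simp: mod_Suc)
    hence "\<psi> ((\<psi> ^^ k) i) \<noteq> (\<psi> ^^ k) i" using iff[of "Suc k" k] by simp
    thus ?thesis using e by simp
  qed
  have "distinct ?l"
    unfolding distinct_map by (auto simp: inj_on_def iff)
  moreover have "successively (\<lambda>u v. (u, v) \<in> T) ?l"
    using step by (auto simp: successively_conv_nth)
  moreover have "(last ?l, hd ?l) \<in> T"
  proof -
    have "last ?l = (\<psi> ^^ (c - 1)) i" "hd ?l = i" using c by (auto simp: last_map hd_map)
    moreover have "(\<psi> ^^ Suc (c - 1)) i = (\<psi> ^^ 0) i" unfolding iff using c by simp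
    ultimately show ?thesis using step[of "c - 1"] by simp
  qed
  ultimately have "is_cycle T ?l" using c unfolding is_cycle_def is_path_def by simp
  thus False using tree by (auto simp: is_tree_def)
qed

text \<open>The products are related by substituting \<open>- x\<close> for \<open>x\<close>, which
  also changes the sign of each of the \<open>card S\<close> factors.\<close>

lemma coeff_prod_linear_neg:
  fixes l :: "nat \<Rightarrow> 'a :: comm_ring_1"
  assumes "finite S"
  shows "coeff (\<Prod>i\<in>S. [:- l i, 1:]) m = (-1) ^ (card S + m) * coeff (\<Prod>i\<in>S. [:l i, 1:]) m"
  using assms
proof (induction S arbitrary: m rule: finite_induct)
  case empty
  show ?case by (cases m) auto
next
  case (insert a S)
  thus ?case by (cases m) (auto simp: algebra_simps)
qed

section \<open>Matrix entries and their products along permutations\<close>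

lemma x_minus_q_laplacian_diag:
  assumes "is_tree n T" "i < n"
  shows "x_minus n (q_laplacian n T) $$ (i, i) = [:- (1 - monom 1 2 + monom 1 2 * of_nat (vertex_degree T i)), 1:]"
proof -
  have "(i, i) \<notin> T" using assms by (auto simp: is_tree_def is_graph_def irrefl_def)
  moreover have "[:0, 1:] ^ 2 = (monom 1 2 :: real poly)" by (simp add: monom_altdef)
  ultimately show ?thesis using assms(2)
    by (simp add: x_minus_def q_laplacian_def degree_mat_def adjacency_mat_def Let_def algebra_simps)
qed

lemma x_minus_q_laplacian_off_diag:
  assumes "i < n" "j < n" "i \<noteq> j"
  shows "x_minus n (q_laplacian n T) $$ (i, j) = (if (i, j) \<in> T then [:[:0, 1:]:] else 0)"
  using assms by (simp add: x_minus_def q_laplacian_def degree_mat_def adjacency_mat_def Let_def)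

lemma edge_involution_facts:
  assumes "\<psi> \<in> edge_involutions T {0..<n}"
  shows "\<psi> permutes {0..<n}" "\<And>i. \<psi> (\<psi> i) = i" "\<And>i. \<psi> i \<noteq> i \<Longrightarrow> (i, \<psi> i) \<in> T"
  using assms by (auto simp: edge_involutions_def)

definition laplacian_entry :: "graph \<Rightarrow> nat \<Rightarrow> real poly" where
  "laplacian_entry T i = 1 - monom 1 2 + monom 1 2 * of_nat (vertex_degree T i)"

text \<open>The entries of \<open>x I - L\<close> on edges are \<open>q\<close>, so each
  transposition contributes \<open>q^2\<close>; fixed points contribute the diagonal
  entries.\<close>

lemma prod_x_minus_q_laplacian:
  assumes T: "is_tree n T" and \<psi>: "\<psi> \<in> edge_involutions T {0..<n}"
  shows "(\<Prod>i = 0..<n. x_minus n (q_laplacian n T) $$ (i, \<psi> i))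
    = [:monom 1 2 ^ card {i. i < \<psi> i}:] * (\<Prod>i | i \<in> {0..<n} \<and> \<psi> i = i. [:- laplacian_entry T i, 1:])"
proof -
  note p = edge_involution_facts[OF \<psi>]
  let ?F = "{i \<in> {0..<n}. \<psi> i = i}" and ?M = "{i \<in> {0..<n}. \<psi> i \<noteq> i}"
  have cardM: "card ?M = 2 * card {i. i < \<psi> i}"
  proof -
    have "{0..<n} = ?F \<union> ?M" by auto
    hence "n = card ?F + card ?M" by (metis (no_types, lifting) card_Un_disjoint card_atLeastLessThan diff_zero
        disjoint_iff finite_Un finite_atLeastLessThan mem_Collect_eq)
    thus ?thesis using cycle_type_involution(1,3)[OF p(1,2)] by simp
  qed
  have "(\<Prod>i = 0..<n. x_minus n (q_laplacian n T) $$ (i, \<psi> i))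
    = (\<Prod>i\<in>?F. x_minus n (q_laplacian n T) $$ (i, \<psi> i)) * (\<Prod>i\<in>?M. x_minus n (q_laplacian n T) $$ (i, \<psi> i))"
    by (subst prod.union_disjoint[symmetric]) (auto intro!: prod.cong)
  also have "(\<Prod>i\<in>?F. x_minus n (q_laplacian n T) $$ (i, \<psi> i)) = (\<Prod>i\<in>?F. [:- laplacian_entry T i, 1:])"
    using x_minus_q_laplacian_diag[OF T] by (intro prod.cong) (auto simp: laplacian_entry_def)
  also have "(\<Prod>i\<in>?M. x_minus n (q_laplacian n T) $$ (i, \<psi> i)) = (\<Prod>i\<in>?M. [:[:0, 1:]:])"
  proof (rule prod.cong[OF refl])
    fix i assume i: "i \<in> ?M"
    have "\<psi> i < n" using permutes_in_image[OF p(1), of i] i by simp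
    thus "x_minus n (q_laplacian n T) $$ (i, \<psi> i) = [:[:0, 1:]:]"
      using i p(3)[of i] by (subst x_minus_q_laplacian_off_diag) auto
  qed
  also have "\<dots> = [:monom 1 2 ^ card {i. i < \<psi> i}:]"
  proof -
    have "[:[:0, 1:]:] ^ 2 = [:monom 1 2 :: real poly:]" by (simp add: monom_altdef power2_eq_square)
    thus ?thesis by (simp only: prod_constant cardM power_mult poly_const_pow)
  qed
  finally show ?thesis by (simp only: mult.commute)
qed

text \<open>A permutation that moves some vertex along a non-edge has a zero factor, and any other
  one is an involution because \<open>T\<close> has no cycles.\<close>

lemma gen_char_poly_tree:
  assumes T: "is_tree n T"
  shows "gen_char_poly n \<gamma> (q_laplacian n T) =
    (\<Sum>\<psi>\<in>edge_involutions T {0..<n}. [:[:of_rat (frobenius_ch_inv n \<gamma> \<psi>):]:] *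
       ([:monom 1 2 ^ card {i. i < \<psi> i}:] * (\<Prod>i | i \<in> {0..<n} \<and> \<psi> i = i. [:- laplacian_entry T i, 1:])))"
proof -
  let ?M = "x_minus n (q_laplacian n T)"
  have "gen_char_poly n \<gamma> (q_laplacian n T) = (\<Sum>\<psi>\<in>edge_involutions T {0..<n}.
      [:[:of_rat (frobenius_ch_inv n \<gamma> \<psi>):]:] * (\<Prod>i = 0..<n. ?M $$ (i, \<psi> i)))"
    unfolding gen_char_poly_def gen_matrix_fun_def
  proof (rule sum.mono_neutral_right)
    show "finite {\<psi>. \<psi> permutes {0..<n}}" by (simp add: finite_permutations)
    show "edge_involutions T {0..<n} \<subseteq> {\<psi>. \<psi> permutes {0..<n}}" by (auto simp: edge_involutions_def)
    show "\<forall>\<psi>\<in>{\<psi>. \<psi> permutes {0..<n}} - edge_involutions T {0..<n}.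
      [:[:of_rat (frobenius_ch_inv n \<gamma> \<psi>):]:] * (\<Prod>i = 0..<n. ?M $$ (i, \<psi> i)) = 0"
    proof
      fix \<psi> assume "\<psi> \<in> {\<psi>. \<psi> permutes {0..<n}} - edge_involutions T {0..<n}"
      hence p: "\<psi> permutes {0..<n}" and ne: "\<psi> \<notin> edge_involutions T {0..<n}" by auto
      have "\<exists>i. \<psi> i \<noteq> i \<and> (i, \<psi> i) \<notin> T"
        using tree_permutation_involutive[OF T p] p ne unfolding edge_involutions_def by blast
      then obtain i where i: "\<psi> i \<noteq> i" "(i, \<psi> i) \<notin> T" by blast
      hence lt: "i \<in> {0..<n}" using p by (auto simp: permutes_def)
      hence "\<psi> i < n" using permutes_in_image[OF p, of i] by simp
      hence "?M $$ (i, \<psi> i) = 0" using i lt by (subst x_minus_q_laplacian_off_diag) auto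
      hence "(\<Prod>i = 0..<n. ?M $$ (i, \<psi> i)) = 0" using lt by (intro prod_zero) auto
      thus "[:[:of_rat (frobenius_ch_inv n \<gamma> \<psi>):]:] * (\<Prod>i = 0..<n. ?M $$ (i, \<psi> i)) = 0" by simp
    qed
  qed
  also have "\<dots> = (\<Sum>\<psi>\<in>edge_involutions T {0..<n}. [:[:of_rat (frobenius_ch_inv n \<gamma> \<psi>):]:] *
       ([:monom 1 2 ^ card {i. i < \<psi> i}:] * (\<Prod>i | i \<in> {0..<n} \<and> \<psi> i = i. [:- laplacian_entry T i, 1:])))"
    using prod_x_minus_q_laplacian[OF T] by (intro sum.cong refl arg_cong2[of _ _ _ _ "(*)"])
  finally show ?thesis .
qed

lemma gen_char_poly_tree_zero:
  assumes "is_tree n T" "is_partition n \<mu>" "\<nexists>k. 2 * k \<le> n \<and> \<mu> = two_one n k"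
  shows "gen_char_poly n (monomial_sym \<mu>) (q_laplacian n T) = 0"
  unfolding gen_char_poly_tree[OF assms(1)]
proof (rule sum.neutral, rule ballI)
  fix \<psi> assume "\<psi> \<in> edge_involutions T {0..<n}"
  hence "frobenius_ch_inv n (monomial_sym \<mu>) \<psi> = 0"
    using frobenius_ch_inv_monomial_involution(2)[OF assms(2) _ _ assms(3)] edge_involution_facts by blast
  thus "[:[:of_rat (frobenius_ch_inv n (monomial_sym \<mu>) \<psi>):]:] *
       ([:monom 1 2 ^ card {i. i < \<psi> i}:] * (\<Prod>i | i \<in> {0..<n} \<and> \<psi> i = i. [:- laplacian_entry T i, 1:])) = 0"
    by simp
qed

section \<open>Coefficients read off the generating function\<close>

text \<open>Only the power of \<open>s_var - 1\<close>, one factor per transposition, involves the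
  outermost variable; everything else is constant in it.\<close>

lemma coeff_tree_gf:
  "coeff (tree_gf n T) k = (\<Sum>\<psi>\<in>edge_involutions T {0..<n}.
      of_int (int (card {i. i < \<psi> i} choose k) * (-1) ^ (card {i. i < \<psi> i} - k)) *
      ([:monom 1 2 ^ card {i. i < \<psi> i}:] * (\<Prod>i | i \<in> {0..<n} \<and> \<psi> i = i. [:laplacian_entry T i, 1:])))"
  unfolding tree_gf_def involution_sum_def coeff_sum
proof (rule sum.cong[OF refl])
  fix \<psi> assume "\<psi> \<in> edge_involutions T {0..<n}"
  note p = edge_involution_facts[OF this]
  let ?F = "{i \<in> {0..<n}. \<psi> i = i}" and ?U = "{i. i < \<psi> i}"
  let ?t = "q2_var * (s_var - 1)"
  define j where "j = card ?U"
  have U: "?U \<subseteq> {0..<n}" using p(1) by (auto simp: permutes_def not_less[symmetric])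
  have w: "laplacian_weight T i = [:[:laplacian_entry T i, 1:]:]" for i
    by (simp add: laplacian_weight_def laplacian_entry_def x_var_def q2_var_def of_nat_poly one_pCons)
  have "(\<Prod>i = 0..<n. if \<psi> i = i then laplacian_weight T i else if i < \<psi> i then ?t else 1)
    = (\<Prod>i = 0..<n. (if \<psi> i = i then laplacian_weight T i else 1) * (if i < \<psi> i then ?t else 1))"
    by (rule prod.cong) auto
  also have "\<dots> = (\<Prod>i\<in>?F. laplacian_weight T i) * (\<Prod>i\<in>{i\<in>{0..<n}. i < \<psi> i}. ?t)"
    by (subst prod.distrib, simp only: prod.inter_filter finite_atLeastLessThan)
  also have "{i\<in>{0..<n}. i < \<psi> i} = ?U" using U by auto
  also have "(\<Prod>i\<in>?U. ?t) = q2_var ^ j * [:-1, 1:] ^ j"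
  proof -
    have "s_var - 1 = [:-1, 1:]" by (simp add: s_var_def one_pCons)
    thus ?thesis by (simp only: prod_constant j_def power_mult_distrib)
  qed
  also have "q2_var ^ j = [:[:monom 1 2 ^ j:]:]" by (simp add: q2_var_def poly_const_pow)
  also have "(\<Prod>i\<in>?F. laplacian_weight T i) = [:\<Prod>i\<in>?F. [:laplacian_entry T i, 1:]:]"
  proof -
    have "(\<Prod>i\<in>S. [:f i:]) = [:\<Prod>i\<in>S. f i:]" for S :: "nat set" and f :: "nat \<Rightarrow> real poly poly"
      by (induct S rule: infinite_finite_induct) (auto simp: one_pCons)
    thus ?thesis unfolding w .
  qed
  finally have "coeff (\<Prod>i = 0..<n. if \<psi> i = i then laplacian_weight T i else if i < \<psi> i then ?t else 1) k
     = (\<Prod>i\<in>?F. [:laplacian_entry T i, 1:]) * ([:monom 1 2 ^ j:] * coeff ([:-1, 1:] ^ j) k)"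
    by simp
  also have "coeff ([:-1, 1:] ^ j) k = (of_int (int (j choose k) * (-1) ^ (j - k)) :: real poly poly)"
  \<comment> \<open>For \<open>k > j\<close> the binomial is 0, so the truncated exponent
    \<open>j - k\<close> does not matter.\<close>
  proof (cases "k \<le> j")
    case False
    hence "degree ([:-1, 1 :: real poly poly:] ^ j) < k"
      using degree_power_le[of "[:-1, 1 :: real poly poly:]" j] by simp
    thus ?thesis using False by (simp add: coeff_eq_0)
  qed (simp add: coeff_linear_poly_power)
  finally show "coeff (\<Prod>i = 0..<n. if \<psi> i = i then laplacian_weight T i else if i < \<psi> i then ?t else 1) k =
      of_int (int (card ?U choose k) * (-1) ^ (card ?U - k)) * ([:monom 1 2 ^ card ?U:] * (\<Prod>i\<in>?F. [:laplacian_entry T i, 1:]))"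
    unfolding j_def by (simp only: mult_ac)
qed

text \<open>Holds involution by involution: the class value supplies \<open>2 ^ k\<close> times the
  coefficient of \<open>s^k\<close>, and the sign \<open>(-1) ^ r\<close> undoes the passage from
  \<open>x\<close> to \<open>- x\<close>.\<close>

lemma gen_char_coeff_tree:
  assumes T: "is_tree n T" and k: "2 * k \<le> n" and r: "r \<le> n"
  shows "gen_char_coeff n (monomial_sym (two_one n k)) (q_laplacian n T) r = 2 ^ k * coeff (coeff (tree_gf n T) k) (n - r)"
proof -
  let ?I = "edge_involutions T {0..<n}"
  let ?g = "\<lambda>\<psi>. frobenius_ch_inv n (monomial_sym (two_one n k)) \<psi>"
  let ?j = "\<lambda>\<psi> :: nat \<Rightarrow> nat. card {i. i < \<psi> i}"
  let ?F = "\<lambda>\<psi>. {i \<in> {0..<n}. \<psi> i = i}"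
  have "(-1) ^ r * coeff ([:[:of_rat (?g \<psi>):]:] * ([:monom 1 2 ^ ?j \<psi>:] * (\<Prod>i\<in>?F \<psi>. [:- laplacian_entry T i, 1:]))) (n - r)
    = 2 ^ k * coeff (of_int (int (?j \<psi> choose k) * (-1) ^ (?j \<psi> - k)) *
        ([:monom 1 2 ^ ?j \<psi>:] * (\<Prod>i\<in>?F \<psi>. [:laplacian_entry T i, 1:]))) (n - r)"
    if "\<psi> \<in> ?I" for \<psi>
  proof -
    note p = edge_involution_facts[OF that]
    define a where "a = int (?j \<psi> choose k) * (-1) ^ (?j \<psi> - k)"
    have "?g \<psi> = 2 ^ k * of_int a"
      using frobenius_ch_inv_monomial_involution(1)[OF is_partition_two_one[OF k] p(1,2) refl k]
      by (simp add: a_def)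
    hence g: "[:of_rat (?g \<psi>) :: real:] = 2 ^ k * of_int a"
      by (simp add: of_rat_mult of_rat_power of_int_poly numeral_poly poly_const_pow)
    have j: "2 * ?j \<psi> \<le> n" "card (?F \<psi>) = n - 2 * ?j \<psi>" using cycle_type_involution(1,3)[OF p(1,2)] by auto
    \<comment> \<open>An involution with \<open>j\<close> transpositions has
      \<open>n - 2 * j\<close> fixed points, so the total exponent is even.\<close>
    have sgn: "(-1) ^ r * (-1) ^ (card (?F \<psi>) + (n - r)) = (1 :: real poly)"
    proof -
      have "r + (card (?F \<psi>) + (n - r)) = 2 * (n - ?j \<psi>)" using j r by simp
      thus ?thesis by (metis power_add power_mult power_minus1_even power2_minus one_power2 power_one)
    qed
    have "(-1) ^ r * coeff ([:[:of_rat (?g \<psi>):]:] * ([:monom 1 2 ^ ?j \<psi>:] * (\<Prod>i\<in>?F \<psi>. [:- laplacian_entry T i, 1:]))) (n - r)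
      = (-1) ^ r * (2 ^ k * of_int a * (monom 1 2 ^ ?j \<psi> * ((-1) ^ (card (?F \<psi>) + (n - r)) * coeff (\<Prod>i\<in>?F \<psi>. [:laplacian_entry T i, 1:]) (n - r))))"
      by (simp add: g coeff_prod_linear_neg)
    also have "\<dots> = ((-1) ^ r * (-1) ^ (card (?F \<psi>) + (n - r))) *
        (2 ^ k * of_int a * (monom 1 2 ^ ?j \<psi> * coeff (\<Prod>i\<in>?F \<psi>. [:laplacian_entry T i, 1:]) (n - r)))"
      by (simp only: mult_ac)
    also have "\<dots> = 2 ^ k * (of_int a * (monom 1 2 ^ ?j \<psi> * coeff (\<Prod>i\<in>?F \<psi>. [:laplacian_entry T i, 1:]) (n - r)))"
      unfolding sgn by (simp only: mult_1_left mult.assoc)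
    also have "\<dots> = 2 ^ k * coeff (of_int a * ([:monom 1 2 ^ ?j \<psi>:] * (\<Prod>i\<in>?F \<psi>. [:laplacian_entry T i, 1:]))) (n - r)"
      by (simp add: of_int_poly[where 'a = "real poly"])
    finally show ?thesis unfolding a_def .
  qed
  thus ?thesis
    unfolding gen_char_coeff_def gen_char_poly_tree[OF T] coeff_tree_gf coeff_sum sum_distrib_left
    by (rule sum.cong[OF refl])
qed

theorem theorem1:
  fixes n :: nat and T\<^sub>1 T\<^sub>2 :: graph
  assumes "1 \<le> n"
    and "is_tree n T\<^sub>1" and "is_tree n T\<^sub>2"
    and "gts_covers n (iso_class n T\<^sub>2) (iso_class n T\<^sub>1)"
  shows "(\<forall>\<mu>. is_partition n \<mu> \<longrightarrow> (\<forall>r\<le>n.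
            gen_char_coeff n (monomial_sym \<mu>) (q_laplacian n T\<^sub>1) r
          - gen_char_coeff n (monomial_sym \<mu>) (q_laplacian n T\<^sub>2) r \<in> nonneg_polys_q2)) \<and>
         (\<forall>\<mu>. is_partition n \<mu> \<longrightarrow>
            (\<nexists>k. 2 * k \<le> n \<and> \<mu> = replicate_mset k 2 + replicate_mset (n - 2 * k) 1) \<longrightarrow>
            gen_char_poly n (monomial_sym \<mu>) (q_laplacian n T\<^sub>1) = 0 \<and>
            gen_char_poly n (monomial_sym \<mu>) (q_laplacian n T\<^sub>2) = 0)"
proof (intro conjI allI impI)
  fix \<mu> r assume \<mu>: "is_partition n \<mu>" and r: "r \<le> n"
  let ?c = "\<lambda>T. gen_char_coeff n (monomial_sym \<mu>) (q_laplacian n T) r"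
  note cone = semiring_coneD[OF semiring_cone_nonneg_polys_q2]
  show "?c T\<^sub>1 - ?c T\<^sub>2 \<in> nonneg_polys_q2"
  proof (cases "\<exists>k. 2 * k \<le> n \<and> \<mu> = two_one n k")
    case True
    then obtain k where k: "2 * k \<le> n" "\<mu> = two_one n k" by blast
    have "iso_class n T\<^sub>1 \<in> tree_classes n" using assms(2) by (auto simp: tree_classes_def)
    moreover have "gts_le n (iso_class n T\<^sub>1) (iso_class n T\<^sub>2)"
      using assms(4) by (simp add: gts_covers_def gts_less_def)
    ultimately have "tree_gf n T\<^sub>1 - tree_gf n T\<^sub>2 \<in> nonneg_cone"
      using tree_gf_mono self_in_iso_class assms(2,3) by blast
    \<comment> \<open>The coefficient of \<open>s^k\<close> is taken first, then that of
      \<open>x^(n - r)\<close>; what remains lies in the innermost cone of polynomials in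
      \<open>q^2\<close>.\<close>
    hence "coeff (coeff (tree_gf n T\<^sub>1 - tree_gf n T\<^sub>2) k) (n - r) \<in> nonneg_polys_q2"
      by (simp add: poly_cone_def)
    hence "of_nat (2 ^ k) * coeff (coeff (tree_gf n T\<^sub>1 - tree_gf n T\<^sub>2) k) (n - r) \<in> nonneg_polys_q2"
      by (rule cone(4)[OF cone(5)])
    thus ?thesis
      unfolding k(2) gen_char_coeff_tree[OF assms(2) k(1) r] gen_char_coeff_tree[OF assms(3) k(1) r]
      by (simp add: right_diff_distrib)
  next
    case False
    hence "?c T\<^sub>1 = 0" "?c T\<^sub>2 = 0"
      using gen_char_poly_tree_zero[OF assms(2) \<mu>] gen_char_poly_tree_zero[OF assms(3) \<mu>]
      by (simp_all add: gen_char_coeff_def)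
    thus ?thesis using cone(1) by simp
  qed
next
  fix \<mu> assume \<mu>: "is_partition n \<mu>"
    and "\<nexists>k. 2 * k \<le> n \<and> \<mu> = replicate_mset k 2 + replicate_mset (n - 2 * k) 1"
  hence no: "\<nexists>k. 2 * k \<le> n \<and> \<mu> = two_one n k" by (simp add: two_one_def)
  show "gen_char_poly n (monomial_sym \<mu>) (q_laplacian n T\<^sub>1) = 0"
    by (rule gen_char_poly_tree_zero[OF assms(2) \<mu> no])
  show "gen_char_poly n (monomial_sym \<mu>) (q_laplacian n T\<^sub>2) = 0"
    by (rule gen_char_poly_tree_zero[OF assms(3) \<mu> no])
qed

end
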